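(* There exist two absolute constants $\lambda_2>\lambda_1>0$ such that the following holds. Let $m>3$ be an integer, let $\eta_0\in\mathcal{H}_{DW}$ with $\rho^{1/2}\partial_\theta\eta_0\in H^m(\mathbb{T})$, $\eta_0\neq0$, and suppose $\langle-L\eta_0,\eta_0\rangle_\rho\ge0$. Let $\eta$ be the unique global classical odd solution of $$\partial_t\eta+L\eta=0,\qquad \partial_\theta v=H\eta,\qquad \eta(0,\theta)=\eta_0(\theta),\qquad v(t,0)=0$$ with $\eta\in C([0,T];\mathcal{H}_{DW})$ and $\rho^{1/2}\partial_\theta\eta\in C([0,T];H^m(\mathbb{T}))\cap C^2([0,T];H^{m-2}(\mathbb{T}))$ for every $T>0$. Then for all $0<t<\infty$, $$0<J_1^{1/2}(t)<\|\eta(t)\|_{\mathcal{H}_{DW}}<J_2^{1/2}(t),$$ where, for $i=1,2$, $$J_i(t)=\frac{\langle\eta_0,\eta_0\rangle_\rho+\frac{1}{\sqrt{\lambda_i}}\langle-L\eta_0,\eta_0\rangle_\rho}{2}\,e^{2\sqrt{\lambda_i}\,t}+\frac{\langle\eta_0,\eta_0\rangle_\rho-\frac{1}{\sqrt{\lambda_i}}\langle-L\eta_0,\eta_0\rangle_\rho}{2}\,e^{-2\sqrt{\lambda_i}\,t}.$$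
   Context: $\mathbb{T}=[-\pi,\pi]$ is the torus (functions are $2\pi$-periodic); $H^m(\mathbb{T})$ is the periodic Sobolev space. $H$ is the periodic Hilbert transform, $Hf(\theta)=\frac{1}{2\pi}\,\mathrm{P.V.}\int_{-\pi}^{\pi}\cot\frac{\theta-\phi}{2}f(\phi)\,d\phi$, so $H\sin k\theta=-\cos k\theta$ and $H\cos k\theta=\sin k\theta$ for $k\ge1$. Given $\eta$, the function $v$ is determined by $\partial_\theta v=H\eta$ and $v(\cdot,0)=0$, and $$L\eta=\tfrac12\sin2\theta\,\partial_\theta\eta-\cos2\theta\,\eta+\sin2\theta\,H\eta-2\cos2\theta\,v.$$ The weight is $\rho=\frac{1}{4\pi\sin^2\theta}$, and $\rho^{1/2}$ denotes $\frac{1}{2\sqrt{\pi}\,\sin\theta}$. The space $\mathcal{H}_{DW}=\{\eta\in H^1(\mathbb{T}):\eta\text{ odd},\ \int_{\mathbb{T}}\frac{|\partial_\theta\eta|^2}{\sin^2\theta}\,d\theta<\infty\}$ is a Hilbert space with inner product $\langle\xi,\eta\rangle_\rho=\int_{-\pi}^{\pi}\rho\,\partial_\theta\xi\,\partial_\theta\eta\,d\theta$ and norm $\|\eta\|_{\mathcal{H}_{DW}}=\langle\eta,\eta\rangle_\rho^{1/2}$. For every $\eta_0$ satisfying the stated regularity hypotheses the solution $\eta$ in the claim exists and is unique. *)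

theory Defs
  imports "HOL-Analysis.Analysis"
begin

text \<open>
  Functions on the torus are \<open>2\<pi>\<close>-periodic functions \<open>real \<Rightarrow> real\<close>.
\<close>

definition periodic :: "(real \<Rightarrow> real) \<Rightarrow> bool" where
  "periodic f \<longleftrightarrow> (\<forall>\<theta>. f (\<theta> + 2 * pi) = f \<theta>)"

definition odd_fun :: "(real \<Rightarrow> real) \<Rightarrow> bool" where
  "odd_fun f \<longleftrightarrow> (\<forall>\<theta>. f (- \<theta>) = - f \<theta>)"

definition fourier_coeff :: "(real \<Rightarrow> real) \<Rightarrow> int \<Rightarrow> complex" where
  "fourier_coeff f k =
     (LINT \<theta>:{-pi..pi}|lebesgue. complex_of_real (f \<theta>) * cis (- (of_int k * \<theta>)))
       / complex_of_real (2 * pi)"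

text \<open>
  Membership in \<open>sobolev m\<close> and the value of \<open>sobolev_norm m\<close> do not change when a
  periodic function is modified on a periodic null set, so elements of \<open>sobolev m\<close> are
  arbitrary representatives of the classes in \<open>H\<^sup>m\<close>.
\<close>

definition sobolev :: "nat \<Rightarrow> (real \<Rightarrow> real) set" where
  "sobolev m = {f. periodic f
     \<and> f \<in> borel_measurable (lebesgue_on {-pi..pi})
     \<and> set_integrable lebesgue {-pi..pi} (\<lambda>\<theta>. (f \<theta>)\<^sup>2)
     \<and> (\<lambda>k::int. (1 + (of_int k)\<^sup>2) ^ m * (cmod (fourier_coeff f k))\<^sup>2) summable_on UNIV}"

definition sobolev_norm :: "nat \<Rightarrow> (real \<Rightarrow> real) \<Rightarrow> real" where
  "sobolev_norm m f =
     sqrt (\<Sum>\<^sub>\<infinity>k::int. (1 + (of_int k)\<^sup>2) ^ m * (cmod (fourier_coeff f k))\<^sup>2)"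

text \<open>
  The principal value removes the points \<open>\<phi>\<close> whose distance to \<open>\<theta>\<close> on the torus, that is
  modulo \<open>2\<pi>\<close>, is less than \<open>\<epsilon>\<close>.
\<close>

definition hilbert :: "(real \<Rightarrow> real) \<Rightarrow> real \<Rightarrow> real" where
  "hilbert f \<theta> = 1 / (2 * pi) *
     Lim (at_right 0) (\<lambda>\<epsilon>. LINT \<phi>:{\<phi> \<in> {-pi..pi}. \<forall>k::int. \<epsilon> \<le> \<bar>\<theta> - \<phi> - 2 * pi * of_int k\<bar>}|lebesgue.
       cot ((\<theta> - \<phi>) / 2) * f \<phi>)"

definition vel :: "(real \<Rightarrow> real) \<Rightarrow> real \<Rightarrow> real" where
  "vel \<eta> = (THE v. (\<forall>\<theta>. (v has_real_derivative hilbert \<eta> \<theta>) (at \<theta>)) \<and> v 0 = 0)"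

definition L_op :: "(real \<Rightarrow> real) \<Rightarrow> real \<Rightarrow> real" where
  "L_op \<eta> \<theta> = 1 / 2 * sin (2 * \<theta>) * deriv \<eta> \<theta> - cos (2 * \<theta>) * \<eta> \<theta>
     + sin (2 * \<theta>) * hilbert \<eta> \<theta> - 2 * cos (2 * \<theta>) * vel \<eta> \<theta>"

definition rho :: "real \<Rightarrow> real" where
  "rho \<theta> = 1 / (4 * pi * (sin \<theta>)\<^sup>2)"

text \<open>The signed square root of the weight, not \<open>sqrt (rho \<theta>)\<close>.\<close>

definition rho_half :: "real \<Rightarrow> real" where
  "rho_half \<theta> = 1 / (2 * sqrt pi * sin \<theta>)"

definition inner_rho :: "(real \<Rightarrow> real) \<Rightarrow> (real \<Rightarrow> real) \<Rightarrow> real" where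
  "inner_rho \<xi> \<eta> = (LINT \<theta>:{-pi..pi}|lebesgue. rho \<theta> * deriv \<xi> \<theta> * deriv \<eta> \<theta>)"

text \<open>
  A class in \<open>H\<^sup>1\<close> is represented by its continuous member. This member is absolutely
  continuous, so its pointwise derivative \<open>deriv \<eta>\<close> exists almost everywhere and is the weak
  derivative; the values of \<open>deriv \<eta>\<close> at the remaining points, and those of the weights at the
  zeros of \<open>sin\<close>, do not affect the integrals.
\<close>

definition H_DW :: "(real \<Rightarrow> real) set" where
  "H_DW = {\<eta>. \<eta> \<in> sobolev 1 \<and> continuous_on UNIV \<eta> \<and> odd_fun \<eta>
     \<and> set_integrable lebesgue {-pi..pi} (\<lambda>\<theta>. \<bar>deriv \<eta> \<theta>\<bar>\<^sup>2 / (sin \<theta>)\<^sup>2)}"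

definition norm_DW :: "(real \<Rightarrow> real) \<Rightarrow> real" where
  "norm_DW \<eta> = sqrt (inner_rho \<eta> \<eta>)"

definition rho_half_deriv :: "(real \<Rightarrow> real) \<Rightarrow> real \<Rightarrow> real" where
  "rho_half_deriv \<eta> \<theta> = rho_half \<theta> * deriv \<eta> \<theta>"

text \<open>
  \<open>curve_C X N k T u\<close>: the curve \<open>u\<close> belongs to \<open>C\<^sup>k([0,T]; X)\<close>, where \<open>X\<close> is a linear space
  of functions normed by \<open>N\<close>; time derivatives are limits of difference quotients in \<open>N\<close>,
  one-sided at the endpoints.
\<close>

definition curve_cont ::
  "(real \<Rightarrow> real) set \<Rightarrow> ((real \<Rightarrow> real) \<Rightarrow> real) \<Rightarrow> real \<Rightarrow> (real \<Rightarrow> real \<Rightarrow> real) \<Rightarrow> bool" where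
  "curve_cont X N T u \<longleftrightarrow> (\<forall>t\<in>{0..T}. u t \<in> X
     \<and> ((\<lambda>s. N (\<lambda>\<theta>. u s \<theta> - u t \<theta>)) \<longlongrightarrow> 0) (at t within {0..T}))"

definition curve_deriv ::
  "((real \<Rightarrow> real) \<Rightarrow> real) \<Rightarrow> real \<Rightarrow> (real \<Rightarrow> real \<Rightarrow> real) \<Rightarrow> (real \<Rightarrow> real \<Rightarrow> real) \<Rightarrow> bool" where
  "curve_deriv N T u u' \<longleftrightarrow> (\<forall>t\<in>{0..T}.
     ((\<lambda>s. N (\<lambda>\<theta>. (u s \<theta> - u t \<theta>) / (s - t) - u' t \<theta>)) \<longlongrightarrow> 0) (at t within {0..T}))"

fun curve_C ::
  "(real \<Rightarrow> real) set \<Rightarrow> ((real \<Rightarrow> real) \<Rightarrow> real) \<Rightarrow> nat \<Rightarrow> real \<Rightarrow> (real \<Rightarrow> real \<Rightarrow> real) \<Rightarrow> bool" where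
  "curve_C X N 0 T u \<longleftrightarrow> curve_cont X N T u"
| "curve_C X N (Suc k) T u \<longleftrightarrow>
     curve_cont X N T u \<and> (\<exists>u'. curve_deriv N T u u' \<and> curve_C X N k T u')"

text \<open>
  \<open>\<eta> t \<theta>\<close> is the solution on \<open>[0,\<infinity>)\<close>; values at negative times are irrelevant. Oddness and
  periodicity are part of membership in \<open>H_DW\<close>. The relations \<open>\<partial>\<^sub>\<theta>v = H\<eta>\<close> and \<open>v(t,0) = 0\<close>
  are incorporated through \<open>vel\<close> in \<open>L_op\<close>.
\<close>

definition classical_solution ::
  "nat \<Rightarrow> (real \<Rightarrow> real) \<Rightarrow> (real \<Rightarrow> real \<Rightarrow> real) \<Rightarrow> bool" where
  "classical_solution m \<eta>\<^sub>0 \<eta> \<longleftrightarrow>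
     (\<forall>t\<ge>0. \<forall>\<theta>. (\<eta> t) differentiable (at \<theta>)
        \<and> (\<exists>D. ((\<lambda>s. \<eta> s \<theta>) has_real_derivative D) (at t within {0..})
               \<and> D + L_op (\<eta> t) \<theta> = 0))
     \<and> (\<forall>\<theta>. \<eta> 0 \<theta> = \<eta>\<^sub>0 \<theta>)
     \<and> (\<forall>T>0. curve_C H_DW norm_DW 0 T \<eta>
        \<and> curve_C (sobolev m) (sobolev_norm m) 0 T (\<lambda>t. rho_half_deriv (\<eta> t))
        \<and> curve_C (sobolev (m - 2)) (sobolev_norm (m - 2)) 2 T (\<lambda>t. rho_half_deriv (\<eta> t)))"

definition J :: "(real \<Rightarrow> real) \<Rightarrow> real \<Rightarrow> real \<Rightarrow> real" where
  "J \<eta>\<^sub>0 l t =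
     (inner_rho \<eta>\<^sub>0 \<eta>\<^sub>0 + 1 / sqrt l * inner_rho (\<lambda>\<theta>. - L_op \<eta>\<^sub>0 \<theta>) \<eta>\<^sub>0) / 2 * exp (2 * sqrt l * t)
   + (inner_rho \<eta>\<^sub>0 \<eta>\<^sub>0 - 1 / sqrt l * inner_rho (\<lambda>\<theta>. - L_op \<eta>\<^sub>0 \<theta>) \<eta>\<^sub>0) / 2 * exp (- 2 * sqrt l * t)"

end

theory Submission
  imports Defs
begin

text \<open>
  The operator \<open>L\<close> becomes explicit in the orthonormal basis
  \<open>e\<^sub>n(\<theta>) = sin((n-1)\<theta>)/(n-1) - sin((n+1)\<theta>)/(n+1)\<close>, \<open>n \<ge> 2\<close>, of the weighted space:
  \<open>L e\<^sub>n = - c\<^sub>n\<^sub>-\<^sub>1 e\<^sub>n\<^sub>-\<^sub>2 + d\<^sub>n e\<^sub>n + c\<^sub>n\<^sub>+\<^sub>1 e\<^sub>n\<^sub>+\<^sub>2\<close> with \<open>c\<^sub>n = (n-2)\<^sup>2(n+2)/(4n\<^sup>2)\<close> and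
  \<open>d\<^sub>n = c\<^sub>n\<^sub>+\<^sub>1 - c\<^sub>n\<^sub>-\<^sub>1\<close>. So \<open>L\<close> is the sum of a bounded diagonal operator \<open>D\<close> and an unbounded
  antisymmetric one. Only \<open>d\<^sub>2\<close> is negative.

  For a solution with coefficients \<open>a\<^sub>n(t)\<close> put \<open>E = \<Sum>a\<^sub>n\<^sup>2\<close>, the square of the norm, and
  \<open>F = - \<Sum>d\<^sub>n a\<^sub>n\<^sup>2\<close>. Antisymmetry gives \<open>F = \<langle>-L \<eta>, \<eta>\<rangle>\<close> and \<open>E' = 2F\<close>. One more derivative gives
  \<open>F' = 2Q\<close> with \<open>Q = \<Sum>d\<^sub>n\<^sup>2 a\<^sub>n\<^sup>2 + \<Sum>c\<^sub>n\<^sub>+\<^sub>1(d\<^sub>n\<^sub>+\<^sub>2 - d\<^sub>n) a\<^sub>n a\<^sub>n\<^sub>+\<^sub>2\<close>. The commutator of \<open>D\<close> with the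
  antisymmetric part is bounded, because \<open>c\<^sub>n\<close> grows linearly while \<open>d\<^sub>n\<close> varies by \<open>O(n\<^sup>-\<^sup>2)\<close>, and it is small
  compared with \<open>D\<^sup>2\<close>. Numerically \<open>0.11 E \<le> Q \<le> 0.9 E\<close>. This is \<open>quadratic_form_bounds\<close>, the
  quantitative core. Hence \<open>E'' = 4Q\<close> lies strictly between \<open>4 \<lambda>\<^sub>1 E\<close> and \<open>4 \<lambda>\<^sub>2 E\<close> for \<open>\<lambda>\<^sub>1 = 1/10\<close> and
  \<open>\<lambda>\<^sub>2 = 1\<close>. The functions \<open>J\<^sub>i\<close> solve \<open>J'' = 4 \<lambda>\<^sub>i J\<close> with the same initial data, and
  \<open>hyperbolic_comparison\<close> yields \<open>J\<^sub>1 < E < J\<^sub>2\<close>. The assumption \<open>F(0) \<ge> 0\<close> enters through \<open>F' \<ge> 0\<close>: it keeps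
  \<open>E\<close> nondecreasing, hence positive.

  The analytic part justifies the passage to coefficients. The Hilbert transform of a sine series is
  computed from the principal value in \<open>hilbert_sine_series\<close>, which gives the matrix of \<open>L\<close> in
  \<open>L_op_expansion\<close>. Completeness of the sine system, \<open>odd_null_of_sine_orthogonal\<close>, identifies a solution
  with its expansion in \<open>odd_periodic_eq_expansion\<close>. Finally \<open>DW_coeff_ode\<close> turns the pointwise
  evolution equation into the system \<open>a' = - L a\<close>.
\<close>

section \<open>Sine and cosine series\<close>

definition sine_series :: "(nat \<Rightarrow> real) \<Rightarrow> real \<Rightarrow> real" where
  "sine_series x \<theta> = (\<Sum>n. x n * sin (real n * \<theta>))"

definition cosine_series :: "(nat \<Rightarrow> real) \<Rightarrow> real \<Rightarrow> real" where
  "cosine_series x \<theta> = (\<Sum>n. x n * cos (real n * \<theta>))"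

lemma summable_mult_bounded:
  fixes x y :: "nat \<Rightarrow> real"
  assumes "summable (\<lambda>n. \<bar>x n\<bar>)" "\<And>n. \<bar>y n\<bar> \<le> 1"
  shows "summable (\<lambda>n. x n * y n)"
proof (rule summable_comparison_test'[OF assms(1), of 0])
  show "norm (x n * y n) \<le> \<bar>x n\<bar>" for n
    using mult_left_mono[OF assms(2)[of n] abs_ge_zero[of "x n"]] by (simp add: abs_mult)
qed

lemma uniform_limit_bounded_series:
  fixes \<phi> :: "nat \<Rightarrow> real \<Rightarrow> real"
  assumes "summable (\<lambda>n. \<bar>x n\<bar>)" "\<And>n \<theta>. \<bar>\<phi> n \<theta>\<bar> \<le> 1"
  shows "uniform_limit S (\<lambda>N \<theta>. \<Sum>n<N. x n * \<phi> n \<theta>) (\<lambda>\<theta>. \<Sum>n. x n * \<phi> n \<theta>) sequentially"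
proof (rule Weierstrass_m_test[OF _ assms(1)])
  show "norm (x n * \<phi> n \<theta>) \<le> \<bar>x n\<bar>" for n \<theta>
    using mult_left_mono[OF assms(2)[of n \<theta>] abs_ge_zero[of "x n"]] by (simp add: abs_mult)
qed

lemma continuous_on_bounded_series:
  fixes \<phi> :: "nat \<Rightarrow> real \<Rightarrow> real"
  assumes "summable (\<lambda>n. \<bar>x n\<bar>)" "\<And>n \<theta>. \<bar>\<phi> n \<theta>\<bar> \<le> 1" "\<And>n. continuous_on S (\<phi> n)"
  shows "continuous_on S (\<lambda>\<theta>. \<Sum>n. x n * \<phi> n \<theta>)"
  by (rule uniform_limit_theorem[OF _ uniform_limit_bounded_series[OF assms(1,2)]])
    (auto intro!: always_eventually continuous_intros assms(3))

text \<open>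
  The partial sums converge uniformly, so integration against a continuous weight can be done
  term by term. All orthogonality computations below reduce to this statement.
\<close>
lemma integral_mult_bounded_series:
  fixes \<phi> :: "nat \<Rightarrow> real \<Rightarrow> real"
  assumes "summable (\<lambda>n. \<bar>x n\<bar>)" "\<And>n \<theta>. \<bar>\<phi> n \<theta>\<bar> \<le> 1" "\<And>n. continuous_on {a..b} (\<phi> n)"
    and h: "continuous_on {a..b} h"
  shows "(\<lambda>n. x n * integral {a..b} (\<lambda>\<theta>. h \<theta> * \<phi> n \<theta>)) sums
         integral {a..b} (\<lambda>\<theta>. h \<theta> * (\<Sum>n. x n * \<phi> n \<theta>))"
proof -
  have bd: "bounded (h ` {a..b})"
    using h compact_continuous_image compact_imp_bounded compact_Icc by blast
  have cs: "continuous_on {a..b} (\<lambda>\<theta>. \<Sum>n. x n * \<phi> n \<theta>)"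
    by (rule continuous_on_bounded_series[OF assms(1-3)])
  have bs: "bounded ((\<lambda>\<theta>. \<Sum>n. x n * \<phi> n \<theta>) ` {a..b})"
    using cs compact_continuous_image compact_imp_bounded compact_Icc by blast
  have u: "uniform_limit {a..b} (\<lambda>N \<theta>. h \<theta> * (\<Sum>n<N. x n * \<phi> n \<theta>))
          (\<lambda>\<theta>. h \<theta> * (\<Sum>n. x n * \<phi> n \<theta>)) sequentially"
    by (rule uniform_lim_mult[OF uniform_limit_const uniform_limit_bounded_series[OF assms(1,2)] bd bs])
  have c: "continuous_on {a..b} (\<lambda>\<theta>. h \<theta> * (\<Sum>n<N. x n * \<phi> n \<theta>))" for N
    by (intro continuous_intros h assms(3))
  obtain I J where I: "\<And>N. ((\<lambda>\<theta>. h \<theta> * (\<Sum>n<N. x n * \<phi> n \<theta>)) has_integral I N) {a..b}"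
    and J: "((\<lambda>\<theta>. h \<theta> * (\<Sum>n. x n * \<phi> n \<theta>)) has_integral J) {a..b}" and lim: "I \<longlonglongrightarrow> J"
    using uniform_limit_integral[OF u c] by auto
  have "I N = (\<Sum>n<N. x n * integral {a..b} (\<lambda>\<theta>. h \<theta> * \<phi> n \<theta>))" for N
  proof -
    have "I N = integral {a..b} (\<lambda>\<theta>. \<Sum>n<N. x n * (h \<theta> * \<phi> n \<theta>))"
      using integral_unique[OF I[of N]] by (simp add: sum_distrib_left mult_ac)
    also have "\<dots> = (\<Sum>n<N. integral {a..b} (\<lambda>\<theta>. x n * (h \<theta> * \<phi> n \<theta>)))"
      by (intro integral_sum integrable_continuous_interval continuous_intros h assms(3)) auto
    finally show ?thesis by simp
  qed
  then have "I = (\<lambda>N. \<Sum>n<N. x n * integral {a..b} (\<lambda>\<theta>. h \<theta> * \<phi> n \<theta>))" by blast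
  with lim integral_unique[OF J] show ?thesis
    by (simp add: sums_def)
qed

lemma summable_abs_divide_nat:
  assumes "summable (\<lambda>n. \<bar>x n\<bar>)"
  shows "summable (\<lambda>n. \<bar>x n / real n\<bar>)"
proof (rule summable_comparison_test'[OF assms, of 0])
  show "norm \<bar>x n / real n\<bar> \<le> \<bar>x n\<bar>" for n
    using divide_left_mono[of 1 "real n" "\<bar>x n\<bar>"] by (cases "n = 0") auto
qed

lemma summable_abs_of_weighted:
  fixes x :: "nat \<Rightarrow> real"
  assumes "summable (\<lambda>n. real n * \<bar>x n\<bar>)"
  shows "summable (\<lambda>n. \<bar>x n\<bar>)"
proof (rule summable_comparison_test'[OF assms, of 1])
  show "norm \<bar>x n\<bar> \<le> real n * \<bar>x n\<bar>" if "1 \<le> n" for n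
    proof -
    have "1 \<le> real n" using that by simp
    from mult_right_mono[OF this, of "\<bar>x n\<bar>"] show ?thesis by simp
  qed
qed

lemma has_integral_cos_int:
  "((\<lambda>\<theta>. cos (of_int k * \<theta>)) has_integral (if k = 0 then 2 * pi else 0)) {-pi..pi}"
proof (cases "k = 0")
  case False
  have "((\<lambda>\<theta>. cos (of_int k * \<theta>)) has_integral sin (of_int k * pi) / of_int k - sin (of_int k * (-pi)) / of_int k) {-pi..pi}"
    by (rule fundamental_theorem_of_calculus)
      (use False in \<open>auto intro!: derivative_eq_intros simp: has_real_derivative_iff_has_vector_derivative[symmetric]\<close>)
  then show ?thesis
    using False by (simp add: mult.commute[of _ pi])
next
  case True
  then show ?thesis using has_integral_const_real[of "1::real" "-pi" pi] by simp
qed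

lemma integral_sin_sin:
  "integral {-pi..pi} (\<lambda>\<theta>. sin (real k * \<theta>) * sin (real n * \<theta>)) = (if k = n \<and> 0 < k then pi else 0)"
proof -
  have eq: "(\<lambda>\<theta>. sin (real k * \<theta>) * sin (real n * \<theta>)) =
      (\<lambda>\<theta>. 1 / 2 * cos (of_int (int k - int n) * \<theta>) - 1 / 2 * cos (of_int (int k + int n) * \<theta>))"
    by (auto simp: sin_times_sin fun_eq_iff left_diff_distrib distrib_right)
  have "((\<lambda>\<theta>. sin (real k * \<theta>) * sin (real n * \<theta>)) has_integral
     (1 / 2 * (if int k - int n = 0 then 2 * pi else 0) - 1 / 2 * (if int k + int n = 0 then 2 * pi else 0))) {-pi..pi}"
    unfolding eq by (intro has_integral_diff has_integral_mult_right has_integral_cos_int)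
  then show ?thesis by (auto dest!: integral_unique)
qed

lemma continuous_on_sine_series:
  "summable (\<lambda>n. \<bar>x n\<bar>) \<Longrightarrow> continuous_on S (sine_series x)"
  unfolding sine_series_def by (rule continuous_on_bounded_series) (auto intro!: continuous_intros)

lemma integral_sin_mult_sine_series:
  assumes "summable (\<lambda>n. \<bar>x n\<bar>)" "0 < k"
  shows "integral {-pi..pi} (\<lambda>\<theta>. sin (real k * \<theta>) * sine_series x \<theta>) = pi * x k"
proof -
  have "(\<lambda>n. x n * integral {-pi..pi} (\<lambda>\<theta>. sin (real k * \<theta>) * sin (real n * \<theta>))) sums
         integral {-pi..pi} (\<lambda>\<theta>. sin (real k * \<theta>) * sine_series x \<theta>)"
    unfolding sine_series_def
    by (rule integral_mult_bounded_series[OF assms(1)]) (auto intro!: continuous_intros)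
  moreover have "(\<lambda>n. x n * integral {-pi..pi} (\<lambda>\<theta>. sin (real k * \<theta>) * sin (real n * \<theta>)))
      = (\<lambda>n. if n = k then x n * pi else 0)"
    using assms(2) by (auto simp: integral_sin_sin fun_eq_iff)
  ultimately show ?thesis
    using sums_single[of k "\<lambda>n. x n * pi"] sums_unique2 by (metis mult.commute)
qed

lemma integral_sine_series_mult:
  assumes "summable (\<lambda>n. \<bar>x n\<bar>)" "summable (\<lambda>n. \<bar>y n\<bar>)" "y 0 = 0"
  shows "(\<lambda>n. x n * y n) sums (integral {-pi..pi} (\<lambda>\<theta>. sine_series x \<theta> * sine_series y \<theta>) / pi)"
proof -
  have "(\<lambda>n. y n * integral {-pi..pi} (\<lambda>\<theta>. sine_series x \<theta> * sin (real n * \<theta>))) sums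
         integral {-pi..pi} (\<lambda>\<theta>. sine_series x \<theta> * sine_series y \<theta>)"
    unfolding sine_series_def[of y]
    by (rule integral_mult_bounded_series[OF assms(2)])
      (auto intro!: continuous_intros continuous_on_sine_series assms)
  moreover have "y n * integral {-pi..pi} (\<lambda>\<theta>. sine_series x \<theta> * sin (real n * \<theta>)) = pi * (x n * y n)" for n
    using integral_sin_mult_sine_series[OF assms(1), of n] assms(3)
    by (cases "n = 0") (auto simp: mult.commute)
  ultimately have "(\<lambda>n. pi * (x n * y n)) sums
         integral {-pi..pi} (\<lambda>\<theta>. sine_series x \<theta> * sine_series y \<theta>)" by simp
  from sums_divide[OF this, of pi] show ?thesis by simp
qed

lemma sine_series_has_derivative:
  assumes "summable (\<lambda>n. real n * \<bar>x n\<bar>)"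
  shows "(sine_series x has_real_derivative cosine_series (\<lambda>n. real n * x n) \<theta>) (at \<theta>)"
proof -
  have s: "summable (\<lambda>n. \<bar>real n * x n\<bar>)" using assms by (simp add: abs_mult)
  show ?thesis
    unfolding sine_series_def cosine_series_def
  proof (rule has_field_derivative_series'(2)[where S=UNIV and ?x0.0=0
        and f="\<lambda>n \<theta>. x n * sin (real n * \<theta>)" and f'="\<lambda>n \<theta>. real n * x n * cos (real n * \<theta>)"])
    show "((\<lambda>\<theta>. x n * sin (real n * \<theta>)) has_field_derivative (real n * x n) * cos (real n * \<theta>)) (at \<theta> within UNIV)" for n \<theta>
      by (auto intro!: derivative_eq_intros)
    show "uniformly_convergent_on UNIV (\<lambda>N \<theta>. \<Sum>n<N. real n * x n * cos (real n * \<theta>))"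
      using uniform_limit_bounded_series[OF s, of "\<lambda>n \<theta>. cos (real n * \<theta>)" UNIV]
      by (auto simp: uniformly_convergent_on_def)
  qed auto
qed

section \<open>Expansions in an orthonormal basis of the weighted space\<close>

text \<open>
  The functions \<open>e\<^sub>n(\<theta>) = sin((n-1)\<theta>)/(n-1) - sin((n+1)\<theta>)/(n+1)\<close>, \<open>n \<ge> 2\<close>, satisfy
  \<open>e\<^sub>n' = 2 sin \<theta> sin(n\<theta>)\<close>, so that they are orthonormal for \<open>inner_rho\<close>. Collecting the terms with
  \<open>sin(k\<theta>)\<close> in \<open>\<Sum>a\<^sub>n e\<^sub>n\<close> gives the sine coefficients defined here, provided that \<open>a\<^sub>0 = a\<^sub>1 = 0\<close>. At
  \<open>k = 0\<close> the division by zero gives the value 0.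
\<close>
definition primitive_coeff :: "(nat \<Rightarrow> real) \<Rightarrow> nat \<Rightarrow> real" where
  "primitive_coeff a k = (a (k + 1) - a (k - 1)) / real k"

text \<open>
  The sum \<open>\<Sum>a\<^sub>n e\<^sub>n\<close>, written as an ordinary sine series so that the Hilbert transform can be applied
  mode by mode.
\<close>
definition expansion :: "(nat \<Rightarrow> real) \<Rightarrow> real \<Rightarrow> real" where
  "expansion a = sine_series (primitive_coeff a)"

lemma summable_shift_abs:
  fixes a :: "nat \<Rightarrow> real"
  assumes "summable (\<lambda>n. \<bar>a n\<bar>)"
  shows "summable (\<lambda>k. \<bar>a (k + 1)\<bar>)" "summable (\<lambda>k. \<bar>a (k - 1)\<bar>)"
proof -
  show "summable (\<lambda>k. \<bar>a (k + 1)\<bar>)" using summable_ignore_initial_segment[OF assms, of 1] .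
  show "summable (\<lambda>k. \<bar>a (k - 1)\<bar>)"
    by (subst summable_Suc_iff[symmetric]) (use assms in simp)
qed

lemma summable_primitive_coeff_weighted:
  assumes "summable (\<lambda>n. \<bar>a n\<bar>)"
  shows "summable (\<lambda>k. real k * \<bar>primitive_coeff a k\<bar>)"
proof (rule summable_comparison_test'[OF summable_add[OF summable_shift_abs[OF assms]], of 0])
  show "norm (real k * \<bar>primitive_coeff a k\<bar>) \<le> \<bar>a (k + 1)\<bar> + \<bar>a (k - 1)\<bar>" for k
    by (cases "k = 0") (auto simp: primitive_coeff_def intro: abs_triangle_ineq4)
qed

lemma sums_drop_two_zeros:
  fixes f :: "nat \<Rightarrow> real"
  assumes "summable f" "f 0 = 0" "f 1 = 0"
  shows "(\<lambda>n. f (n + 2)) sums suminf f"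
proof -
  have "f sums suminf f" using assms(1) by (rule summable_sums)
  then show ?thesis
    by (subst sums_iff_shift) (use assms in \<open>simp_all add: numeral_2_eq_2\<close>)
qed

text \<open>
  The derivative of the sine series is \<open>\<Sum>(a\<^sub>k\<^sub>+\<^sub>1 - a\<^sub>k\<^sub>-\<^sub>1) cos(k\<theta>)\<close>. Summation by parts turns it into
  \<open>\<Sum>a\<^sub>n (cos((n-1)\<theta>) - cos((n+1)\<theta>))\<close>, and each bracket is \<open>2 sin \<theta> sin(n\<theta>)\<close>. The boundary terms are
  those with \<open>a\<^sub>0\<close> and \<open>a\<^sub>1\<close>.
\<close>
lemma expansion_has_derivative:
  assumes s: "summable (\<lambda>n. \<bar>a n\<bar>)" and z: "a 0 = 0" "a 1 = 0"
  shows "(expansion a has_real_derivative 2 * sin \<theta> * sine_series a \<theta>) (at \<theta>)"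
proof -
  have sc: "summable (\<lambda>n. a n * cos ((real n - 1) * \<theta>))" "summable (\<lambda>n. a n * cos ((real n + 1) * \<theta>))"
    by (rule summable_mult_bounded[OF s], simp)+
  have "(\<lambda>n. a (n + 2) * cos (real (n + 1) * \<theta>) - a n * cos (real (n + 1) * \<theta>)) sums
     ((\<Sum>n. a n * cos ((real n - 1) * \<theta>)) - (\<Sum>n. a n * cos ((real n + 1) * \<theta>)))"
    using sums_diff[OF sums_drop_two_zeros[OF sc(1)] summable_sums[OF sc(2)]] z by (simp add: add.commute)
  also have "(\<lambda>n. a (n + 2) * cos (real (n + 1) * \<theta>) - a n * cos (real (n + 1) * \<theta>)) =
       (\<lambda>n. (\<lambda>k. real k * primitive_coeff a k * cos (real k * \<theta>)) (Suc n))"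
    by (auto simp: primitive_coeff_def fun_eq_iff field_simps)
  finally have "(\<lambda>k. real k * primitive_coeff a k * cos (real k * \<theta>)) sums
     ((\<Sum>n. a n * cos ((real n - 1) * \<theta>)) - (\<Sum>n. a n * cos ((real n + 1) * \<theta>)))"
    by (subst (asm) sums_Suc_iff) simp
  then have "cosine_series (\<lambda>k. real k * primitive_coeff a k) \<theta> =
     (\<Sum>n. a n * cos ((real n - 1) * \<theta>)) - (\<Sum>n. a n * cos ((real n + 1) * \<theta>))"
    unfolding cosine_series_def by (rule sums_unique[symmetric])
  also have "\<dots> = (\<Sum>n. a n * cos ((real n - 1) * \<theta>) - a n * cos ((real n + 1) * \<theta>))"
    by (rule suminf_diff[OF sc])
  also have "\<dots> = (\<Sum>n. 2 * sin \<theta> * (a n * sin (real n * \<theta>)))"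
    by (rule suminf_cong) (simp add: algebra_simps cos_add cos_diff)
  also have "\<dots> = 2 * sin \<theta> * sine_series a \<theta>"
    unfolding sine_series_def by (rule suminf_mult[OF summable_mult_bounded[OF s]]) simp
  finally show ?thesis
    unfolding expansion_def
    using sine_series_has_derivative[OF summable_primitive_coeff_weighted[OF s]] by metis
qed

lemma sin_nonzero_off_multiples:
  assumes "\<theta> \<in> {-pi..pi} - {-pi, 0, pi}"
  shows "sin \<theta> \<noteq> 0"
proof (cases "\<theta> > 0")
  case True then show ?thesis using sin_gt_zero[of \<theta>] assms by auto
next
  case False then show ?thesis using sin_gt_zero[of "-\<theta>"] assms by auto
qed

text \<open>
  The factors \<open>2 sin \<theta>\<close> of the two derivatives cancel the weight, and what remains is Parseval's
  identity for the two sine series. The cancellation fails only at the zeros of \<open>sin\<close>, a null set.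
\<close>
lemma inner_rho_expansion:
  assumes s: "summable (\<lambda>n. \<bar>a n\<bar>)" "summable (\<lambda>n. \<bar>b n\<bar>)" and z: "a 0 = 0" "a 1 = 0" "b 0 = 0" "b 1 = 0"
  shows "(\<lambda>n. a n * b n) sums inner_rho (expansion a) (expansion b)"
proof -
  have d: "deriv (expansion x) \<theta> = 2 * sin \<theta> * sine_series x \<theta>"
    if "summable (\<lambda>n. \<bar>x n\<bar>)" "x 0 = 0" "x 1 = 0" for x \<theta>
    by (rule DERIV_imp_deriv[OF expansion_has_derivative[OF that]])
  let ?g = "\<lambda>\<theta>. sine_series a \<theta> * sine_series b \<theta> / pi"
  let ?f = "\<lambda>\<theta>. rho \<theta> * deriv (expansion a) \<theta> * deriv (expansion b) \<theta>"
  have cont: "continuous_on {-pi..pi} ?g"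
    by (intro continuous_intros continuous_on_sine_series s) simp
  have gi: "?g absolutely_integrable_on {-pi..pi}"
    using cont by (rule absolutely_integrable_continuous_real)
  have neg: "negligible {-pi, 0, pi}" by (rule negligible_finite) simp
  have eq: "?f \<theta> = ?g \<theta>" if "\<theta> \<in> {-pi..pi} - {-pi, 0, pi}" for \<theta>
  proof -
    have "sin \<theta> \<noteq> 0" by (rule sin_nonzero_off_multiples[OF that])
    then show ?thesis
      unfolding d[OF s(1) z(1,2)] d[OF s(2) z(3,4)] by (simp add: rho_def field_simps power2_eq_square)
  qed
  have fi: "?f absolutely_integrable_on {-pi..pi}"
    by (rule absolutely_integrable_spike[OF gi neg eq])
  have "inner_rho (expansion a) (expansion b) = integral {-pi..pi} ?f"
    unfolding inner_rho_def by (rule set_lebesgue_integral_eq_integral(2)[OF fi])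
  also have "\<dots> = integral {-pi..pi} ?g"
    by (rule integral_spike[OF neg]) (simp add: eq)
  also have "\<dots> = integral {-pi..pi} (\<lambda>\<theta>. sine_series a \<theta> * sine_series b \<theta>) / pi" by simp
  finally show ?thesis using integral_sine_series_mult[OF s z(3)] by simp
qed

text \<open>
  Trigonometric polynomials biorthogonal to the \<open>e\<^sub>n\<close> for the unweighted integral. They recover the
  coefficients from the values of a function, without differentiating it. The recursion inverts
  \<open>k b\<^sub>k = a\<^sub>k\<^sub>+\<^sub>1 - a\<^sub>k\<^sub>-\<^sub>1\<close> for the sine coefficients \<open>b\<^sub>k\<close>, starting from \<open>a\<^sub>0 = a\<^sub>1 = 0\<close>.
\<close>
fun dual :: "nat \<Rightarrow> real \<Rightarrow> real" where
  "dual 0 \<theta> = 0"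
| "dual (Suc 0) \<theta> = 0"
| "dual (Suc (Suc n)) \<theta> = dual n \<theta> + (real n + 1) / pi * sin (real (n + 1) * \<theta>)"

lemma continuous_on_dual: "continuous_on S (dual n)"
  by (induction n rule: induct_nat_012) (auto intro!: continuous_intros)

lemma summable_primitive_coeff:
  "summable (\<lambda>n. \<bar>a n\<bar>) \<Longrightarrow> summable (\<lambda>k. \<bar>primitive_coeff a k\<bar>)"
  by (rule summable_abs_of_weighted[OF summable_primitive_coeff_weighted])

lemma continuous_on_expansion: "summable (\<lambda>n. \<bar>a n\<bar>) \<Longrightarrow> continuous_on S (expansion a)"
  unfolding expansion_def by (intro continuous_on_sine_series summable_primitive_coeff)

lemma integral_dual_expansion:
  assumes s: "summable (\<lambda>n. \<bar>a n\<bar>)" and z: "a 0 = 0" "a 1 = 0"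
  shows "integral {-pi..pi} (\<lambda>\<theta>. dual n \<theta> * expansion a \<theta>) = a n"
proof (induction n rule: induct_nat_012)
  case (ge2 n)
  have "integral {-pi..pi} (\<lambda>\<theta>. dual (Suc (Suc n)) \<theta> * expansion a \<theta>)
     = integral {-pi..pi} (\<lambda>\<theta>. dual n \<theta> * expansion a \<theta> + (real n + 1) / pi * (sin (real (n + 1) * \<theta>) * expansion a \<theta>))"
    by (simp add: algebra_simps add_divide_distrib)
  also have "\<dots> = integral {-pi..pi} (\<lambda>\<theta>. dual n \<theta> * expansion a \<theta>)
       + integral {-pi..pi} (\<lambda>\<theta>. (real n + 1) / pi * (sin (real (n + 1) * \<theta>) * expansion a \<theta>))"
    by (intro integral_add integrable_continuous_interval continuous_intros continuous_on_dual continuous_on_expansion s)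
  also have "\<dots> = a n + (real n + 1) / pi * (pi * primitive_coeff a (n + 1))"
    using ge2 integral_sin_mult_sine_series[OF summable_primitive_coeff[OF s], of "n+1"]
    by (simp add: expansion_def)
  also have "\<dots> = a (Suc (Suc n))"
  proof -
    have "primitive_coeff a (n + 1) = (a (n + 2) - a n) / (real n + 1)"
      by (simp add: primitive_coeff_def add.commute)
    then show ?thesis by simp
  qed
  finally show ?case .
qed (use z in auto)

section \<open>The Hilbert transform of a sine series\<close>

lemma has_integral_shift_real:
  fixes f :: "real \<Rightarrow> real"
  assumes "(f has_integral i) {a..b}"
  shows "((\<lambda>x. f (x + c)) has_integral i) {a - c..b - c}"
  using has_integral_affinity[of f i a b 1 c] assms by (simp add: image_add_atLeastAtMost' algebra_simps)

lemma has_integral_reflect_about: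
  fixes f :: "real \<Rightarrow> real"
  assumes "(f has_integral i) {a..b}"
  shows "((\<lambda>x. f (c - x)) has_integral i) {c - b..c - a}"
proof -
  have "(\<lambda>x. - x + c) ` {a..b} = {c - b..c - a}"
    by (auto intro!: image_eqI[of _ "\<lambda>x. - x + c" "c - _"])
  then show ?thesis
    using has_integral_affinity[of f i a b "-1" c] assms by (simp add: algebra_simps)
qed

lemma periodic_add_int:
  assumes "\<And>x::real. F (x + 2 * pi) = F x"
  shows "F (x + 2 * pi * of_int k) = F x"
proof -
  have nat: "F (x + 2 * pi * real n) = F x" for n x
  proof (induction n)
    case (Suc n)
    have "F (x + 2 * pi * real (Suc n)) = F ((x + 2 * pi * real n) + 2 * pi)" by (simp add: algebra_simps)
    then show ?case using assms Suc by simp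
  qed simp
  show ?thesis
  proof (cases "k \<ge> 0")
    case True
    then show ?thesis using nat[of x "nat k"] by simp
  next
    case False
    then show ?thesis using nat[of "x + 2 * pi * of_int k" "nat (-k)"] by simp
  qed
qed

text \<open>
  Cut the window at \<open>pi\<close> and move the part beyond it back by one period. This treats \<open>c\<close> between \<open>0\<close>
  and \<open>2 pi\<close>; every other window is a translate of such a one by a multiple of the period.
\<close>
lemma has_integral_periodic_window:
  fixes F :: "real \<Rightarrow> real"
  assumes per: "\<And>x. F (x + 2 * pi) = F x" and I: "(F has_integral I) {-pi..pi}"
  shows "(F has_integral I) {c - pi..c + pi}"
proof -
  have base: "(F has_integral I) {c - pi..c + pi}" if c: "0 \<le> c" "c \<le> 2 * pi" for c
  proof -
    have i1: "F integrable_on {-pi..c - pi}" and i2: "F integrable_on {c - pi..pi}"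
      using has_integral_integrable[OF I] c by (auto intro: integrable_subinterval_real)
    obtain J1 J2 where J: "(F has_integral J1) {-pi..c - pi}" "(F has_integral J2) {c - pi..pi}"
      using i1 i2 by blast
    have "(F has_integral J1 + J2) {-pi..pi}"
      by (rule has_integral_combine[OF _ _ J]) (use c in auto)
    then have I': "I = J2 + J1" using has_integral_unique[OF I] by (simp only: add.commute)
    have "((\<lambda>x. F (x + - (2 * pi))) has_integral J1) {-pi - - (2 * pi)..c - pi - - (2 * pi)}"
      by (rule has_integral_shift_real[OF J(1)])
    moreover have "F (x + - (2 * pi)) = F x" for x using per[of "x - 2 * pi"] by simp
    ultimately have "(F has_integral J1) {pi..c + pi}" by (simp add: algebra_simps)
    from has_integral_combine[OF _ _ J(2) this] show ?thesis using c unfolding I' by linarith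
  qed
  define k where "k = \<lfloor>c / (2 * pi)\<rfloor>"
  \<comment> \<open>The representative of \<open>c\<close> modulo the period in \<open>[0, 2 pi)\<close>.\<close>
  define c' where "c' = c - 2 * pi * of_int k"
  have "0 \<le> c'" "c' \<le> 2 * pi"
    using floor_divide_lower[of "2 * pi" c] floor_divide_upper[of "2 * pi" c]
    by (auto simp: c'_def k_def algebra_simps)
  from has_integral_shift_real[OF base[OF this], of "2 * pi * of_int (-k)"]
  show ?thesis
    unfolding periodic_add_int[of F, OF per] by (simp add: c'_def algebra_simps)
qed

lemma has_integral_periodic_reflect:
  fixes F :: "real \<Rightarrow> real"
  assumes per: "\<And>x. F (x + 2 * pi) = F x" and I: "(F has_integral I) {-pi..pi}"
  shows "((\<lambda>x. F (c - x)) has_integral I) {-pi..pi}"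
  using has_integral_reflect_about[OF has_integral_periodic_window[OF per I, of c], of c] by simp

lemma absolutely_integrable_periodic_reflect:
  fixes F :: "real \<Rightarrow> real"
  assumes per: "\<And>x. F (x + 2 * pi) = F x" and I: "F absolutely_integrable_on {-pi..pi}"
  shows "(\<lambda>x. F (c - x)) absolutely_integrable_on {-pi..pi}"
proof -
  obtain I J where "(F has_integral I) {-pi..pi}" "((\<lambda>x. \<bar>F x\<bar>) has_integral J) {-pi..pi}"
    using I by (auto simp: absolutely_integrable_on_def)
  then have "((\<lambda>x. F (c - x)) has_integral I) {-pi..pi}" "((\<lambda>x. \<bar>F (c - x)\<bar>) has_integral J) {-pi..pi}"
    using has_integral_periodic_reflect[of F] has_integral_periodic_reflect[of "\<lambda>x. \<bar>F x\<bar>"] per by auto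
  then show ?thesis
    unfolding absolutely_integrable_on_def real_norm_def by blast
qed

text \<open>
  The modified Dirichlet kernel \<open>1 + 2 cos x + \<dots> + 2 cos((k-1)x) + cos(kx)\<close>. It equals
  \<open>cot(x/2) sin(kx)\<close> and shows that this product has a removable singularity and is bounded by \<open>2k\<close>.
\<close>
definition conj_kernel :: "nat \<Rightarrow> real \<Rightarrow> real" where
  "conj_kernel k x = (\<Sum>j<k. cos (real j * x) + cos (real (j + 1) * x))"

text \<open>
  Induction on \<open>k\<close>: the summand \<open>cos(kx) + cos((k+1)x)\<close> contributes
  \<open>cos(x/2) (sin((k+1)x) - sin(kx))\<close>, so the sum telescopes.
\<close>
lemma sin_half_mult_conj_kernel: "sin (x / 2) * conj_kernel k x = cos (x / 2) * sin (real k * x)"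
proof (induction k)
  case (Suc k)
  define h where "h = x / 2"
  have x: "real (k + 1) * x = real k * x + (h + h)" "real (Suc k) * x = real k * x + (h + h)"
    by (simp_all add: h_def algebra_simps)
  have trig: "c * S + s * (C + (C * (c * c - s * s) - S * (s * c + c * s)))
      = c * (S * (c * c - s * s) + C * (s * c + c * s)) + (s * C + c * S) * (1 - (s * s + c * c))"
    for s c S C :: real
    by (simp add: algebra_simps)
  have one: "sin h * sin h + cos h * cos h = 1"
    using sin_cos_squared_add[of h] unfolding power2_eq_square .
  have "sin h * conj_kernel (Suc k) x
      = cos h * sin (real k * x) + sin h * (cos (real k * x) + cos (real (k + 1) * x))"
    using Suc by (simp add: conj_kernel_def h_def algebra_simps)
  also have "\<dots> = cos h * sin (real (Suc k) * x)"
    unfolding x sin_add cos_add trig one by (simp only: diff_self mult_zero_right add_0_right)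
  finally show ?case by (simp only: h_def)
qed (simp add: conj_kernel_def)

lemma conj_kernel_eq_cot:
  assumes "sin (x / 2) \<noteq> 0"
  shows "cot (x / 2) * sin (real k * x) = conj_kernel k x"
proof -
  have "conj_kernel k x = cos (x / 2) * sin (real k * x) / sin (x / 2)"
    unfolding sin_half_mult_conj_kernel[symmetric] using assms by simp
  then show ?thesis by (simp only: cot_def times_divide_eq_left)
qed

lemma abs_conj_kernel_le: "\<bar>conj_kernel k x\<bar> \<le> 2 * real k"
proof -
  have "\<bar>conj_kernel k x\<bar> \<le> (\<Sum>j<k. \<bar>cos (real j * x) + cos (real (j + 1) * x)\<bar>)"
    unfolding conj_kernel_def by (rule sum_abs)
  also have "\<dots> \<le> (\<Sum>j<k. 2)"
  proof (rule sum_mono)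
    fix j show "\<bar>cos (real j * x) + cos (real (j + 1) * x)\<bar> \<le> 2"
      using abs_cos_le_one[of "real j * x"] abs_cos_le_one[of "real (j + 1) * x"] by linarith
  qed
  finally show ?thesis by simp
qed

lemma integral_cos_nat_half: "((\<lambda>x. cos (real j * x)) has_integral (if j = 0 then pi else 0)) {0..pi}"
proof (cases "j = 0")
  case False
  have "((\<lambda>x. cos (real j * x)) has_integral sin (real j * pi) / real j - sin (real j * 0) / real j) {0..pi}"
    by (rule fundamental_theorem_of_calculus)
      (use False in \<open>auto intro!: derivative_eq_intros simp: has_real_derivative_iff_has_vector_derivative[symmetric]\<close>)
  then show ?thesis using False by simp
next
  case True
  then show ?thesis using has_integral_const_real[of "1::real" 0 pi] by simp
qed

lemma integral_conj_kernel: "integral {0..pi} (conj_kernel k) = (if k = 0 then 0 else pi)"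
proof -
  have "(conj_kernel k has_integral (\<Sum>j<k. (if j = 0 then pi else 0) + (if j + 1 = 0 then pi else 0))) {0..pi}"
    unfolding conj_kernel_def
    by (intro has_integral_sum has_integral_add integral_cos_nat_half) auto
  then show ?thesis by (auto dest!: integral_unique)
qed

lemma continuous_on_conj_kernel: "continuous_on S (conj_kernel k)"
  unfolding conj_kernel_def by (intro continuous_intros)

text \<open>
  The difference \<open>f(\<theta>+x) - f(\<theta>-x)\<close> of a sine series is \<open>2 \<Sum>b\<^sub>k cos(k\<theta>) sin(kx)\<close>. Multiplied by
  \<open>cot(x/2)\<close> it becomes a series in the kernels above, which converges uniformly because
  \<open>\<Sum>k|b\<^sub>k|\<close> is finite. So the singular integral is an ordinary integral of a continuous
  function.
\<close>
lemma conj_series: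
  assumes b: "summable (\<lambda>k. real k * \<bar>b k\<bar>)"
  defines "W \<equiv> \<lambda>\<theta> x. \<Sum>k. b k * cos (real k * \<theta>) * conj_kernel k x"
  shows "continuous_on S (W \<theta>)"
    and "integral {0..pi} (W \<theta>) = pi * (cosine_series b \<theta> - b 0)"
    and "sin (x / 2) \<noteq> 0 \<Longrightarrow> cot (x / 2) * (sine_series b (\<theta> + x) - sine_series b (\<theta> - x)) = 2 * W \<theta> x"
proof -
  \<comment> \<open>Normalize the kernels to be bounded by 1, moving the factor \<open>2k\<close> into the coefficients.\<close>
  define w where "w k = 2 * real k * (b k * cos (real k * \<theta>))" for k
  define \<phi> where "\<phi> k x = conj_kernel k x / (2 * real k)" for k x
  have w\<phi>: "w k * \<phi> k x = b k * cos (real k * \<theta>) * conj_kernel k x" for k x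
    by (cases "k = 0") (auto simp: w_def \<phi>_def conj_kernel_def)
  have W: "W \<theta> = (\<lambda>x. \<Sum>k. w k * \<phi> k x)"
    unfolding W_def w\<phi> ..
  have sb: "summable (\<lambda>k. \<bar>b k\<bar>)" by (rule summable_abs_of_weighted[OF b])
  have ws: "summable (\<lambda>k. \<bar>w k\<bar>)"
  proof (rule summable_comparison_test'[OF summable_mult[OF b, of 2], of 0])
    fix k
    have "real k * \<bar>b k\<bar> * \<bar>cos (real k * \<theta>)\<bar> \<le> real k * \<bar>b k\<bar> * 1"
      by (intro mult_left_mono) auto
    then show "norm \<bar>w k\<bar> \<le> 2 * (real k * \<bar>b k\<bar>)" by (simp add: w_def abs_mult)
  qed
  have \<phi>1: "\<bar>\<phi> k x\<bar> \<le> 1" for k x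
    using abs_conj_kernel_le[of k x] by (cases "k = 0") (auto simp: \<phi>_def)
  have \<phi>c: "continuous_on S (\<phi> k)" for k S
    by (cases "k = 0") (auto simp: \<phi>_def[abs_def] intro!: continuous_intros continuous_on_conj_kernel)
  show "continuous_on S (W \<theta>)"
    unfolding W by (rule continuous_on_bounded_series[OF ws \<phi>1 \<phi>c])
  have "(\<lambda>k. w k * integral {0..pi} (\<lambda>x. 1 * \<phi> k x)) sums integral {0..pi} (\<lambda>x. 1 * (\<Sum>k. w k * \<phi> k x))"
    by (rule integral_mult_bounded_series[OF ws \<phi>1 \<phi>c]) auto
  moreover have "w k * integral {0..pi} (\<lambda>x. 1 * \<phi> k x) = pi * (if k = 0 then 0 else b k * cos (real k * \<theta>))" for k
    by (cases "k = 0") (auto simp: w_def \<phi>_def integral_conj_kernel)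
  ultimately have "(\<lambda>k. pi * (if k = 0 then 0 else b k * cos (real k * \<theta>))) sums integral {0..pi} (W \<theta>)"
    unfolding W by simp
  moreover have "(\<lambda>k. pi * (if k = 0 then 0 else b k * cos (real k * \<theta>))) sums (pi * (cosine_series b \<theta> - b 0))"
  proof -
    have s: "(\<lambda>k. b k * cos (real k * \<theta>)) sums cosine_series b \<theta>"
      unfolding cosine_series_def by (rule summable_sums[OF summable_mult_bounded[OF sb]]) simp
    have "(\<lambda>k. b k * cos (real k * \<theta>) - (if k = 0 then b k else 0)) sums (cosine_series b \<theta> - b 0)"
      by (rule sums_diff[OF s]) (rule sums_single)
    also have "(\<lambda>k. b k * cos (real k * \<theta>) - (if k = 0 then b k else 0)) = (\<lambda>k. if k = 0 then 0 else b k * cos (real k * \<theta>))"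
      by auto
    finally show ?thesis by (rule sums_mult)
  qed
  ultimately show "integral {0..pi} (W \<theta>) = pi * (cosine_series b \<theta> - b 0)"
    by (rule sums_unique2)
  assume x: "sin (x / 2) \<noteq> 0"
  have s: "(\<lambda>k. b k * sin (real k * y)) sums sine_series b y" for y
    unfolding sine_series_def by (rule summable_sums[OF summable_mult_bounded[OF sb]]) simp
  have "(\<lambda>k. cot (x / 2) * (b k * sin (real k * (\<theta> + x)) - b k * sin (real k * (\<theta> - x)))) sums
     (cot (x / 2) * (sine_series b (\<theta> + x) - sine_series b (\<theta> - x)))"
    by (intro sums_mult sums_diff s)
  moreover have "cot (x / 2) * (b k * sin (real k * (\<theta> + x)) - b k * sin (real k * (\<theta> - x)))
     = 2 * (b k * cos (real k * \<theta>) * conj_kernel k x)" for k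
    unfolding conj_kernel_eq_cot[OF x, symmetric]
    by (simp add: ring_distribs sin_add sin_diff)
  ultimately have "(\<lambda>k. 2 * (b k * cos (real k * \<theta>) * conj_kernel k x)) sums
     (cot (x / 2) * (sine_series b (\<theta> + x) - sine_series b (\<theta> - x)))" by simp
  moreover have "(\<lambda>k. b k * cos (real k * \<theta>) * conj_kernel k x) sums W \<theta> x"
    using summable_sums[OF summable_mult_bounded[OF ws, of "\<lambda>k. \<phi> k x"]] \<phi>1 unfolding w\<phi> W_def by simp
  ultimately show "cot (x / 2) * (sine_series b (\<theta> + x) - sine_series b (\<theta> - x)) = 2 * W \<theta> x"
    using sums_mult sums_unique2 by blast
qed

lemma sine_series_periodic: "sine_series b (x + 2 * pi) = sine_series b x"
proof -
  have "sin (real n * (x + 2 * pi)) = sin (real n * x)" for n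
  proof -
    have eq: "real n * (x + 2 * pi) = real n * x + 2 * pi * of_int (int n)"
      by (simp only: of_int_of_nat_eq distrib_left mult.commute)
    show ?thesis unfolding eq by (rule periodic_add_int) (rule sin_periodic)
  qed
  then show ?thesis unfolding sine_series_def by (simp only:)
qed

text \<open>
  By periodicity the domain can be centred at \<open>\<theta>\<close>; with \<open>x = \<theta> - \<phi>\<close> it is then \<open>\<epsilon> \<le> |x| \<le> pi\<close>.
  Folding the negative half onto the positive one leaves \<open>cot(x/2) (f(\<theta>-x) - f(\<theta>+x))\<close> on
  \<open>[\<epsilon>, pi]\<close>, since \<open>cot\<close> is odd.
\<close>
lemma truncated_hilbert_integral:
  fixes b \<theta>
  assumes b: "summable (\<lambda>k. real k * \<bar>b k\<bar>)" and e: "0 < \<epsilon>" "\<epsilon> < pi"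
  shows "(LINT \<phi>:{\<phi> \<in> {-pi..pi}. \<forall>k::int. \<epsilon> \<le> \<bar>\<theta> - \<phi> - 2 * pi * of_int k\<bar>}|lebesgue.
       cot ((\<theta> - \<phi>) / 2) * sine_series b \<phi>)
     = - 2 * integral {\<epsilon>..pi} (\<lambda>x. \<Sum>k. b k * cos (real k * \<theta>) * conj_kernel k x)"
proof -
  define f where "f = sine_series b"
  define W where "W x = (\<Sum>k. b k * cos (real k * \<theta>) * conj_kernel k x)" for x
  define mask where "mask x \<longleftrightarrow> (\<forall>k::int. \<epsilon> \<le> \<bar>x - 2 * pi * of_int k\<bar>)" for x
  \<comment> \<open>The truncated integrand, in the variable \<open>x = \<theta> - \<phi>\<close>; it is periodic because \<open>f\<close>, the mask and \<open>cot(x/2)\<close> are.\<close>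
  define G where "G x = (if mask x then cot (x / 2) * f (\<theta> - x) else 0)" for x
  have fc: "continuous_on S f" for S
    unfolding f_def by (rule continuous_on_sine_series[OF summable_abs_of_weighted[OF b]])
  have fp: "f (x + 2 * pi) = f x" for x unfolding f_def by (rule sine_series_periodic)
  have maskp: "mask (x + 2 * pi) = mask x" for x
  proof -
    have *: "x + 2 * pi - 2 * pi * of_int k = x - 2 * pi * of_int (k - 1)" for k
      by (simp add: algebra_simps)
    show ?thesis
      unfolding mask_def *
    proof (intro iffI allI)
      fix k :: int
      assume "\<forall>k::int. \<epsilon> \<le> \<bar>x - 2 * pi * of_int (k - 1)\<bar>"
      from this[rule_format, of "k + 1"] show "\<epsilon> \<le> \<bar>x - 2 * pi * of_int k\<bar>" by simp
    qed blast
  qed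
  have Gp: "G (x + 2 * pi) = G x" for x
  proof -
    have "cot ((x + 2 * pi) / 2) = cot (x / 2)" by (simp add: cot_def add_divide_distrib)
    moreover have "f (\<theta> - (x + 2 * pi)) = f (\<theta> - x)" using fp[of "\<theta> - x - 2 * pi"] by (simp add: algebra_simps)
    ultimately show ?thesis by (simp add: G_def maskp)
  qed
  have mask_iff: "mask x \<longleftrightarrow> \<epsilon> \<le> \<bar>x\<bar>" if x: "\<bar>x\<bar> \<le> pi" for x
  proof
    assume "mask x" then show "\<epsilon> \<le> \<bar>x\<bar>" unfolding mask_def by (drule_tac spec[of _ 0]) simp
  next
    assume *: "\<epsilon> \<le> \<bar>x\<bar>"
    have "\<epsilon> \<le> \<bar>x - 2 * pi * of_int k\<bar>" for k
    proof (cases "k = 0")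
      case False
      then have "1 \<le> \<bar>real_of_int k\<bar>" by linarith
      then have "2 * pi * 1 \<le> 2 * pi * \<bar>real_of_int k\<bar>" by (intro mult_left_mono) auto
      also have "\<dots> = \<bar>2 * pi * of_int k\<bar>" by (simp add: abs_mult)
      finally show ?thesis using x e by linarith
    qed (use * in simp)
    then show "mask x" by (simp add: mask_def)
  qed
  have sinnz: "sin (x / 2) \<noteq> 0" if x: "x \<in> {\<epsilon>..pi} \<or> -x \<in> {\<epsilon>..pi}" for x
  proof -
    consider "0 < x" "x \<le> pi" | "0 < - x" "- x \<le> pi" using x e by force
    then show ?thesis
    proof cases
      case 1 then show ?thesis using sin_gt_zero[of "x / 2"] by simp
    next
      case 2 then show ?thesis using sin_gt_zero[of "- (x / 2)"] by simp
    qed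
  qed
  define g where "g x = cot (x / 2) * f (\<theta> - x)" for x
  define g' where "g' x = cot (x / 2) * f (\<theta> + x)" for x
  have gc: "continuous_on {\<epsilon>..pi} g" "continuous_on {\<epsilon>..pi} g'"
  proof -
    have nz: "\<forall>x\<in>{\<epsilon>..pi}. sin (x / 2) \<noteq> 0" using sinnz by blast
    have "continuous_on {\<epsilon>..pi} (\<lambda>x. cot (x / 2))"
      unfolding cot_def by (intro continuous_intros nz) auto
    moreover have "continuous_on {\<epsilon>..pi} (\<lambda>x. f (\<theta> - x))" "continuous_on {\<epsilon>..pi} (\<lambda>x. f (\<theta> + x))"
      by (rule continuous_on_compose2[OF fc[of UNIV]], auto intro!: continuous_intros)+
    ultimately show "continuous_on {\<epsilon>..pi} g" "continuous_on {\<epsilon>..pi} g'"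
      unfolding g_def[abs_def] g'_def[abs_def] by (auto intro: continuous_on_mult)
  qed
  have right: "(G has_integral integral {\<epsilon>..pi} g) {\<epsilon>..pi}"
    by (rule has_integral_eq[OF _ integrable_integral[OF integrable_continuous_interval[OF gc(1)]]])
      (use e in \<open>auto simp: G_def g_def mask_iff\<close>)
  have left: "(G has_integral - integral {\<epsilon>..pi} g') {-pi..-\<epsilon>}"
  proof (rule has_integral_eq)
    show "((\<lambda>x. - g' (0 - x)) has_integral - integral {\<epsilon>..pi} g') {-pi..-\<epsilon>}"
      using has_integral_neg[OF has_integral_reflect_about[OF integrable_integral[OF integrable_continuous_interval[OF gc(2)]], of 0]]
      by simp
    show "- g' (0 - x) = G x" if "x \<in> {-pi..-\<epsilon>}" for x
      using that e by (auto simp: G_def g'_def mask_iff cot_def)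
  qed
  have mid: "(G has_integral 0) {-\<epsilon>..\<epsilon>}"
    by (rule has_integral_spike_finite[of "{-\<epsilon>, \<epsilon>}" _ _ "\<lambda>_. 0"]) (use e in \<open>auto simp: G_def mask_iff\<close>)
  have "(G has_integral - integral {\<epsilon>..pi} g' + 0 + integral {\<epsilon>..pi} g) {-pi..pi}"
    by (rule has_integral_combine[OF _ _ has_integral_combine[OF _ _ left mid] right]) (use e in auto)
  also have "- integral {\<epsilon>..pi} g' + 0 + integral {\<epsilon>..pi} g = - integral {\<epsilon>..pi} (\<lambda>x. g' x - g x)"
    by (subst integral_diff) (auto intro!: integrable_continuous_interval gc)
  also have "integral {\<epsilon>..pi} (\<lambda>x. g' x - g x) = integral {\<epsilon>..pi} (\<lambda>x. 2 * W x)"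
  proof (rule integral_cong)
    fix x assume "x \<in> {\<epsilon>..pi}"
    with sinnz have "sin (x / 2) \<noteq> 0" by blast
    from conj_series(3)[OF b this, of \<theta>] show "g' x - g x = 2 * W x"
      unfolding W_def g_def g'_def f_def by (simp add: right_diff_distrib)
  qed
  finally have GI: "(G has_integral - 2 * integral {\<epsilon>..pi} W) {-pi..pi}" by simp
  have Gabs: "G absolutely_integrable_on {-pi..pi}"
  proof -
    have "G absolutely_integrable_on {\<epsilon>..pi}"
      by (rule absolutely_integrable_spike[OF absolutely_integrable_continuous_real[OF gc(1)] negligible_empty])
        (use e in \<open>auto simp: G_def g_def mask_iff\<close>)
    moreover have "G absolutely_integrable_on {-pi..-\<epsilon>}"
    proof (rule absolutely_integrable_spike[OF _ negligible_empty])
      have "continuous_on {-pi..-\<epsilon>} (\<lambda>x. - g' (- x))"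
        by (intro continuous_intros continuous_on_compose2[OF gc(2)]) auto
      then show "(\<lambda>x. - g' (- x)) absolutely_integrable_on {-pi..-\<epsilon>}"
        by (rule absolutely_integrable_continuous_real)
      show "G x = - g' (- x)" if "x \<in> {-pi..-\<epsilon>} - {}" for x
        using that e by (auto simp: G_def g'_def mask_iff cot_def)
    qed
    moreover have "G absolutely_integrable_on {-\<epsilon>..\<epsilon>}"
      by (rule absolutely_integrable_spike[where f="\<lambda>_. 0" and S="{-\<epsilon>, \<epsilon>}"]) (use e in \<open>auto simp: G_def mask_iff\<close>)
    ultimately show ?thesis
      using absolutely_integrable_on_combine[where f=G and a="-pi" and c="-\<epsilon>" and b=\<epsilon>]
        absolutely_integrable_on_combine[where f=G and a="-pi" and c=\<epsilon> and b=pi] e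
      by auto
  qed
  have "(LINT \<phi>:{\<phi> \<in> {-pi..pi}. \<forall>k::int. \<epsilon> \<le> \<bar>\<theta> - \<phi> - 2 * pi * of_int k\<bar>}|lebesgue. cot ((\<theta> - \<phi>) / 2) * f \<phi>)
     = (LINT \<phi>:{-pi..pi}|lebesgue. G (\<theta> - \<phi>))"
    unfolding set_lebesgue_integral_def
    by (rule Bochner_Integration.integral_cong) (auto simp: G_def mask_def indicator_def)
  also have "\<dots> = integral {-pi..pi} (\<lambda>\<phi>. G (\<theta> - \<phi>))"
    by (rule set_lebesgue_integral_eq_integral(2)[OF absolutely_integrable_periodic_reflect[OF Gp Gabs]])
  also have "\<dots> = - 2 * integral {\<epsilon>..pi} W"
    by (rule integral_unique[OF has_integral_periodic_reflect[OF Gp GI]])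
  finally show ?thesis unfolding f_def W_def[abs_def] .
qed

text \<open>
  The integrand that remains after folding is continuous up to \<open>x = 0\<close>, so the principal value is the
  integral over \<open>[0, pi]\<close>, and each kernel integrates to \<open>pi\<close> there. This is \<open>H sin(k\<theta>) = - cos(k\<theta>)\<close>,
  summed over \<open>k\<close>.
\<close>
lemma hilbert_sine_series:
  assumes b: "summable (\<lambda>k. real k * \<bar>b k\<bar>)" "b 0 = 0"
  shows "hilbert (sine_series b) = (\<lambda>\<theta>. - cosine_series b \<theta>)"
proof
  fix \<theta>
  define W where "W = (\<lambda>x. \<Sum>k. b k * cos (real k * \<theta>) * conj_kernel k x)"
  have Wc: "continuous_on S W" for S unfolding W_def by (rule conj_series(1)[OF b(1)])
  have WI: "integral {0..pi} W = pi * cosine_series b \<theta>"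
    unfolding W_def using conj_series(2)[OF b(1), of \<theta>] b(2) by simp
  have "continuous_on {0..pi} (\<lambda>\<epsilon>. integral {\<epsilon>..pi} W)"
    by (rule indefinite_integral_continuous_1'[OF integrable_continuous_interval[OF Wc]])
  then have "((\<lambda>\<epsilon>. integral {\<epsilon>..pi} W) \<longlongrightarrow> integral {0..pi} W) (at 0 within {0..pi})"
    by (auto simp: continuous_on)
  then have "((\<lambda>\<epsilon>. integral {\<epsilon>..pi} W) \<longlongrightarrow> integral {0..pi} W) (at_right 0)"
    by (simp add: at_within_Icc_at_right)
  then have lim: "((\<lambda>\<epsilon>. - 2 * integral {\<epsilon>..pi} W) \<longlongrightarrow> - 2 * integral {0..pi} W) (at_right 0)"
    by (rule tendsto_mult_left)
  have "\<forall>\<^sub>F \<epsilon> in at_right (0::real). 0 < \<epsilon> \<and> \<epsilon> < pi"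
    using eventually_at_right_real[of 0 pi] by simp
  then have "\<forall>\<^sub>F \<epsilon> in at_right 0. - 2 * integral {\<epsilon>..pi} W =
    (LINT \<phi>:{\<phi> \<in> {-pi..pi}. \<forall>k::int. \<epsilon> \<le> \<bar>\<theta> - \<phi> - 2 * pi * of_int k\<bar>}|lebesgue. cot ((\<theta> - \<phi>) / 2) * sine_series b \<phi>)"
    by eventually_elim (unfold W_def, rule truncated_hilbert_integral[OF b(1), symmetric], auto)
  from Lim_transform_eventually[OF lim this]
  show "hilbert (sine_series b) \<theta> = - cosine_series b \<theta>"
    unfolding hilbert_def by (subst tendsto_Lim) (auto simp: WI)
qed

lemma sine_series_minus: 
  assumes "summable (\<lambda>n. \<bar>x n\<bar>)"
  shows "sine_series (\<lambda>n. - x n) \<theta> = - sine_series x \<theta>"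
  unfolding sine_series_def using suminf_minus[OF summable_mult_bounded[OF assms, of "\<lambda>n. sin (real n * \<theta>)"]] by simp

lemma vel_sine_series:
  assumes b: "summable (\<lambda>k. real k * \<bar>b k\<bar>)" "b 0 = 0"
  shows "vel (sine_series b) = sine_series (\<lambda>k. - b k / real k)"
proof -
  have sb: "summable (\<lambda>k. \<bar>b k\<bar>)" by (rule summable_abs_of_weighted[OF b(1)])
  have s: "summable (\<lambda>k. real k * \<bar>- b k / real k\<bar>)"
    by (rule summable_comparison_test'[OF sb, of 0]) (auto simp: abs_mult)
  have d: "(sine_series (\<lambda>k. - b k / real k) has_real_derivative hilbert (sine_series b) \<theta>) (at \<theta>)" for \<theta>
  proof -
    have "cosine_series (\<lambda>k. real k * (- b k / real k)) \<theta> = (\<Sum>k. - (b k * cos (real k * \<theta>)))"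
      unfolding cosine_series_def by (rule suminf_cong) (use b(2) in auto)
    also have "\<dots> = - cosine_series b \<theta>"
      unfolding cosine_series_def by (rule suminf_minus[OF summable_mult_bounded[OF sb]]) simp
    finally show ?thesis
      using sine_series_has_derivative[OF s, of \<theta>] hilbert_sine_series[OF b] by simp
  qed
  have z: "sine_series x 0 = 0" for x by (simp add: sine_series_def)
  show ?thesis
    unfolding vel_def
  proof (rule the_equality)
    fix v assume v: "(\<forall>\<theta>. (v has_real_derivative hilbert (sine_series b) \<theta>) (at \<theta>)) \<and> v 0 = 0"
    show "v = sine_series (\<lambda>k. - b k / real k)"
    proof
      fix x
      have "((\<lambda>x. v x - sine_series (\<lambda>k. - b k / real k) x) has_real_derivative 0) (at y)" for y
        using DERIV_diff[OF v[THEN conjunct1, rule_format] d, of y] by simp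
      from DERIV_isconst_all[of "\<lambda>x. v x - sine_series (\<lambda>k. - b k / real k) x" x 0] this
      show "v x = sine_series (\<lambda>k. - b k / real k) x" using v z by auto
    qed
  qed (use d z in auto)
qed

section \<open>The matrix of the linearized operator\<close>

text \<open>
  The amplitude with which \<open>L\<close> couples \<open>e\<^sub>n\<^sub>-\<^sub>1\<close> to \<open>e\<^sub>n\<^sub>+\<^sub>1\<close>: it maps \<open>sin(n\<theta>)/n\<close> to
  \<open>- hop n (e\<^sub>n\<^sub>-\<^sub>1 + e\<^sub>n\<^sub>+\<^sub>1)\<close>. The zero at \<open>n = 2\<close> reflects \<open>L sin(2\<theta>) = 0\<close> and keeps \<open>e\<^sub>1\<close>, which is not in
  the space, out of the range; the value at \<open>n = 0\<close> is 0 by division by zero.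
\<close>
definition hop :: "nat \<Rightarrow> real" where
  "hop n = (real n - 2)\<^sup>2 * (real n + 2) / (4 * (real n)\<^sup>2)"

text \<open>
  The matrix of \<open>L\<close> in the basis \<open>e\<^sub>n\<close>. The entries that connect \<open>n\<close> with \<open>n + 2\<close> have opposite signs in
  the two directions: off the diagonal the matrix is antisymmetric.
\<close>
definition L_coeff :: "(nat \<Rightarrow> real) \<Rightarrow> nat \<Rightarrow> real" where
  "L_coeff a n = (if n < 2 then 0
     else (hop (n + 1) - hop (n - 1)) * a n + hop (n - 1) * a (n - 2) - hop (n + 1) * a (n + 2))"

text \<open>
  The right side is what the product formulas give for the coefficient of \<open>sin(m\<theta>)\<close> in \<open>L\<close> of a sine
  series. Both sides agree because \<open>L_coeff a n = - (D\<^sub>n\<^sub>+\<^sub>1 + D\<^sub>n\<^sub>-\<^sub>1)\<close> with \<open>D\<^sub>k = hop k (a\<^sub>k\<^sub>+\<^sub>1 - a\<^sub>k\<^sub>-\<^sub>1)\<close>, so the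
  difference of two such values telescopes. The term \<open>T 1\<close> comes from \<open>sin((1-2)\<theta>) = - sin \<theta>\<close>.
\<close>
lemma primitive_coeff_L_coeff:
  fixes a :: "nat \<Rightarrow> real" and m :: nat
  defines "S \<equiv> \<lambda>k. primitive_coeff a k * ((real k - 2)\<^sup>2 / (4 * real k))"
    and "T \<equiv> \<lambda>k. primitive_coeff a k * (((real k)\<^sup>2 - 4) / (4 * real k))"
  assumes m: "m \<noteq> 0"
  shows "primitive_coeff (L_coeff a) m =
    (if m < 2 then 0 else S (m - 2)) - T (m + 2) + (if m = 1 then T 1 else 0)"
proof -
  define D where "D k = hop k * (a (k + 1) - a (k - 1))" for k
  have DS: "D k = (real k + 2) * S k" and DT: "D k = (real k - 2) * T k" for k
  proof -
    have "(x - 2)\<^sup>2 * (x + 2) / (4 * x\<^sup>2) * X = (x + 2) * (X / x * ((x - 2)\<^sup>2 / (4 * x)))"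
      "(x - 2)\<^sup>2 * (x + 2) / (4 * x\<^sup>2) * X = (x - 2) * (X / x * ((x\<^sup>2 - 4) / (4 * x)))" for x X :: real
    proof -
      have f: "x\<^sup>2 - 4 = (x - 2) * (x + 2)" by (simp add: power2_eq_square algebra_simps)
      show "(x - 2)\<^sup>2 * (x + 2) / (4 * x\<^sup>2) * X = (x + 2) * (X / x * ((x - 2)\<^sup>2 / (4 * x)))"
        by (simp add: power2_eq_square mult.commute mult.left_commute)
      show "(x - 2)\<^sup>2 * (x + 2) / (4 * x\<^sup>2) * X = (x - 2) * (X / x * ((x\<^sup>2 - 4) / (4 * x)))"
        unfolding f by (simp add: power2_eq_square mult.commute mult.left_commute)
    qed
    then show "D k = (real k + 2) * S k" "D k = (real k - 2) * T k"
      unfolding D_def S_def T_def hop_def primitive_coeff_def by blast+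
  qed
  \<comment> \<open>These two zeros make the formula for \<open>L_coeff\<close> valid at \<open>n = 1\<close> as well.\<close>
  have D0: "D 0 = 0" "D 2 = 0" by (simp_all add: D_def hop_def)
  have L: "L_coeff a n = - (D (n + 1) + D (n - 1))" if "1 \<le> n" for n
  proof (cases "n = 1")
    case True then show ?thesis using D0 by (simp add: L_coeff_def numeral_2_eq_2)
  next
    case False
    define j where "j = n - 2"
    have "n = j + 2" using that False unfolding j_def by linarith
    then show ?thesis by (simp add: L_coeff_def D_def algebra_simps numeral_2_eq_2)
  qed
  show ?thesis
  proof (cases "m = 1")
    case True
    have "primitive_coeff (L_coeff a) 1 = L_coeff a 2" by (simp add: primitive_coeff_def L_coeff_def numeral_2_eq_2)
    also have "\<dots> = - (D 3 + D 1)" using L[of 2] by (simp add: numeral_3_eq_3 numeral_2_eq_2)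
    also have "\<dots> = - T 3 + T 1" using DT[of 3] DT[of 1] by simp
    finally show ?thesis using True by (simp add: numeral_3_eq_3 numeral_2_eq_2)
  next
    case False
    define j where "j = m - 2"
    have j: "m = j + 2" using m False unfolding j_def by linarith
    have "L_coeff a (m + 1) - L_coeff a (m - 1) = D j - D (j + 4)"
      using L[of "m + 1"] L[of "m - 1"] unfolding j by (simp add: numeral_eq_Suc)
    also have "\<dots> = real m * (S j - T (j + 4))"
      using DS[of j] DT[of "j + 4"] unfolding j by (simp add: algebra_simps)
    finally show ?thesis using m unfolding primitive_coeff_def[of "L_coeff a"] by (simp add: j numeral_eq_Suc)
  qed
qed

text \<open>
  The left side is \<open>L\<close> applied to \<open>sin(k\<theta>)\<close>, with \<open>H sin(k\<theta>) = - cos(k\<theta>)\<close> and \<open>v = - sin(k\<theta>)/k\<close>.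
\<close>
lemma sine_mode_L:
  fixes k \<theta> :: real
  assumes "k \<noteq> 0"
  shows "1 / 2 * sin (2 * \<theta>) * (k * cos (k * \<theta>)) - cos (2 * \<theta>) * sin (k * \<theta>)
      - sin (2 * \<theta>) * cos (k * \<theta>) + 2 / k * cos (2 * \<theta>) * sin (k * \<theta>)
    = (k - 2)\<^sup>2 / (4 * k) * sin ((k + 2) * \<theta>) - (k\<^sup>2 - 4) / (4 * k) * sin ((k - 2) * \<theta>)"
  using assms unfolding distrib_right left_diff_distrib sin_add sin_diff
  by (simp add: field_simps power2_eq_square)

text \<open>
  Apply \<open>L\<close> to each sine mode and reorder by frequency: mode \<open>k\<close> feeds the frequencies \<open>k + 2\<close> and
  \<open>k - 2\<close>, so the two halves of the series are shifted in opposite directions before they are added.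
\<close>
lemma L_op_expansion:
  assumes a: "summable (\<lambda>n. \<bar>a n\<bar>)"
  shows "L_op (expansion a) = expansion (L_coeff a)"
proof
  fix \<theta>
  define b where "b = primitive_coeff a"
  \<comment> \<open>The amplitudes that mode \<open>k\<close> sends up to \<open>k + 2\<close> and, with a minus sign, down to \<open>k - 2\<close>.\<close>
  define S where "S k = b k * ((real k - 2)\<^sup>2 / (4 * real k))" for k
  define T where "T k = b k * (((real k)\<^sup>2 - 4) / (4 * real k))" for k
  have b0: "b 0 = 0" by (simp add: b_def primitive_coeff_def)
  have wb: "summable (\<lambda>k. real k * \<bar>b k\<bar>)" unfolding b_def by (rule summable_primitive_coeff_weighted[OF a])
  have sb: "summable (\<lambda>k. \<bar>b k\<bar>)" unfolding b_def by (rule summable_primitive_coeff[OF a])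
  have sS: "summable (\<lambda>k. \<bar>S k\<bar>)" and sT: "summable (\<lambda>k. \<bar>T k\<bar>)"
  proof -
    have "\<bar>(real k - 2)\<^sup>2 / (4 * real k)\<bar> \<le> real k \<and> \<bar>((real k)\<^sup>2 - 4) / (4 * real k)\<bar> \<le> real k" for k
    proof (cases "k = 0")
      case False
      then have k: "1 \<le> real k" by simp
      have "(real k - 2)\<^sup>2 \<le> real k * (4 * real k)"
      proof -
        have "0 \<le> (3 * real k - 2) * (real k + 2)" using k by (intro mult_nonneg_nonneg) auto
        then show ?thesis by (simp add: power2_eq_square algebra_simps)
      qed
      moreover have "\<bar>(real k)\<^sup>2 - 4\<bar> \<le> real k * (4 * real k)"
      proof -
        have "1 \<le> real k * real k" using mult_mono[of 1 "real k" 1 "real k"] k by simp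
        then show ?thesis by (simp add: power2_eq_square abs_le_iff)
      qed
      ultimately show ?thesis using k by (simp add: abs_divide abs_mult divide_le_eq)
    qed simp
    then have "\<bar>S k\<bar> \<le> real k * \<bar>b k\<bar>" "\<bar>T k\<bar> \<le> real k * \<bar>b k\<bar>" for k
      unfolding S_def T_def abs_mult by (metis abs_ge_zero mult.commute mult_left_mono)+
    then show "summable (\<lambda>k. \<bar>S k\<bar>)" "summable (\<lambda>k. \<bar>T k\<bar>)"
      by (intro summable_comparison_test'[OF wb, of 0]; simp)+
  qed
  have s_b: "(\<lambda>k. b k * sin (real k * \<theta>)) sums sine_series b \<theta>"
    unfolding sine_series_def by (rule summable_sums[OF summable_mult_bounded[OF sb]]) simp
  have c_b: "(\<lambda>k. b k * cos (real k * \<theta>)) sums cosine_series b \<theta>"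
    unfolding cosine_series_def by (rule summable_sums[OF summable_mult_bounded[OF sb]]) simp
  have c_kb: "(\<lambda>k. real k * b k * cos (real k * \<theta>)) sums cosine_series (\<lambda>k. real k * b k) \<theta>"
    unfolding cosine_series_def by (rule summable_sums[OF summable_mult_bounded]) (use wb in \<open>simp_all add: abs_mult\<close>)
  have s_bk: "(\<lambda>k. - b k / real k * sin (real k * \<theta>)) sums sine_series (\<lambda>k. - b k / real k) \<theta>"
    unfolding sine_series_def
    by (rule summable_sums[OF summable_mult_bounded]) (use summable_abs_divide_nat[OF sb] in simp_all)
  have "(\<lambda>k. 1 / 2 * sin (2 * \<theta>) * (real k * b k * cos (real k * \<theta>)) - cos (2 * \<theta>) * (b k * sin (real k * \<theta>))
      + sin (2 * \<theta>) * - (b k * cos (real k * \<theta>)) - 2 * cos (2 * \<theta>) * (- b k / real k * sin (real k * \<theta>))) sums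
     (1 / 2 * sin (2 * \<theta>) * cosine_series (\<lambda>k. real k * b k) \<theta> - cos (2 * \<theta>) * sine_series b \<theta>
      + sin (2 * \<theta>) * - cosine_series b \<theta> - 2 * cos (2 * \<theta>) * sine_series (\<lambda>k. - b k / real k) \<theta>)"
    by (intro sums_add sums_diff sums_mult sums_minus s_b c_b c_kb s_bk)
  also have "1 / 2 * sin (2 * \<theta>) * cosine_series (\<lambda>k. real k * b k) \<theta> - cos (2 * \<theta>) * sine_series b \<theta>
      + sin (2 * \<theta>) * - cosine_series b \<theta> - 2 * cos (2 * \<theta>) * sine_series (\<lambda>k. - b k / real k) \<theta>
     = L_op (expansion a) \<theta>"
    unfolding L_op_def expansion_def b_def[symmetric]
    using DERIV_imp_deriv[OF sine_series_has_derivative[OF wb, of \<theta>]]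
    by (simp add: hilbert_sine_series[OF wb b0] vel_sine_series[OF wb b0])
  also have "(\<lambda>k. 1 / 2 * sin (2 * \<theta>) * (real k * b k * cos (real k * \<theta>)) - cos (2 * \<theta>) * (b k * sin (real k * \<theta>))
      + sin (2 * \<theta>) * - (b k * cos (real k * \<theta>)) - 2 * cos (2 * \<theta>) * (- b k / real k * sin (real k * \<theta>)))
     = (\<lambda>k. S k * sin ((real k + 2) * \<theta>) - T k * sin ((real k - 2) * \<theta>))"
  proof
    fix k
    show "1 / 2 * sin (2 * \<theta>) * (real k * b k * cos (real k * \<theta>)) - cos (2 * \<theta>) * (b k * sin (real k * \<theta>))
      + sin (2 * \<theta>) * - (b k * cos (real k * \<theta>)) - 2 * cos (2 * \<theta>) * (- b k / real k * sin (real k * \<theta>))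
     = S k * sin ((real k + 2) * \<theta>) - T k * sin ((real k - 2) * \<theta>)"
    proof (cases "k = 0")
      case False
      then have "real k \<noteq> 0" by simp
      from arg_cong[OF sine_mode_L[OF this, of \<theta>], of "\<lambda>x. b k * x"] show ?thesis
        unfolding S_def T_def by (simp add: algebra_simps)
    qed (simp add: S_def T_def b0)
  qed
  finally have A: "(\<lambda>k. S k * sin ((real k + 2) * \<theta>) - T k * sin ((real k - 2) * \<theta>)) sums L_op (expansion a) \<theta>" .
  have sumS: "summable (\<lambda>k. S k * sin ((real k + 2) * \<theta>))" and sumT: "summable (\<lambda>k. T k * sin ((real k - 2) * \<theta>))"
    by (rule summable_mult_bounded[OF sS], simp) (rule summable_mult_bounded[OF sT], simp)
  define s t where "s = (\<Sum>k. S k * sin ((real k + 2) * \<theta>))" and "t = (\<Sum>k. T k * sin ((real k - 2) * \<theta>))"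
  have Ls: "L_op (expansion a) \<theta> = s - t"
    using sums_unique2[OF A sums_diff[OF summable_sums[OF sumS] summable_sums[OF sumT]]] by (simp add: s_def t_def)
  have S': "(\<lambda>m. (if m < 2 then 0 else S (m - 2)) * sin (real m * \<theta>)) sums s"
    by (subst sums_iff_shift'[of _ 2, symmetric])
      (use summable_sums[OF sumS] in \<open>simp add: s_def add.commute\<close>)
  have T0: "T 0 = 0" by (simp add: T_def)
  have "(\<lambda>k. T (k + 2) * sin ((real (k + 2) - 2) * \<theta>)) sums (t - (\<Sum>k<2. T k * sin ((real k - 2) * \<theta>)))"
    using summable_sums[OF sumT] unfolding t_def[symmetric] by (subst sums_iff_shift) simp
  also have "(\<Sum>k<2. T k * sin ((real k - 2) * \<theta>)) = - (T 1 * sin \<theta>)"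
    by (simp add: numeral_2_eq_2 T0)
  finally have T': "(\<lambda>m. T (m + 2) * sin (real m * \<theta>)) sums (t + T 1 * sin \<theta>)" by simp
  have one: "(\<lambda>m. if m = 1 then T m * sin (real m * \<theta>) else 0) sums (T 1 * sin (real 1 * \<theta>))"
    by (rule sums_single)
  have "(\<lambda>m. (if m < 2 then 0 else S (m - 2)) * sin (real m * \<theta>) - T (m + 2) * sin (real m * \<theta>)
      + (if m = 1 then T m * sin (real m * \<theta>) else 0)) sums (s - (t + T 1 * sin \<theta>) + T 1 * sin (real 1 * \<theta>))"
    by (intro sums_add sums_diff S' T' one)
  also have "s - (t + T 1 * sin \<theta>) + T 1 * sin (real 1 * \<theta>) = L_op (expansion a) \<theta>" by (simp add: Ls)
  also have "(\<lambda>m. (if m < 2 then 0 else S (m - 2)) * sin (real m * \<theta>) - T (m + 2) * sin (real m * \<theta>)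
      + (if m = 1 then T m * sin (real m * \<theta>) else 0)) = (\<lambda>m. primitive_coeff (L_coeff a) m * sin (real m * \<theta>))"
  proof
    fix m
    show "(if m < 2 then 0 else S (m - 2)) * sin (real m * \<theta>) - T (m + 2) * sin (real m * \<theta>)
      + (if m = 1 then T m * sin (real m * \<theta>) else 0) = primitive_coeff (L_coeff a) m * sin (real m * \<theta>)"
    proof (cases "m = 0")
      case False
      show ?thesis
        unfolding primitive_coeff_L_coeff[OF False] S_def T_def b_def
        by (simp add: left_diff_distrib distrib_right)
    qed simp
  qed
  finally show "L_op (expansion a) \<theta> = expansion (L_coeff a) \<theta>"
    unfolding expansion_def sine_series_def by (rule sums_unique)
qed

lemma hop_bound: "0 \<le> hop n" "hop n \<le> real n"
proof -
  show "0 \<le> hop n" by (simp add: hop_def)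
  show "hop n \<le> real n"
  proof (cases "n = 0")
    case False
    then have n: "1 \<le> real n" by simp
    have "(real n - 2)\<^sup>2 \<le> (real n)\<^sup>2"
      using n by (simp add: abs_le_square_iff[symmetric])
    then have "(real n - 2)\<^sup>2 * (real n + 2) \<le> (real n)\<^sup>2 * (4 * real n)"
      using n by (intro mult_mono) auto
    then show ?thesis using n by (simp add: hop_def divide_le_eq mult_ac)
  qed (simp add: hop_def)
qed

section \<open>Completeness of the sine system\<close>

lemma absolutely_integrable_mult_continuous:
  fixes f g :: "real \<Rightarrow> real"
  assumes "f absolutely_integrable_on {a..b}" "continuous_on {a..b} g"
  shows "(\<lambda>x. f x * g x) absolutely_integrable_on {a..b}"
proof -
  have "(\<lambda>x. g x * f x) absolutely_integrable_on {a..b}"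
  proof (rule absolutely_integrable_bounded_measurable_product_real[OF _ _ _ assms(1)])
    show "g \<in> borel_measurable (lebesgue_on {a..b})"
      by (rule continuous_imp_measurable_on_sets_lebesgue[OF assms(2)]) simp
    show "bounded (g ` {a..b})"
      using assms(2) compact_continuous_image compact_imp_bounded compact_Icc by blast
  qed simp
  then show ?thesis by (simp add: mult.commute)
qed

lemma integrable_mult_continuous:
  fixes f g :: "real \<Rightarrow> real"
  assumes "f absolutely_integrable_on {a..b}" "continuous_on {a..b} g"
  shows "(\<lambda>x. f x * g x) integrable_on {a..b}"
  by (rule set_lebesgue_integral_eq_integral(1)[OF absolutely_integrable_mult_continuous[OF assms]])

text \<open>
  By the product formula \<open>sin(n\<theta>) cos \<theta>\<close> is a combination of \<open>sin((n+1)\<theta>)\<close> and \<open>sin((n-1)\<theta>)\<close>, so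
  orthogonality to all sines passes to all \<open>sin(n\<theta>) cos\<^sup>i \<theta>\<close>.
\<close>
lemma integral_zero_mult_sin_cos_power:
  fixes f :: "real \<Rightarrow> real"
  assumes f: "f absolutely_integrable_on {-pi..pi}"
    and orth: "\<And>n::nat. integral {-pi..pi} (\<lambda>\<theta>. f \<theta> * sin (real n * \<theta>)) = 0"
  shows "integral {-pi..pi} (\<lambda>\<theta>. f \<theta> * (sin (real n * \<theta>) * cos \<theta> ^ i)) = 0"
proof (induction i arbitrary: n)
  case 0
  then show ?case using orth by simp
next
  case (Suc i)
  show ?case
  proof (cases "n = 0")
    case False
    have eq: "f \<theta> * (sin (real n * \<theta>) * cos \<theta> ^ Suc i) =
       1 / 2 * (f \<theta> * (sin (real (n + 1) * \<theta>) * cos \<theta> ^ i)) + 1 / 2 * (f \<theta> * (sin (real (n - 1) * \<theta>) * cos \<theta> ^ i))" for \<theta>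
    proof -
      have "real (n + 1) * \<theta> = real n * \<theta> + \<theta>" "real (n - 1) * \<theta> = real n * \<theta> - \<theta>"
        using False by (simp_all add: of_nat_diff algebra_simps)
      then show ?thesis by (simp only: sin_add sin_diff) (simp add: algebra_simps)
    qed
    have "((\<lambda>\<theta>. f \<theta> * (sin (real k * \<theta>) * cos \<theta> ^ i)) has_integral 0) {-pi..pi}" for k
      using integrable_integral[OF integrable_mult_continuous[OF f, of "\<lambda>\<theta>. sin (real k * \<theta>) * cos \<theta> ^ i"]]
      by (simp add: Suc continuous_intros)
    then have "((\<lambda>\<theta>. f \<theta> * (sin (real n * \<theta>) * cos \<theta> ^ Suc i)) has_integral 1 / 2 * 0 + 1 / 2 * 0) {-pi..pi}"
      unfolding eq by (intro has_integral_add has_integral_mult_right)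
    then show ?thesis by (simp add: integral_unique)
  qed simp
qed

text \<open>
  Since \<open>|\<theta>| = arccos(cos \<theta>)\<close> on \<open>[-pi, pi]\<close>, the Weierstrass theorem on \<open>[-1, 1]\<close> approximates \<open>h(|\<theta>|)\<close>
  uniformly by polynomials in \<open>cos \<theta>\<close>, and those were treated in the preceding lemma.
\<close>
lemma integral_zero_mult_sin_continuous:
  fixes f h :: "real \<Rightarrow> real"
  assumes f: "f absolutely_integrable_on {-pi..pi}"
    and orth: "\<And>n::nat. integral {-pi..pi} (\<lambda>\<theta>. f \<theta> * sin (real n * \<theta>)) = 0"
    and h: "continuous_on UNIV h"
  shows "integral {-pi..pi} (\<lambda>\<theta>. f \<theta> * (sin \<theta> * h \<bar>\<theta>\<bar>)) = 0"
proof -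
  define I where "I = integral {-pi..pi} (\<lambda>\<theta>. \<bar>f \<theta>\<bar>)"
  have fabs: "(\<lambda>\<theta>. \<bar>f \<theta>\<bar>) integrable_on {-pi..pi}"
    using f by (simp add: absolutely_integrable_on_def)
  have I0: "0 \<le> I" unfolding I_def by (rule integral_nonneg[OF fabs]) simp
  have le: "\<bar>integral {-pi..pi} (\<lambda>\<theta>. f \<theta> * (sin \<theta> * h \<bar>\<theta>\<bar>))\<bar> \<le> \<epsilon> * (I + 1)" if \<epsilon>: "0 < \<epsilon>" for \<epsilon>
  proof -
    have "continuous_on {-1..1} (\<lambda>x. h (arccos x))"
      by (rule continuous_on_compose2[OF h continuous_on_arccos']) simp
    then obtain p where p: "real_polynomial_function p" and ap: "\<And>x. x \<in> {-1..1} \<Longrightarrow> \<bar>h (arccos x) - p x\<bar> < \<epsilon>"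
      using Stone_Weierstrass_real_polynomial_function[of "{-1..1}" "\<lambda>x. h (arccos x)" \<epsilon>] \<epsilon> by auto
    obtain a N where pa: "p = (\<lambda>x. \<Sum>i\<le>N. a i * x ^ i)"
      using p real_polynomial_function_iff_sum by blast
    have pc: "continuous_on {-pi..pi} (\<lambda>\<theta>. p (cos \<theta>))" unfolding pa by (intro continuous_intros)
    have hc: "continuous_on {-pi..pi} (\<lambda>\<theta>. h \<bar>\<theta>\<bar>)"
      by (rule continuous_on_compose2[OF h]) (auto intro!: continuous_intros)
    have "((\<lambda>\<theta>. f \<theta> * (sin \<theta> * cos \<theta> ^ i)) has_integral 0) {-pi..pi}" for i
      using integrable_integral[OF integrable_mult_continuous[OF f, of "\<lambda>\<theta>. sin \<theta> * cos \<theta> ^ i"]]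
        integral_zero_mult_sin_cos_power[OF f orth, of 1 i]
      by (simp add: continuous_intros)
    then have "((\<lambda>\<theta>. \<Sum>i\<le>N. a i * (f \<theta> * (sin \<theta> * cos \<theta> ^ i))) has_integral (\<Sum>i\<le>N. a i * 0)) {-pi..pi}"
      by (intro has_integral_sum has_integral_mult_right) auto
    also have "(\<lambda>\<theta>. \<Sum>i\<le>N. a i * (f \<theta> * (sin \<theta> * cos \<theta> ^ i))) = (\<lambda>\<theta>. f \<theta> * (sin \<theta> * p (cos \<theta>)))"
      by (simp add: pa sum_distrib_left mult_ac)
    finally have p0: "((\<lambda>\<theta>. f \<theta> * (sin \<theta> * p (cos \<theta>))) has_integral 0) {-pi..pi}" by simp
    have ih: "(\<lambda>\<theta>. f \<theta> * (sin \<theta> * h \<bar>\<theta>\<bar>)) integrable_on {-pi..pi}"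
      by (rule integrable_mult_continuous[OF f]) (intro continuous_intros hc)
    from has_integral_diff[OF integrable_integral[OF ih] p0]
    have d: "((\<lambda>\<theta>. f \<theta> * (sin \<theta> * h \<bar>\<theta>\<bar>) - f \<theta> * (sin \<theta> * p (cos \<theta>))) has_integral
        integral {-pi..pi} (\<lambda>\<theta>. f \<theta> * (sin \<theta> * h \<bar>\<theta>\<bar>))) {-pi..pi}" by simp
    have "norm (integral {-pi..pi} (\<lambda>\<theta>. f \<theta> * (sin \<theta> * h \<bar>\<theta>\<bar>) - f \<theta> * (sin \<theta> * p (cos \<theta>))))
        \<le> integral {-pi..pi} (\<lambda>\<theta>. \<epsilon> * \<bar>f \<theta>\<bar>)"
    proof (rule Henstock_Kurzweil_Integration.integral_norm_bound_integral)
      show "(\<lambda>\<theta>. f \<theta> * (sin \<theta> * h \<bar>\<theta>\<bar>) - f \<theta> * (sin \<theta> * p (cos \<theta>))) integrable_on {-pi..pi}"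
        using d by blast
      show "(\<lambda>\<theta>. \<epsilon> * \<bar>f \<theta>\<bar>) integrable_on {-pi..pi}" by (rule integrable_on_cmult_left[OF fabs, simplified])
      fix \<theta> assume \<theta>: "\<theta> \<in> {-pi..pi}"
      then have "arccos (cos \<theta>) = \<bar>\<theta>\<bar>"
        by (cases "0 \<le> \<theta>") (auto simp: arccos_cos arccos_cos2)
      with ap[of "cos \<theta>"] have "\<bar>h \<bar>\<theta>\<bar> - p (cos \<theta>)\<bar> \<le> \<epsilon>" by simp
      then have "\<bar>sin \<theta>\<bar> * \<bar>h \<bar>\<theta>\<bar> - p (cos \<theta>)\<bar> \<le> 1 * \<epsilon>" by (intro mult_mono) auto
      then have "\<bar>f \<theta>\<bar> * (\<bar>sin \<theta>\<bar> * \<bar>h \<bar>\<theta>\<bar> - p (cos \<theta>)\<bar>) \<le> \<bar>f \<theta>\<bar> * (1 * \<epsilon>)" by (intro mult_left_mono) auto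
      moreover have "f \<theta> * (sin \<theta> * h \<bar>\<theta>\<bar>) - f \<theta> * (sin \<theta> * p (cos \<theta>)) = f \<theta> * (sin \<theta> * (h \<bar>\<theta>\<bar> - p (cos \<theta>)))"
        by (simp add: algebra_simps)
      ultimately show "norm (f \<theta> * (sin \<theta> * h \<bar>\<theta>\<bar>) - f \<theta> * (sin \<theta> * p (cos \<theta>))) \<le> \<epsilon> * \<bar>f \<theta>\<bar>"
        by (simp add: abs_mult mult.commute)
    qed
    also have "\<dots> = \<epsilon> * I" unfolding I_def by simp
    also have "\<dots> \<le> \<epsilon> * (I + 1)" using \<epsilon> by simp
    finally show ?thesis using integral_unique[OF d] by simp
  qed
  have "\<bar>integral {-pi..pi} (\<lambda>\<theta>. f \<theta> * (sin \<theta> * h \<bar>\<theta>\<bar>))\<bar> \<le> 0 + e" if "0 < e" for e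
  proof -
    have I1: "0 < I + 1" using I0 by simp
    then show ?thesis using le[of "e / (I + 1)"] that by simp
  qed
  then have "\<bar>integral {-pi..pi} (\<lambda>\<theta>. f \<theta> * (sin \<theta> * h \<bar>\<theta>\<bar>))\<bar> \<le> 0"
    by (rule field_le_epsilon)
  then show ?thesis by simp
qed

lemma negligible_nonzero_of_integral_zero:
  fixes f :: "real \<Rightarrow> real"
  assumes f: "f absolutely_integrable_on S" and nonneg: "\<And>x. x \<in> S \<Longrightarrow> 0 \<le> f x" and z: "integral S f = 0"
  shows "negligible {x \<in> S. f x \<noteq> 0}"
proof -
  have i: "integrable lebesgue (\<lambda>x. indicator S x *\<^sub>R f x)" using f by (simp add: set_integrable_def)
  have "integral\<^sup>L lebesgue (\<lambda>x. indicator S x *\<^sub>R f x) = 0"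
    using set_lebesgue_integral_eq_integral(2)[OF f] z by (simp add: set_lebesgue_integral_def)
  then have "AE x in lebesgue. indicator S x *\<^sub>R f x = 0"
    using integral_nonneg_eq_0_iff_AE[OF i] nonneg by (auto simp: indicator_def)
  then obtain N where N: "N \<in> null_sets lebesgue" "{x \<in> space lebesgue. indicator S x *\<^sub>R f x \<noteq> 0} \<subseteq> N"
    by (auto simp: eventually_ae_filter)
  have "{x \<in> S. f x \<noteq> 0} \<subseteq> {x \<in> space lebesgue. indicator S x *\<^sub>R f x \<noteq> 0}" by auto
  with N show ?thesis
    using negligible_iff_null_sets negligible_subset by blast
qed

text \<open>
  Completeness of the sine system. One would like to test \<open>f\<close> against the bounded function
  \<open>sin \<theta> f(|\<theta>|) / (1 + |f(|\<theta>|)|)\<close>. It need not be continuous, but \<open>f\<close> is almost everywhere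
  a limit of continuous functions, so dominated convergence applies. As \<open>f\<close> is odd,
  the result is that \<open>|sin \<theta>| f\<^sup>2 / (1 + |f|)\<close> has integral zero.
\<close>
lemma odd_null_of_sine_orthogonal:
  fixes f :: "real \<Rightarrow> real"
  assumes f: "f absolutely_integrable_on {-pi..pi}"
    and orth: "\<And>n::nat. integral {-pi..pi} (\<lambda>\<theta>. f \<theta> * sin (real n * \<theta>)) = 0"
    and odd: "\<And>\<theta>. f (- \<theta>) = - f \<theta>"
  shows "\<exists>N. negligible N \<and> (\<forall>\<theta>\<in>{-pi..pi} - N. f \<theta> = 0)"
proof -
  have fm: "f \<in> borel_measurable (lebesgue_on {-pi..pi})"
    using f absolutely_integrable_measurable[of "{-pi..pi}" f] by simp
  then have "f measurable_on {-pi..pi}" by (simp add: measurable_on_iff_borel_measurable)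
  then obtain N g where N: "negligible N" and g: "\<And>n. continuous_on UNIV (g n)"
    and lim: "\<And>x. x \<notin> N \<Longrightarrow> (\<lambda>n. g n x) \<longlonglongrightarrow> (if x \<in> {-pi..pi} then f x else 0)"
    unfolding measurable_on_def by blast
  \<comment> \<open>The test functions are evaluated at \<open>|\<theta>|\<close>, so the exceptional set must be symmetric.\<close>
  define M where "M = N \<union> uminus ` N"
  have M: "negligible M" unfolding M_def
    by (intro negligible_Un N negligible_differentiable_image_negligible)
      (auto intro!: derivative_intros simp: differentiable_on_def)
  \<comment> \<open>Continuous, bounded by 1, and convergent to \<open>f / (1 + |f|)\<close> on \<open>[-pi, pi]\<close> off \<open>N\<close>.\<close>
  define h where "h n x = g n x / (1 + \<bar>g n x\<bar>)" for n x
  have hc: "continuous_on UNIV (h n)" for n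
    unfolding h_def[abs_def] by (intro continuous_intros g) (auto simp: add_nonneg_eq_0_iff)
  have h1: "\<bar>h n x\<bar> \<le> 1" for n x by (simp add: h_def divide_le_eq)
  define F where "F n \<theta> = (if \<theta> \<in> M then 0 else f \<theta> * (sin \<theta> * h n \<bar>\<theta>\<bar>))" for n \<theta>
  define G where "G \<theta> = (if \<theta> \<in> M then 0 else \<bar>sin \<theta>\<bar> * ((f \<theta>)\<^sup>2 / (1 + \<bar>f \<theta>\<bar>)))" for \<theta>
  have hc': "continuous_on {-pi..pi} (\<lambda>\<theta>. sin \<theta> * h n \<bar>\<theta>\<bar>)" for n
    by (intro continuous_intros continuous_on_compose2[OF hc]) auto
  have Fi: "F n absolutely_integrable_on {-pi..pi}" for n
    by (rule absolutely_integrable_spike[OF absolutely_integrable_mult_continuous[OF f hc'[of n]] M]) (simp add: F_def)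
  have F0: "integral {-pi..pi} (F n) = 0" for n
    using integral_spike[OF M, of "{-pi..pi}" "F n" "\<lambda>\<theta>. f \<theta> * (sin \<theta> * h n \<bar>\<theta>\<bar>)"]
      integral_zero_mult_sin_continuous[OF f orth hc[of n]]
    by (simp add: F_def)
  have fabs: "(\<lambda>\<theta>. \<bar>f \<theta>\<bar>) integrable_on {-pi..pi}"
    using f by (simp add: absolutely_integrable_on_def)
  have Fb: "norm (F n \<theta>) \<le> \<bar>f \<theta>\<bar>" for n \<theta>
  proof -
    have "\<bar>sin \<theta>\<bar> * \<bar>h n \<bar>\<theta>\<bar>\<bar> \<le> 1 * 1" by (intro mult_mono h1) auto
    then show ?thesis
      using mult_left_mono[of "\<bar>sin \<theta>\<bar> * \<bar>h n \<bar>\<theta>\<bar>\<bar>" 1 "\<bar>f \<theta>\<bar>"] by (simp add: F_def abs_mult)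
  qed
  have FG: "(\<lambda>n. F n \<theta>) \<longlonglongrightarrow> G \<theta>" if \<theta>: "\<theta> \<in> {-pi..pi}" for \<theta>
  proof (cases "\<theta> \<in> M")
    case False
    then have "\<bar>\<theta>\<bar> \<notin> N" by (auto simp: M_def abs_if image_iff split: if_splits)
    then have "(\<lambda>n. g n \<bar>\<theta>\<bar>) \<longlonglongrightarrow> f \<bar>\<theta>\<bar>" using lim[of "\<bar>\<theta>\<bar>"] \<theta> by (auto simp: abs_if split: if_splits)
    then have "(\<lambda>n. f \<theta> * (sin \<theta> * h n \<bar>\<theta>\<bar>)) \<longlonglongrightarrow> f \<theta> * (sin \<theta> * (f \<bar>\<theta>\<bar> / (1 + \<bar>f \<bar>\<theta>\<bar>\<bar>)))"
      unfolding h_def by (intro tendsto_intros) auto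
    moreover have "f \<theta> * (sin \<theta> * (f \<bar>\<theta>\<bar> / (1 + \<bar>f \<bar>\<theta>\<bar>\<bar>))) = G \<theta>"
    proof (cases "0 \<le> \<theta>")
      case True
      then have "0 \<le> sin \<theta>" using \<theta> by (intro sin_ge_zero) auto
      then show ?thesis using True False by (simp add: G_def power2_eq_square)
    next
      case neg: False
      then have "0 \<le> sin (- \<theta>)" using \<theta> by (intro sin_ge_zero) auto
      then have s: "\<bar>sin \<theta>\<bar> = - sin \<theta>" by simp
      show ?thesis using neg False odd[of \<theta>] by (simp add: G_def s power2_eq_square)
    qed
    ultimately show ?thesis using False by (simp add: F_def)
  qed (simp add: F_def G_def)
  have "(\<lambda>n. integral {-pi..pi} (F n)) \<longlonglongrightarrow> integral {-pi..pi} G"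
    by (rule dominated_convergence(2)[OF _ fabs Fb FG]) (use Fi set_lebesgue_integral_eq_integral(1) in blast)
  then have G0: "integral {-pi..pi} G = 0" using F0 by (simp add: LIMSEQ_const_iff)
  have Gi: "G absolutely_integrable_on {-pi..pi}"
  proof (rule dominated_convergence_absolutely_integrable[OF Fi fabs _ FG])
    show "norm (G \<theta>) \<le> \<bar>f \<theta>\<bar>" if "\<theta> \<in> {-pi..pi}" for \<theta>
      by (rule LIMSEQ_le_const2[OF tendsto_norm[OF FG[OF that]]]) (use Fb in blast)
  qed
  have "negligible {\<theta> \<in> {-pi..pi}. G \<theta> \<noteq> 0}"
    by (rule negligible_nonzero_of_integral_zero[OF Gi _ G0]) (simp add: G_def)
  then have "negligible (M \<union> {\<theta> \<in> {-pi..pi}. G \<theta> \<noteq> 0} \<union> {-pi, 0, pi})"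
    using M by (auto intro!: negligible_Un)
  moreover have "f \<theta> = 0" if "\<theta> \<in> {-pi..pi} - (M \<union> {\<theta> \<in> {-pi..pi}. G \<theta> \<noteq> 0} \<union> {-pi, 0, pi})" for \<theta>
  proof -
    have "sin \<theta> \<noteq> 0" using that by (intro sin_nonzero_off_multiples) auto
    moreover have "G \<theta> = 0" "\<theta> \<notin> M" using that by auto
    moreover have "1 + \<bar>f \<theta>\<bar> \<noteq> 0" by linarith
    ultimately show ?thesis unfolding G_def by simp
  qed
  ultimately show ?thesis by blast
qed

section \<open>Coefficients of functions of Sobolev regularity\<close>

lemma sobolev_absolutely_integrable:
  assumes "u \<in> sobolev m"
  shows "u absolutely_integrable_on {-pi..pi}"
proof (rule measurable_bounded_by_integrable_imp_absolutely_integrable)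
  show "u \<in> borel_measurable (lebesgue_on {-pi..pi})" using assms by (simp add: sobolev_def)
  have "(\<lambda>\<theta>. (u \<theta>)\<^sup>2) absolutely_integrable_on {-pi..pi}" using assms by (simp add: sobolev_def)
  then have "(\<lambda>\<theta>. (u \<theta>)\<^sup>2) integrable_on {-pi..pi}" by (rule set_lebesgue_integral_eq_integral(1))
  then show "(\<lambda>\<theta>. 1 + (u \<theta>)\<^sup>2) integrable_on {-pi..pi}" by (intro integrable_add integrable_const_ivl)
  show "norm (u \<theta>) \<le> 1 + (u \<theta>)\<^sup>2" for \<theta>
  proof -
    have "0 \<le> (\<bar>u \<theta>\<bar> - 1)\<^sup>2" by simp
    then have "2 * \<bar>u \<theta>\<bar> \<le> 1 + (u \<theta>)\<^sup>2" by (simp add: power2_diff)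
    then show ?thesis by simp
  qed
qed simp

lemma fourier_coeff_eq:
  assumes u: "u absolutely_integrable_on {-pi..pi}"
  shows "fourier_coeff u k = Complex (integral {-pi..pi} (\<lambda>\<theta>. u \<theta> * cos (of_int k * \<theta>)) / (2 * pi))
      (- integral {-pi..pi} (\<lambda>\<theta>. u \<theta> * sin (of_int k * \<theta>)) / (2 * pi))"
proof -
  let ?c = "\<lambda>\<theta>. u \<theta> * cos (of_int k * \<theta>)" and ?s = "\<lambda>\<theta>. u \<theta> * sin (of_int k * \<theta>)"
  have c: "?c absolutely_integrable_on {-pi..pi}" and s: "?s absolutely_integrable_on {-pi..pi}"
    by (intro absolutely_integrable_mult_continuous[OF u] continuous_intros)+
  have eq: "indicator {-pi..pi} \<theta> *\<^sub>R (complex_of_real (u \<theta>) * cis (- (of_int k * \<theta>)))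
     = complex_of_real (indicator {-pi..pi} \<theta> *\<^sub>R ?c \<theta>) - \<i> * complex_of_real (indicator {-pi..pi} \<theta> *\<^sub>R ?s \<theta>)" for \<theta>
    by (simp add: complex_eq_iff indicator_def)
  have "(LINT \<theta>:{-pi..pi}|lebesgue. complex_of_real (u \<theta>) * cis (- (of_int k * \<theta>)))
    = complex_of_real (LINT \<theta>:{-pi..pi}|lebesgue. ?c \<theta>) - \<i> * complex_of_real (LINT \<theta>:{-pi..pi}|lebesgue. ?s \<theta>)"
    unfolding set_lebesgue_integral_def eq
    using c s unfolding set_integrable_def
    by (subst Bochner_Integration.integral_diff)
      (simp_all only: integrable_of_real integral_of_real integrable_mult_right integral_mult_right_zero)
  then show ?thesis
    unfolding fourier_coeff_def set_lebesgue_integral_eq_integral(2)[OF c] set_lebesgue_integral_eq_integral(2)[OF s]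
    by (simp add: complex_eq_iff)
qed

lemma sobolev_coeff_le_norm:
  assumes "u \<in> sobolev m"
  shows "(1 + (of_int k)\<^sup>2) ^ m * (cmod (fourier_coeff u k))\<^sup>2 \<le> (sobolev_norm m u)\<^sup>2"
proof -
  let ?f = "\<lambda>k::int. (1 + (of_int k)\<^sup>2) ^ m * (cmod (fourier_coeff u k))\<^sup>2"
  have s: "?f summable_on UNIV" using assms by (simp add: sobolev_def)
  have "sum ?f {k} \<le> infsum ?f UNIV" by (rule finite_sum_le_infsum[OF s]) auto
  moreover have "0 \<le> infsum ?f UNIV" by (rule infsum_nonneg) simp
  ultimately show ?thesis by (simp add: sobolev_norm_def)
qed

text \<open>
  A single term of the series that defines the Sobolev norm, with \<open>n\<^sup>8 \<le> (1 + n\<^sup>2)\<^sup>m\<close>.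
\<close>
lemma sobolev_sine_coeff_decay:
  assumes u: "u \<in> sobolev m" and m: "4 \<le> m"
  shows "real n ^ 4 * \<bar>integral {-pi..pi} (\<lambda>\<theta>. u \<theta> * sin (real n * \<theta>))\<bar> \<le> 2 * pi * sobolev_norm m u"
proof -
  define I where "I = integral {-pi..pi} (\<lambda>\<theta>. u \<theta> * sin (real n * \<theta>))"
  have N0: "0 \<le> sobolev_norm m u" unfolding sobolev_norm_def by (intro real_sqrt_ge_zero infsum_nonneg) simp
  have "\<bar>Im (fourier_coeff u (int n))\<bar> \<le> cmod (fourier_coeff u (int n))" by (rule abs_Im_le_cmod)
  moreover have "\<bar>Im (fourier_coeff u (int n))\<bar> = \<bar>I\<bar> / (2 * pi)"
    unfolding fourier_coeff_eq[OF sobolev_absolutely_integrable[OF u]] by (simp add: I_def abs_divide)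
  ultimately have I: "\<bar>I\<bar> / (2 * pi) \<le> cmod (fourier_coeff u (int n))" by simp
  have "real n ^ 8 \<le> (1 + (real n)\<^sup>2) ^ m"
  proof -
    have "real n ^ 8 = ((real n)\<^sup>2) ^ 4" by (simp flip: power_mult)
    also have "\<dots> \<le> (1 + (real n)\<^sup>2) ^ 4" by (intro power_mono) auto
    also have "\<dots> \<le> (1 + (real n)\<^sup>2) ^ m" using m by (intro power_increasing) auto
    finally show ?thesis .
  qed
  then have "real n ^ 8 * (\<bar>I\<bar> / (2 * pi))\<^sup>2 \<le> (1 + (real n)\<^sup>2) ^ m * (cmod (fourier_coeff u (int n)))\<^sup>2"
    using I by (intro mult_mono power_mono) auto
  also have "\<dots> \<le> (sobolev_norm m u)\<^sup>2" using sobolev_coeff_le_norm[OF u, of "int n"] by simp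
  finally have "(real n ^ 4 * (\<bar>I\<bar> / (2 * pi)))\<^sup>2 \<le> (sobolev_norm m u)\<^sup>2"
    unfolding power_mult_distrib[of "real n ^ 4"] by (simp flip: power_mult)
  then have "real n ^ 4 * (\<bar>I\<bar> / (2 * pi)) \<le> sobolev_norm m u" by (rule power2_le_imp_le[OF _ N0])
  then show ?thesis unfolding I_def[symmetric] by (simp add: field_simps)
qed

text \<open>
  The value of \<open>sobolev_norm\<close> is 0 when its series diverges. So the difference must be known to belong
  to the space before its norm can bound its coefficients.
\<close>
lemma sobolev_diff:
  assumes u: "u \<in> sobolev m" and v: "v \<in> sobolev m"
  shows "(\<lambda>\<theta>. u \<theta> - v \<theta>) \<in> sobolev m"
proof -
  let ?S = "{-pi..pi}"
  have ui: "u absolutely_integrable_on ?S" and vi: "v absolutely_integrable_on ?S"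
    using u v sobolev_absolutely_integrable by blast+
  have um: "u \<in> borel_measurable (lebesgue_on ?S)" and vm: "v \<in> borel_measurable (lebesgue_on ?S)"
    using u v by (simp_all add: sobolev_def)
  have "periodic (\<lambda>\<theta>. u \<theta> - v \<theta>)" using u v by (simp add: sobolev_def periodic_def)
  moreover have "(\<lambda>\<theta>. u \<theta> - v \<theta>) \<in> borel_measurable (lebesgue_on ?S)" using um vm by simp
  moreover have "set_integrable lebesgue ?S (\<lambda>\<theta>. (u \<theta> - v \<theta>)\<^sup>2)"
  proof (rule measurable_bounded_by_integrable_imp_absolutely_integrable)
    show "(\<lambda>\<theta>. (u \<theta> - v \<theta>)\<^sup>2) \<in> borel_measurable (lebesgue_on ?S)" using um vm by simp
    have "(\<lambda>\<theta>. (u \<theta>)\<^sup>2) integrable_on ?S" "(\<lambda>\<theta>. (v \<theta>)\<^sup>2) integrable_on ?S"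
      using u v set_lebesgue_integral_eq_integral(1) by (auto simp: sobolev_def)
    then show "(\<lambda>\<theta>. 2 * (u \<theta>)\<^sup>2 + 2 * (v \<theta>)\<^sup>2) integrable_on ?S"
      by (intro integrable_add) auto
    show "norm ((u \<theta> - v \<theta>)\<^sup>2) \<le> 2 * (u \<theta>)\<^sup>2 + 2 * (v \<theta>)\<^sup>2" for \<theta>
    proof -
      have "0 \<le> (u \<theta> + v \<theta>)\<^sup>2" by simp
      moreover have "2 * (u \<theta>)\<^sup>2 + 2 * (v \<theta>)\<^sup>2 = (u \<theta> + v \<theta>)\<^sup>2 + (u \<theta> - v \<theta>)\<^sup>2"
        by (simp add: power2_eq_square algebra_simps)
      ultimately show ?thesis by simp
    qed
  qed simp
  moreover have "(\<lambda>k::int. (1 + (of_int k)\<^sup>2) ^ m * (cmod (fourier_coeff (\<lambda>\<theta>. u \<theta> - v \<theta>) k))\<^sup>2) summable_on UNIV"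
  proof (rule summable_on_comparison_test)
    let ?w = "\<lambda>k::int. (1 + (of_int k :: real)\<^sup>2) ^ m"
    have "(\<lambda>k. ?w k * (cmod (fourier_coeff u k))\<^sup>2) summable_on UNIV" "(\<lambda>k. ?w k * (cmod (fourier_coeff v k))\<^sup>2) summable_on UNIV"
      using u v by (simp_all add: sobolev_def)
    then show "(\<lambda>k. 2 * (?w k * (cmod (fourier_coeff u k))\<^sup>2) + 2 * (?w k * (cmod (fourier_coeff v k))\<^sup>2)) summable_on UNIV"
      by (intro summable_on_add summable_on_cmult_right)
    fix k :: int
    have "fourier_coeff (\<lambda>\<theta>. u \<theta> - v \<theta>) k = fourier_coeff u k - fourier_coeff v k"
    proof -
      have d: "(\<lambda>\<theta>. u \<theta> - v \<theta>) absolutely_integrable_on ?S" using ui vi by (rule set_integral_diff(1))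
      have "integral ?S (\<lambda>\<theta>. (u \<theta> - v \<theta>) * h \<theta>) = integral ?S (\<lambda>\<theta>. u \<theta> * h \<theta>) - integral ?S (\<lambda>\<theta>. v \<theta> * h \<theta>)"
        if "continuous_on ?S h" for h
        unfolding left_diff_distrib
        by (intro Henstock_Kurzweil_Integration.integral_diff integrable_mult_continuous ui vi that)
      then show ?thesis
        unfolding fourier_coeff_eq[OF ui] fourier_coeff_eq[OF vi] fourier_coeff_eq[OF d]
        by (simp add: complex_eq_iff continuous_intros diff_divide_distrib)
    qed
    then have "cmod (fourier_coeff (\<lambda>\<theta>. u \<theta> - v \<theta>) k) \<le> cmod (fourier_coeff u k) + cmod (fourier_coeff v k)"
      by (simp add: norm_triangle_ineq4)
    then have "(cmod (fourier_coeff (\<lambda>\<theta>. u \<theta> - v \<theta>) k))\<^sup>2 \<le> (cmod (fourier_coeff u k) + cmod (fourier_coeff v k))\<^sup>2"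
      by (intro power_mono) auto
    also have "\<dots> \<le> 2 * (cmod (fourier_coeff u k))\<^sup>2 + 2 * (cmod (fourier_coeff v k))\<^sup>2"
    proof -
      have "0 \<le> (cmod (fourier_coeff u k) - cmod (fourier_coeff v k))\<^sup>2" by simp
      then show ?thesis by (simp add: power2_eq_square algebra_simps)
    qed
    finally have "?w k * (cmod (fourier_coeff (\<lambda>\<theta>. u \<theta> - v \<theta>) k))\<^sup>2
        \<le> ?w k * (2 * (cmod (fourier_coeff u k))\<^sup>2 + 2 * (cmod (fourier_coeff v k))\<^sup>2)"
      by (intro mult_left_mono) auto
    then show "?w k * (cmod (fourier_coeff (\<lambda>\<theta>. u \<theta> - v \<theta>) k))\<^sup>2
        \<le> 2 * (?w k * (cmod (fourier_coeff u k))\<^sup>2) + 2 * (?w k * (cmod (fourier_coeff v k))\<^sup>2)"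
      by (simp add: algebra_simps)
  qed auto
  ultimately show ?thesis by (simp add: sobolev_def)
qed

text \<open>
  The coefficient of \<open>e\<^sub>n\<close>: since \<open>e\<^sub>n'\<close> times the signed root of the weight is \<open>sin(n\<theta>) / sqrt pi\<close>, this
  is \<open>inner_rho f e\<^sub>n\<close>.
\<close>
definition DW_coeff :: "(real \<Rightarrow> real) \<Rightarrow> nat \<Rightarrow> real" where
  "DW_coeff f n = integral {-pi..pi} (\<lambda>\<theta>. rho_half_deriv f \<theta> * sin (real n * \<theta>)) / sqrt pi"

text \<open>
  Continuity in time controls the difference from the value at \<open>t\<close> in the Sobolev norm, hence the
  coefficients uniformly in \<open>n\<close>. Local bounds are enough, because they only serve to differentiate at
  \<open>t\<close>.
\<close>
lemma DW_coeff_locally_bounded: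
  assumes c: "curve_cont (sobolev m) (sobolev_norm m) T (\<lambda>t. rho_half_deriv (\<eta> t))" and m: "4 \<le> m" and t: "t \<in> {0..T}"
  shows "\<exists>\<delta> M. 0 < \<delta> \<and> (\<forall>s\<in>{0..T}. \<forall>n. \<bar>s - t\<bar> < \<delta> \<longrightarrow> real n ^ 4 * \<bar>DW_coeff (\<eta> s) n\<bar> \<le> M)"
proof -
  define u where "u t = rho_half_deriv (\<eta> t)" for t
  have us: "u s \<in> sobolev m" if "s \<in> {0..T}" for s using c that by (simp add: curve_cont_def u_def)
  have "((\<lambda>s. sobolev_norm m (\<lambda>\<theta>. u s \<theta> - u t \<theta>)) \<longlongrightarrow> 0) (at t within {0..T})"
    using c t by (simp add: curve_cont_def u_def)
  then have "\<forall>\<^sub>F s in at t within {0..T}. sobolev_norm m (\<lambda>\<theta>. u s \<theta> - u t \<theta>) < 1"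
    by (rule order_tendstoD(2)) simp
  then obtain \<delta> where \<delta>: "0 < \<delta>" and near: "\<And>s. s \<in> {0..T} \<Longrightarrow> s \<noteq> t \<Longrightarrow> dist s t < \<delta> \<Longrightarrow> sobolev_norm m (\<lambda>\<theta>. u s \<theta> - u t \<theta>) < 1"
    unfolding eventually_at by blast
  define M where "M = 2 * pi * (sobolev_norm m (u t) + 1) / sqrt pi"
  have "real n ^ 4 * \<bar>DW_coeff (\<eta> s) n\<bar> \<le> M" if s: "s \<in> {0..T}" "\<bar>s - t\<bar> < \<delta>" for s n
  proof -
    let ?I = "\<lambda>w. integral {-pi..pi} (\<lambda>\<theta>. w \<theta> * sin (real n * \<theta>))"
    have le: "real n ^ 4 * \<bar>?I (u s)\<bar> \<le> 2 * pi * (sobolev_norm m (u t) + 1)"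
    proof (cases "s = t")
      case True
      show ?thesis
        using sobolev_sine_coeff_decay[OF us[OF t] m, of n] pi_gt_zero unfolding True distrib_left by linarith
    next
      case False
      then have "sobolev_norm m (\<lambda>\<theta>. u s \<theta> - u t \<theta>) < 1" using near s by (simp add: dist_real_def)
      then have "2 * pi * sobolev_norm m (\<lambda>\<theta>. u s \<theta> - u t \<theta>) \<le> 2 * pi * 1" by (intro mult_left_mono) auto
      then have d: "real n ^ 4 * \<bar>?I (\<lambda>\<theta>. u s \<theta> - u t \<theta>)\<bar> \<le> 2 * pi"
        using sobolev_sine_coeff_decay[OF sobolev_diff[OF us[OF s(1)] us[OF t]] m, of n] by linarith
      have "?I (\<lambda>\<theta>. u s \<theta> - u t \<theta>) = ?I (u s) - ?I (u t)"
        unfolding left_diff_distrib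
        by (intro Henstock_Kurzweil_Integration.integral_diff integrable_mult_continuous sobolev_absolutely_integrable[OF us] s t)
          (auto intro!: continuous_intros)
      then have "\<bar>?I (u s)\<bar> \<le> \<bar>?I (\<lambda>\<theta>. u s \<theta> - u t \<theta>)\<bar> + \<bar>?I (u t)\<bar>" by linarith
      then have "real n ^ 4 * \<bar>?I (u s)\<bar> \<le> real n ^ 4 * (\<bar>?I (\<lambda>\<theta>. u s \<theta> - u t \<theta>)\<bar> + \<bar>?I (u t)\<bar>)"
        by (intro mult_left_mono) auto
      then show ?thesis
        using d sobolev_sine_coeff_decay[OF us[OF t] m, of n] unfolding distrib_left by linarith
    qed
    show ?thesis
      using divide_right_mono[OF le, of "sqrt pi"] unfolding DW_coeff_def u_def[symmetric] M_def
      by (simp add: abs_divide)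
  qed
  with \<delta> show ?thesis by blast
qed

lemma summable_inverse_square: "summable (\<lambda>n. 1 / real n ^ 2)"
  using inverse_power_summable[of 2, where 'a=real] by (simp add: field_simps)

lemma weighted_term_le_of_decay:
  fixes a :: "nat \<Rightarrow> real"
  assumes "\<And>n. real n ^ 4 * \<bar>a n\<bar> \<le> M"
  shows "real n * \<bar>a n\<bar> \<le> M * (1 / real n ^ 2)"
proof (cases "n = 0")
  case False
  then have n: "1 \<le> real n" by simp
  have "real n * \<bar>a n\<bar> * real n ^ 2 = real n ^ 3 * \<bar>a n\<bar>" by (simp add: power2_eq_square power3_eq_cube)
  also have "\<dots> \<le> real n ^ 4 * \<bar>a n\<bar>" using n by (intro mult_right_mono power_increasing) auto
  also have "\<dots> \<le> M" by (rule assms)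
  finally show ?thesis using n by (simp add: pos_le_divide_eq)
qed simp

lemma weighted_sum_of_decay:
  fixes a :: "nat \<Rightarrow> real"
  assumes "\<And>n. real n ^ 4 * \<bar>a n\<bar> \<le> M"
  shows "summable (\<lambda>n. real n * \<bar>a n\<bar>)"
    and "(\<Sum>n. real n * \<bar>a n\<bar>) \<le> M * (\<Sum>n. 1 / real n ^ 2)"
proof -
  have sM: "summable (\<lambda>n. M * (1 / real n ^ 2))" by (rule summable_mult[OF summable_inverse_square])
  show s: "summable (\<lambda>n. real n * \<bar>a n\<bar>)"
    by (rule summable_comparison_test'[OF sM, of 0]) (use weighted_term_le_of_decay[OF assms] in simp)
  have "(\<Sum>n. real n * \<bar>a n\<bar>) \<le> (\<Sum>n. M * (1 / real n ^ 2))"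
    by (rule suminf_le[OF weighted_term_le_of_decay[OF assms] s sM])
  also have "\<dots> = M * (\<Sum>n. 1 / real n ^ 2)" by (rule suminf_mult[OF summable_inverse_square])
  finally show "(\<Sum>n. real n * \<bar>a n\<bar>) \<le> M * (\<Sum>n. 1 / real n ^ 2)" .
qed

text \<open>
  The function \<open>rho_half_deriv f\<close> is odd, and its sine coefficients are those of
  \<open>\<Sum>a\<^sub>n sin(n\<theta>) / sqrt pi\<close>. By completeness the two agree almost everywhere, so
  \<open>f' = 2 sin \<theta> \<Sum>a\<^sub>n sin(n\<theta>)\<close> almost everywhere. Since \<open>f\<close> is differentiable at every point, its
  Henstock-Kurzweil primitive is \<open>f\<close> itself, and null sets do not matter there. Periodicity of \<open>f\<close> forces the
  integral of \<open>f'\<close> to vanish, which is \<open>a\<^sub>1 = 0\<close>.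
\<close>
lemma odd_periodic_eq_expansion:
  assumes odd: "odd_fun f" and per: "periodic f" and diff: "\<And>\<theta>. f differentiable (at \<theta>)"
    and int: "rho_half_deriv f absolutely_integrable_on {-pi..pi}"
    and s: "summable (\<lambda>n. \<bar>DW_coeff f n\<bar>)"
  shows "DW_coeff f 0 = 0" "DW_coeff f 1 = 0" "f = expansion (DW_coeff f)"
proof -
  define a where "a = DW_coeff f"
  show a0: "DW_coeff f 0 = 0" by (simp add: DW_coeff_def)
  have sa: "summable (\<lambda>n. \<bar>a n\<bar>)" using s by (simp add: a_def)
  have df: "(f has_real_derivative deriv f \<theta>) (at \<theta>)" for \<theta>
    using diff by (simp add: DERIV_deriv_iff_real_differentiable)
  have fodd: "f (- \<theta>) = - f \<theta>" for \<theta> using odd by (simp add: odd_fun_def)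
  have deven: "deriv f (- \<theta>) = deriv f \<theta>" for \<theta>
  proof -
    have "((\<lambda>x. - f (- x)) has_real_derivative deriv f (- \<theta>)) (at \<theta>)"
      by (auto intro!: derivative_eq_intros DERIV_chain2[OF df])
    moreover have "(\<lambda>x. - f (- x)) = f" by (simp add: fodd)
    ultimately show ?thesis by (simp add: DERIV_imp_deriv)
  qed
  define h where "h \<theta> = rho_half_deriv f \<theta> - sine_series a \<theta> / sqrt pi" for \<theta>
  have ci: "(\<lambda>\<theta>. sine_series a \<theta> / sqrt pi) absolutely_integrable_on {-pi..pi}"
    by (intro absolutely_integrable_continuous_real continuous_intros continuous_on_sine_series sa) simp
  have hi: "h absolutely_integrable_on {-pi..pi}"
    unfolding h_def[abs_def] by (rule set_integral_diff(1)[OF int ci])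
  have hodd: "h (- \<theta>) = - h \<theta>" for \<theta>
  proof -
    have "sine_series a (- \<theta>) = - sine_series a \<theta>"
      unfolding sine_series_def using suminf_minus[OF summable_mult_bounded[OF sa, of "\<lambda>n. sin (real n * \<theta>)"]] by simp
    then show ?thesis by (simp add: h_def rho_half_deriv_def rho_half_def deven)
  qed
  have orth: "integral {-pi..pi} (\<lambda>\<theta>. h \<theta> * sin (real n * \<theta>)) = 0" for n
  proof (cases "n = 0")
    case False
    then have False': "0 < n" by simp
    have "integral {-pi..pi} (\<lambda>\<theta>. h \<theta> * sin (real n * \<theta>)) =
       integral {-pi..pi} (\<lambda>\<theta>. rho_half_deriv f \<theta> * sin (real n * \<theta>)) -
       integral {-pi..pi} (\<lambda>\<theta>. sine_series a \<theta> / sqrt pi * sin (real n * \<theta>))"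
      unfolding h_def left_diff_distrib
      by (intro Henstock_Kurzweil_Integration.integral_diff integrable_mult_continuous int ci) (auto intro!: continuous_intros)
    also have "integral {-pi..pi} (\<lambda>\<theta>. sine_series a \<theta> / sqrt pi * sin (real n * \<theta>))
       = integral {-pi..pi} (\<lambda>\<theta>. sin (real n * \<theta>) * sine_series a \<theta>) / sqrt pi"
      by (simp add: mult.commute flip: integral_divide)
    also have "\<dots> = sqrt pi * a n"
      unfolding integral_sin_mult_sine_series[OF sa False']
      by (simp add: real_div_sqrt flip: times_divide_eq_left)
    also have "integral {-pi..pi} (\<lambda>\<theta>. rho_half_deriv f \<theta> * sin (real n * \<theta>)) = sqrt pi * a n"
      by (simp add: a_def DW_coeff_def)
    finally show ?thesis by simp
  qed simp
  obtain N where N: "negligible N" and h0: "\<And>\<theta>. \<theta> \<in> {-pi..pi} - N \<Longrightarrow> h \<theta> = 0"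
    using odd_null_of_sine_orthogonal[OF hi orth hodd] by blast
  define Z where "Z = N \<union> {-pi, 0, pi}"
  have Z: "negligible Z" unfolding Z_def using N by (auto intro!: negligible_Un)
  have fd: "deriv f \<theta> = 2 * sin \<theta> * sine_series a \<theta>" if "\<theta> \<in> {-pi..pi} - Z" for \<theta>
  proof -
    have "sin \<theta> \<noteq> 0" using that by (intro sin_nonzero_off_multiples) (auto simp: Z_def)
    moreover have "h \<theta> = 0" using h0 that by (simp add: Z_def)
    ultimately show ?thesis
      by (simp add: h_def rho_half_deriv_def rho_half_def divide_eq_eq mult.commute split: if_splits)
  qed
  have ftc: "((\<lambda>\<theta>. 2 * sin \<theta> * sine_series a \<theta>) has_integral f x - f (-pi)) {-pi..x}" if x: "x \<in> {-pi..pi}" for x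
  proof (rule has_integral_spike[OF Z])
    show "(deriv f has_integral f x - f (-pi)) {-pi..x}"
      by (rule fundamental_theorem_of_calculus)
        (use x df in \<open>auto simp: has_real_derivative_iff_has_vector_derivative[symmetric] intro: has_field_derivative_at_within\<close>)
    show "2 * sin \<theta> * sine_series a \<theta> = deriv f \<theta>" if "\<theta> \<in> {-pi..x} - Z" for \<theta>
      using fd[of \<theta>] that x by auto
  qed
  have fpi: "f pi = 0" "f (-pi) = 0"
  proof -
    have "f (-pi + 2 * pi) = f (-pi)" using per unfolding periodic_def by blast
    then show "f pi = 0" "f (-pi) = 0" using fodd[of pi] by simp_all
  qed
  have "integral {-pi..pi} (\<lambda>\<theta>. 2 * sin \<theta> * sine_series a \<theta>) = 0"
    using integral_unique[OF ftc[of pi]] fpi by simp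
  then have "2 * integral {-pi..pi} (\<lambda>\<theta>. sin \<theta> * sine_series a \<theta>) = 0"
    by (simp add: mult.assoc)
  then show a1: "DW_coeff f 1 = 0"
    using integral_sin_mult_sine_series[OF sa, of 1] by (simp add: a_def)
  have base: "f x = expansion a x" if x: "x \<in> {-pi..pi}" for x
  proof -
    have "((\<lambda>\<theta>. 2 * sin \<theta> * sine_series a \<theta>) has_integral expansion a x - expansion a (-pi)) {-pi..x}"
      by (rule fundamental_theorem_of_calculus)
        (use x expansion_has_derivative[OF sa] a0 a1 in \<open>auto simp: a_def has_real_derivative_iff_has_vector_derivative[symmetric] intro: has_field_derivative_at_within\<close>)
    moreover have "expansion a (-pi) = 0" by (simp add: expansion_def sine_series_def)
    ultimately show ?thesis using has_integral_unique[OF ftc[OF x], of "expansion a x - expansion a (-pi)"] fpi by simp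
  qed
  show "f = expansion (DW_coeff f)"
  proof
    fix x
    define k where "k = \<lfloor>(x + pi) / (2 * pi)\<rfloor>"
    \<comment> \<open>Both sides are periodic, so it suffices to compare them on one period.\<close>
    define y where "y = x + 2 * pi * of_int (- k)"
    have "y \<in> {-pi..pi}"
      using floor_divide_lower[of "2 * pi" "x + pi"] floor_divide_upper[of "2 * pi" "x + pi"]
      by (auto simp: y_def k_def algebra_simps)
    from base[OF this] show "f x = expansion (DW_coeff f) x"
      unfolding y_def a_def expansion_def
      using periodic_add_int[of f x "- k"] periodic_add_int[of "sine_series (primitive_coeff (DW_coeff f))" x "- k", OF sine_series_periodic] per
      by (simp add: periodic_def)
  qed
qed

section \<open>Differential inequalities\<close>

text \<open>
  Multiplying by the integrating factor \<open>exp(-kt)\<close> gives a strictly increasing function.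
\<close>
lemma growth_of_forced_linear:
  fixes y y' :: "real \<Rightarrow> real"
  assumes d: "\<And>t. 0 \<le> t \<Longrightarrow> (y has_real_derivative y' t) (at t within {0..})"
    and gt: "\<And>t. 0 < t \<Longrightarrow> k * y t < y' t" and y0: "y 0 = 0" and t: "0 < t"
  shows "0 < y t"
proof -
  define q where "q s = exp (- k * s) * y s" for s
  have dq: "(q has_real_derivative exp (- k * s) * (y' s - k * y s)) (at s within {0..})" if "0 \<le> s" for s
    unfolding q_def using d[OF that] by (auto intro!: derivative_eq_intros simp: algebra_simps)
  have "q 0 < q t"
  proof (rule DERIV_pos_imp_increasing_open[OF t])
    fix s assume s: "0 < s" "s < t"
    have "at s within {0..} = at s" using s by (intro at_within_interior) simp
    then have "(q has_real_derivative exp (- k * s) * (y' s - k * y s)) (at s)" using dq[of s] s by simp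
    moreover have "0 < exp (- k * s) * (y' s - k * y s)" using gt[of s] s by simp
    ultimately show "\<exists>z. (q has_real_derivative z) (at s) \<and> 0 < z" by blast
  next
    have "continuous_on {0..} q" using dq by (intro DERIV_continuous_on) auto
    then show "continuous_on {0..t} q" by (rule continuous_on_subset) auto
  qed
  then show ?thesis by (simp add: q_def y0 zero_less_mult_iff)
qed

lemma mono_of_nonneg_derivative:
  fixes y y' :: "real \<Rightarrow> real"
  assumes d: "\<And>t. 0 \<le> t \<Longrightarrow> (y has_real_derivative y' t) (at t within {0..})"
    and ge: "\<And>t. 0 \<le> t \<Longrightarrow> 0 \<le> y' t" and t: "0 \<le> t"
  shows "y 0 \<le> y t"
proof (rule DERIV_nonneg_imp_increasing_open[OF t])
  fix s assume s: "0 < s" "s < t"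
  have "at s within {0..} = at s" using s by (intro at_within_interior) simp
  then show "\<exists>z. (y has_real_derivative z) (at s) \<and> 0 \<le> z" using d[of s] ge[of s] s by auto
next
  have "continuous_on {0..} y" using d by (intro DERIV_continuous_on) auto
  then show "continuous_on {0..t} y" by (rule continuous_on_subset) auto
qed

text \<open>
  The hypotheses say \<open>w'' > 4 l w\<close> with zero initial data. With \<open>s = sqrt l\<close> the operator factors as
  \<open>(d/dt - 2s)(d/dt + 2s)\<close>. So \<open>z + s w\<close>, which is half of \<open>w' + 2 s w\<close>, is positive by
  \<open>growth_of_forced_linear\<close>, and the same lemma then gives \<open>w > 0\<close>.
\<close>
lemma hyperbolic_comparison:
  fixes w z z' :: "real \<Rightarrow> real"
  assumes l: "0 < l"
    and w: "\<And>t. 0 \<le> t \<Longrightarrow> (w has_real_derivative 2 * z t) (at t within {0..})"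
    and z: "\<And>t. 0 \<le> t \<Longrightarrow> (z has_real_derivative z' t) (at t within {0..})"
    and gt: "\<And>t. 0 < t \<Longrightarrow> 2 * l * w t < z' t"
    and ini: "w 0 = 0" "z 0 = 0" and t: "0 < t"
  shows "0 < w t"
proof -
  define s where "s = sqrt l"
  have s: "0 < s" "s * s = l" using l by (simp_all add: s_def)
  have p: "0 < z r + s * w r" if r: "0 < r" for r
  proof (rule growth_of_forced_linear[where k = "2 * s" and y' = "\<lambda>r. z' r + s * (2 * z r)", OF _ _ _ r])
    show "((\<lambda>r. z r + s * w r) has_real_derivative z' r + s * (2 * z r)) (at r within {0..})" if "0 \<le> r" for r
      using w[OF that] z[OF that] by (auto intro!: derivative_eq_intros)
    show "2 * s * (z r + s * w r) < z' r + s * (2 * z r)" if "0 < r" for r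
    proof -
      have "2 * s * (z r + s * w r) = 2 * (s * s) * w r + s * (2 * z r)" by (simp add: algebra_simps)
      then show ?thesis using gt[OF that] s(2) by simp
    qed
  qed (simp add: ini)
  show ?thesis
  proof (rule growth_of_forced_linear[where k = "- 2 * s", OF w _ ini(1) t])
    show "- 2 * s * w r < 2 * z r" if "0 < r" for r using p[OF that] by simp
  qed
qed

section \<open>The quadratic form of the second energy derivative\<close>

text \<open>
  The diagonal of the matrix of \<open>L\<close>. It is negative for \<open>n = 2\<close>, positive for all larger \<open>n\<close> and tends to
  \<open>1/2\<close>.
\<close>
definition diag :: "nat \<Rightarrow> real" where
  "diag n = (if n < 2 then 0 else hop (n + 1) - hop (n - 1))"

text \<open>
  With \<open>P = n\<^sup>2 - 1\<close> one has \<open>diag n = 1/2 + 2/P - 8n/P\<^sup>2\<close>, and \<open>2P \<ge> 8n\<close> as soon as \<open>n \<ge> 5\<close>.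
\<close>
lemma diag_bounds:
  assumes "5 \<le> n"
  shows "1 / 2 \<le> diag n" "diag n \<le> 1 / 2 + 2 / ((real n)\<^sup>2 - 1)"
proof -
  define x where "x = real n"
  have x: "5 \<le> x" using assms by (simp add: x_def)
  define P where "P = x\<^sup>2 - 1"
  have x2: "5 * x \<le> x\<^sup>2" using x by (simp add: power2_eq_square)
  have P: "0 < P" using x x2 unfolding P_def by linarith
  have fac: "P = (x + 1) * (x - 1)" by (simp add: P_def power2_eq_square algebra_simps)
  have "diag n = (x - 1)\<^sup>2 * (x + 3) / (4 * (x + 1)\<^sup>2) - (x - 3)\<^sup>2 * (x + 1) / (4 * (x - 1)\<^sup>2)"
    using assms by (simp add: diag_def hop_def x_def of_nat_diff algebra_simps)
  also have "\<dots> = ((x - 1)^4 * (x + 3) - (x - 3)\<^sup>2 * (x + 1)^3) / (4 * P\<^sup>2)"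
  proof -
    have *: "A / (4 * u\<^sup>2) - B / (4 * v\<^sup>2) = (A * v\<^sup>2 - B * u\<^sup>2) / (4 * (u * v)\<^sup>2)"
      if "u \<noteq> 0" "v \<noteq> 0" for A B u v :: real
      using that by (simp add: power_mult_distrib divide_simps)
    have eqs: "(x - 1)\<^sup>2 * (x + 3) * (x - 1)\<^sup>2 = (x - 1)^4 * (x + 3)" "(x - 3)\<^sup>2 * (x + 1) * (x + 1)\<^sup>2 = (x - 3)\<^sup>2 * (x + 1)^3"
      by (simp_all add: power2_eq_square power3_eq_cube power4_eq_xxxx)
    show ?thesis unfolding fac eqs[symmetric] by (rule *) (use x in auto)
  qed
  also have "(x - 1)^4 * (x + 3) - (x - 3)\<^sup>2 * (x + 1)^3 = 2 * P\<^sup>2 + 8 * P - 32 * x"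
    unfolding P_def by (simp add: power2_eq_square power3_eq_cube power4_eq_xxxx algebra_simps)
  finally have d: "diag n = (2 * P\<^sup>2 + 8 * P - 32 * x) / (4 * P\<^sup>2)" .
  have "8 * P = 8 * x\<^sup>2 - 8" by (simp add: P_def)
  then have "0 \<le> 8 * P - 32 * x" using x x2 by linarith
  then have "2 * P\<^sup>2 / (4 * P\<^sup>2) \<le> diag n" unfolding d by (intro divide_right_mono) auto
  then show "1 / 2 \<le> diag n" using P by simp
  have "diag n \<le> (2 * P\<^sup>2 + 8 * P) / (4 * P\<^sup>2)" unfolding d using x by (intro divide_right_mono) auto
  also have "\<dots> = 1 / 2 + 2 / P" using P by (simp add: add_divide_distrib power2_eq_square)
  finally show "diag n \<le> 1 / 2 + 2 / ((real n)\<^sup>2 - 1)" by (simp add: P_def x_def)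
qed

lemma hop_le_quarter: "2 \<le> n \<Longrightarrow> hop n \<le> real n / 4"
proof -
  assume "2 \<le> n"
  then have n: "2 \<le> real n" by simp
  have "(real n - 2)\<^sup>2 * (real n + 2) = (real n)\<^sup>2 * real n - 2 * (real n - 2) * (real n + 2)  - (4 * real n)"
    by (simp add: power2_eq_square algebra_simps)
  moreover have "0 \<le> 2 * (real n - 2) * (real n + 2)" using n by simp
  ultimately have "(real n - 2)\<^sup>2 * (real n + 2) \<le> (real n)\<^sup>2 * real n" using n by linarith
  then show ?thesis using n by (simp add: hop_def divide_le_eq mult.commute)
qed

text \<open>
  The absolute value of the coefficient of \<open>a\<^sub>n a\<^sub>n\<^sub>+\<^sub>2\<close> in the quadratic form that governs the second
  derivative of the energy. For \<open>n < 2\<close> it is set to 0, as \<open>a\<^sub>n\<close> vanishes there.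
\<close>
definition coupling :: "nat \<Rightarrow> real" where
  "coupling n = (if n < 2 then 0 else hop (n + 1) * \<bar>diag (n + 2) - diag n\<bar>)"

text \<open>
  Although \<open>hop\<close> grows linearly, the diagonal varies only by \<open>O(1/n\<^sup>2)\<close>, so the product stays bounded.
\<close>
lemma coupling_le_eighth:
  assumes "5 \<le> n"
  shows "coupling n \<le> 1 / 8"
proof -
  define x where "x = real n"
  have x: "5 \<le> x" using assms by (simp add: x_def)
  have x2: "5 * x \<le> x\<^sup>2" using x by (simp add: power2_eq_square)
  have P: "0 < x\<^sup>2 - 1" using x x2 by linarith
  have "2 / ((real (n + 2))\<^sup>2 - 1) \<le> 2 / (x\<^sup>2 - 1)"
    using P unfolding x_def by (intro divide_left_mono diff_right_mono power_mono mult_pos_pos) (auto intro: order_less_le_trans)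
  then have "\<bar>diag (n + 2) - diag n\<bar> \<le> 2 / (x\<^sup>2 - 1)"
    using diag_bounds[OF assms] diag_bounds[of "n + 2"] assms unfolding x_def by linarith
  moreover have "hop (n + 1) \<le> (x + 1) / 4" using hop_le_quarter[of "n + 1"] assms by (simp add: x_def)
  ultimately have "hop (n + 1) * \<bar>diag (n + 2) - diag n\<bar> \<le> (x + 1) / 4 * (2 / (x\<^sup>2 - 1))"
    using x by (intro mult_mono) auto
  also have "x\<^sup>2 - 1 = (x + 1) * (x - 1)" by (simp add: power2_eq_square algebra_simps)
  also have "(x + 1) / 4 * (2 / ((x + 1) * (x - 1))) = 1 / (2 * (x - 1))"
    using x by (simp add: divide_simps) (simp add: algebra_simps)
  also have "\<dots> \<le> 1 / 8" using x by (simp add: divide_simps)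
  finally show ?thesis using assms by (simp add: coupling_def)
qed

lemma coupling_nonneg: "0 \<le> coupling n"
  using hop_bound(1) by (simp add: coupling_def)

lemma diag_small: "diag 2 = - 11 / 18" "diag 3 = 3 / 8" "diag 4 = 221 / 450" "diag 5 = 37 / 72" "diag 6 = 2538 / 4900"
  by (simp_all add: diag_def hop_def power2_eq_square)

lemma coupling_small: "coupling 2 \<le> 154 / 1000" "coupling 3 \<le> 53 / 1000" "coupling 4 \<le> 17 / 1000"
  using diag_small by (simp_all add: coupling_def hop_def power2_eq_square)

text \<open>
  After the mixed terms are split evenly between the two squares, these are the weights of \<open>a\<^sub>n\<^sup>2\<close>. The
  smallest one occurs at \<open>n = 3\<close>, where it is about \<open>0.114\<close>. For \<open>n \<ge> 5\<close> the square of the diagonal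
  entry lies between \<open>1/4\<close> and \<open>49/144\<close>, and both couplings are at most \<open>1/8\<close>.
\<close>
lemma quadratic_form_weights:
  assumes n: "2 \<le> n"
  shows "11 / 100 \<le> (diag n)\<^sup>2 - coupling n / 2 - coupling (n - 2) / 2"
    and "(diag n)\<^sup>2 + coupling n / 2 + coupling (n - 2) / 2 \<le> 9 / 10"
proof -
  have c0: "coupling 0 = 0" "coupling 1 = 0" by (simp_all add: coupling_def)
  have le: "coupling k \<le> 1 / 8" if k: "3 \<le> k" for k
  proof -
    consider "k = 3" | "k = 4" | "5 \<le> k" using k by linarith
    then show ?thesis using coupling_small coupling_le_eighth by cases auto
  qed
  have "11 / 100 \<le> (diag n)\<^sup>2 - coupling n / 2 - coupling (n - 2) / 2
     \<and> (diag n)\<^sup>2 + coupling n / 2 + coupling (n - 2) / 2 \<le> 9 / 10"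
  proof -
    consider "n = 2" | "n = 3" | "n = 4" | "5 \<le> n" using n by linarith
    then show ?thesis
    proof cases
      case 1
      then show ?thesis using c0 coupling_small(1) coupling_nonneg[of 2] by (simp add: diag_small power2_eq_square)
    next
      case 2
      then show ?thesis using c0 coupling_small(2) coupling_nonneg[of 3] by (simp add: diag_small power2_eq_square)
    next
      case 3
      then show ?thesis using coupling_small(1,3) coupling_nonneg[of 2] coupling_nonneg[of 4]
        by (simp add: diag_small power2_eq_square)
    next
      case 4
      have "2 / ((real n)\<^sup>2 - 1) \<le> 1 / 12"
      proof -
        have "5 * 5 \<le> real n * real n" using 4 by (intro mult_mono) auto
        then show ?thesis by (simp add: power2_eq_square divide_simps)
      qed
      then have d: "1 / 2 \<le> diag n" "diag n \<le> 7 / 12" using diag_bounds[OF 4] by linarith+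
      have "1 / 2 * (1 / 2) \<le> diag n * diag n" "diag n * diag n \<le> 7 / 12 * (7 / 12)"
        using d by (intro mult_mono; simp)+
      moreover have "coupling n \<le> 1 / 8" "coupling (n - 2) \<le> 1 / 8" using le[of n] le[of "n - 2"] 4 by auto
      ultimately show ?thesis
        using coupling_nonneg[of n] coupling_nonneg[of "n - 2"] unfolding power2_eq_square by (intro conjI; linarith)
    qed
  qed
  then show "11 / 100 \<le> (diag n)\<^sup>2 - coupling n / 2 - coupling (n - 2) / 2"
    and "(diag n)\<^sup>2 + coupling n / 2 + coupling (n - 2) / 2 \<le> 9 / 10" by blast+
qed

lemma abs_diag_le_1: "\<bar>diag n\<bar> \<le> 1"
proof -
  consider "n < 2" | "n = 2" | "n = 3" | "n = 4" | "5 \<le> n" by linarith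
  then show ?thesis
  proof cases
    case 5
    have "5 * 5 \<le> real n * real n" using 5 by (intro mult_mono) auto
    then have "2 / ((real n)\<^sup>2 - 1) \<le> 1 / 2" by (simp add: power2_eq_square divide_simps)
    then show ?thesis using diag_bounds[OF 5] by linarith
  qed (simp_all add: diag_small, simp add: diag_def)
qed

text \<open>
  The off-diagonal terms of the pairing of \<open>L a\<close> with \<open>a\<close> are differences of these quantities.
\<close>
definition neighbour :: "(nat \<Rightarrow> real) \<Rightarrow> nat \<Rightarrow> real" where
  "neighbour a n = hop (n + 1) * (a n * a (n + 2))"

lemma summable_abs_bounded:
  fixes a :: "nat \<Rightarrow> real"
  assumes "summable (\<lambda>n. \<bar>a n\<bar>)"
  obtains C where "0 \<le> C" "\<And>n. \<bar>a n\<bar> \<le> C"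
proof -
  have "\<bar>a n\<bar> \<le> (\<Sum>n. \<bar>a n\<bar>)" for n using sum_le_suminf[OF assms, of "{n}"] by simp
  moreover have "0 \<le> (\<Sum>n. \<bar>a n\<bar>)" by (intro suminf_nonneg assms) simp
  ultimately show ?thesis using that by blast
qed

lemma summable_neighbour:
  assumes s: "summable (\<lambda>n. real n * \<bar>a n\<bar>)" and a0: "a 0 = 0"
  shows "summable (\<lambda>n. \<bar>neighbour a n\<bar>)"
proof -
  obtain C where C: "0 \<le> C" "\<And>n. \<bar>a n\<bar> \<le> C" using summable_abs_bounded[OF summable_abs_of_weighted[OF s]] by blast
  show ?thesis
  proof (rule summable_comparison_test'[OF summable_mult[OF s, of "2 * C"], of 0])
    fix n
    show "norm \<bar>neighbour a n\<bar> \<le> 2 * C * (real n * \<bar>a n\<bar>)"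
    proof (cases "n = 0")
      case False
      have "hop (n + 1) \<le> 2 * real n" using hop_bound(2)[of "n + 1"] False by simp
      then have "hop (n + 1) * (\<bar>a n\<bar> * \<bar>a (n + 2)\<bar>) \<le> 2 * real n * (\<bar>a n\<bar> * C)"
        using C by (intro mult_mono) auto
      then show ?thesis using hop_bound(1)[of "n + 1"] by (simp add: neighbour_def abs_mult mult_ac)
    qed (simp add: neighbour_def a0)
  qed
qed

lemma summable_square:
  fixes a :: "nat \<Rightarrow> real"
  assumes "summable (\<lambda>n. \<bar>a n\<bar>)"
  shows "summable (\<lambda>n. (a n)\<^sup>2)"
proof -
  obtain C where C: "0 \<le> C" "\<And>n. \<bar>a n\<bar> \<le> C" using summable_abs_bounded[OF assms] by blast
  show ?thesis
  proof (rule summable_comparison_test'[OF summable_mult[OF assms, of C], of 0])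
    show "norm ((a n)\<^sup>2) \<le> C * \<bar>a n\<bar>" for n
      using mult_right_mono[OF C(2)[of n], of "\<bar>a n\<bar>"] by (simp add: power2_eq_square abs_mult)
  qed
qed

lemma sums_delay_two:
  fixes f :: "nat \<Rightarrow> real"
  assumes "f sums S"
  shows "(\<lambda>n. if n < 2 then 0 else f (n - 2)) sums S"
  by (subst sums_iff_shift'[of _ 2, symmetric]) (use assms in simp)

text \<open>
  The off-diagonal part of \<open>a\<^sub>n L_coeff a n\<close> is \<open>neighbour a (n - 2) - neighbour a n\<close>. Against a weight
  \<open>w\<close>, summation by parts leaves the increments \<open>w\<^sub>n\<^sub>+\<^sub>2 - w\<^sub>n\<close>. For \<open>w = 1\<close> nothing of it remains; for
  \<open>w = diag\<close> the increments decay fast enough to compensate the growth of \<open>hop\<close>.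
\<close>
lemma weighted_L_pairing:
  assumes w: "\<And>n. \<bar>w n\<bar> \<le> 1" and s: "summable (\<lambda>n. real n * \<bar>a n\<bar>)" and z: "a 0 = 0" "a 1 = 0"
  shows "summable (\<lambda>n. w n * diag n * (a n)\<^sup>2)"
    and "summable (\<lambda>n. (w (n + 2) - w n) * neighbour a n)"
    and "(\<lambda>n. w n * (a n * L_coeff a n)) sums
      ((\<Sum>n. w n * diag n * (a n)\<^sup>2) + (\<Sum>n. (w (n + 2) - w n) * neighbour a n))"
proof -
  have sn: "summable (\<lambda>n. \<bar>neighbour a n\<bar>)" by (rule summable_neighbour[OF s z(1)])
  have s2: "summable (\<lambda>n. \<bar>(a n)\<^sup>2\<bar>)" using summable_square[OF summable_abs_of_weighted[OF s]] by simp
  have wd: "\<bar>w n * diag n\<bar> \<le> 1" for n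
    using mult_mono[OF w[of n] abs_diag_le_1[of n]] by (simp add: abs_mult)
  show D: "summable (\<lambda>n. w n * diag n * (a n)\<^sup>2)"
    using summable_mult_bounded[OF s2, of "\<lambda>n. w n * diag n"] wd by (simp add: mult.commute)
  have X1: "summable (\<lambda>n. w (n + 2) * neighbour a n)" and X2: "summable (\<lambda>n. w n * neighbour a n)"
    using summable_mult_bounded[OF sn, of "\<lambda>n. w (n + 2)"] summable_mult_bounded[OF sn, of w] w
    by (simp_all add: mult.commute)
  show "summable (\<lambda>n. (w (n + 2) - w n) * neighbour a n)"
    using summable_diff[OF X1 X2] by (simp add: left_diff_distrib)
  have "(\<lambda>n. w n * diag n * (a n)\<^sup>2 + (if n < 2 then 0 else w (n - 2 + 2) * neighbour a (n - 2)) - w n * neighbour a n) sums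
     ((\<Sum>n. w n * diag n * (a n)\<^sup>2) + (\<Sum>n. w (n + 2) * neighbour a n) - (\<Sum>n. w n * neighbour a n))"
    by (intro sums_diff sums_add summable_sums[OF D] sums_delay_two[OF summable_sums[OF X1]] summable_sums[OF X2])
  also have "(\<Sum>n. w n * diag n * (a n)\<^sup>2) + (\<Sum>n. w (n + 2) * neighbour a n) - (\<Sum>n. w n * neighbour a n)
     = (\<Sum>n. w n * diag n * (a n)\<^sup>2) + (\<Sum>n. (w (n + 2) - w n) * neighbour a n)"
    using suminf_diff[OF X1 X2] by (simp add: left_diff_distrib)
  also have "(\<lambda>n. w n * diag n * (a n)\<^sup>2 + (if n < 2 then 0 else w (n - 2 + 2) * neighbour a (n - 2)) - w n * neighbour a n)
     = (\<lambda>n. w n * (a n * L_coeff a n))"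
  proof
    fix n
    show "w n * diag n * (a n)\<^sup>2 + (if n < 2 then 0 else w (n - 2 + 2) * neighbour a (n - 2)) - w n * neighbour a n
       = w n * (a n * L_coeff a n)"
    proof (cases "n < 2")
      case True
      then have "n = 0 \<or> n = 1" by auto
      then show ?thesis using z by (auto simp: neighbour_def L_coeff_def)
    next
      case False
      define j where "j = n - 2"
      have "n = j + 2" using False by (simp add: j_def)
      then show ?thesis
        by (simp add: neighbour_def L_coeff_def diag_def power2_eq_square algebra_simps)
    qed
  qed
  finally show "(\<lambda>n. w n * (a n * L_coeff a n)) sums
      ((\<Sum>n. w n * diag n * (a n)\<^sup>2) + (\<Sum>n. (w (n + 2) - w n) * neighbour a n))" .
qed

lemma L_pairing:
  assumes s: "summable (\<lambda>n. real n * \<bar>a n\<bar>)" and z: "a 0 = 0" "a 1 = 0"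
  shows "(\<lambda>n. a n * L_coeff a n) sums (\<Sum>n. diag n * (a n)\<^sup>2)"
  using weighted_L_pairing(3)[OF _ s z, of "\<lambda>_. 1"] by simp

lemma coupling_le_1: "coupling n \<le> 1"
proof -
  consider "n < 2" | "n = 2" | "n = 3" | "n = 4" | "5 \<le> n" by linarith
  then show ?thesis
    using coupling_small coupling_le_eighth[of n] by cases (auto simp: coupling_def)
qed

text \<open>
  The form is \<open>\<Sum>diag\<^sub>n\<^sup>2 a\<^sub>n\<^sup>2\<close> plus mixed terms bounded by \<open>coupling n (a\<^sub>n\<^sup>2 + a\<^sub>n\<^sub>+\<^sub>2\<^sup>2) / 2\<close>. So the
  numerical bounds on the weights carry over to the form.
\<close>
lemma quadratic_form_bounds:
  assumes s: "summable (\<lambda>n. real n * \<bar>a n\<bar>)" and z: "a 0 = 0" "a 1 = 0"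
  shows "11 / 100 * (\<Sum>n. (a n)\<^sup>2) \<le> (\<Sum>n. diag n * (a n * L_coeff a n))"
    and "(\<Sum>n. diag n * (a n * L_coeff a n)) \<le> 9 / 10 * (\<Sum>n. (a n)\<^sup>2)"
proof -
  define A where "A = (\<Sum>n. (a n)\<^sup>2)"
  define D where "D = (\<Sum>n. diag n * diag n * (a n)\<^sup>2)"
  define X where "X = (\<Sum>n. (diag (n + 2) - diag n) * neighbour a n)"
  have s2: "summable (\<lambda>n. (a n)\<^sup>2)" by (rule summable_square[OF summable_abs_of_weighted[OF s]])
  have sA: "(\<lambda>n. (a n)\<^sup>2) sums A" unfolding A_def by (rule summable_sums[OF s2])
  have sD: "(\<lambda>n. diag n * diag n * (a n)\<^sup>2) sums D"
    unfolding D_def by (rule summable_sums[OF weighted_L_pairing(1)[OF abs_diag_le_1 s z]])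
  have sX: "(\<lambda>n. (diag (n + 2) - diag n) * neighbour a n) sums X"
    unfolding X_def by (rule summable_sums[OF weighted_L_pairing(2)[OF abs_diag_le_1 s z]])
  have Q: "(\<Sum>n. diag n * (a n * L_coeff a n)) = D + X"
    unfolding D_def X_def by (rule sums_unique[OF weighted_L_pairing(3)[OF abs_diag_le_1 s z], symmetric])
  have s2': "summable (\<lambda>n. \<bar>(a n)\<^sup>2\<bar>)" using s2 by simp
  have s3: "summable (\<lambda>n. \<bar>(a (n + 2))\<^sup>2\<bar>)" using summable_ignore_initial_segment[OF s2, of 2] by simp
  define U where "U = (\<Sum>n. coupling n / 2 * (a n)\<^sup>2)"
  define V where "V = (\<Sum>n. coupling n / 2 * (a (n + 2))\<^sup>2)"
  have c1: "\<bar>coupling n / 2\<bar> \<le> 1" for n using coupling_le_1[of n] coupling_nonneg[of n] by simp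
  have sU: "(\<lambda>n. coupling n / 2 * (a n)\<^sup>2) sums U"
    unfolding U_def using summable_sums[OF summable_mult_bounded[OF s2' c1]] by (simp add: mult.commute)
  have sV: "(\<lambda>n. coupling n / 2 * (a (n + 2))\<^sup>2) sums V"
    unfolding V_def using summable_sums[OF summable_mult_bounded[OF s3 c1]] by (simp add: mult.commute)
  have sV': "(\<lambda>n. if n < 2 then 0 else coupling (n - 2) / 2 * (a (n - 2 + 2))\<^sup>2) sums V"
    by (rule sums_delay_two[OF sV])
  have cross: "\<bar>(diag (n + 2) - diag n) * neighbour a n\<bar> \<le> coupling n / 2 * (a n)\<^sup>2 + coupling n / 2 * (a (n + 2))\<^sup>2" for n
  proof (cases "n < 2")
    case True
    then have "n = 0 \<or> n = 1" by auto
    then show ?thesis using z by (auto simp: neighbour_def coupling_def)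
  next
    case False
    have "0 \<le> (\<bar>a n\<bar> - \<bar>a (n + 2)\<bar>)\<^sup>2" by simp
    then have "\<bar>a n * a (n + 2)\<bar> \<le> 1 / 2 * (a n)\<^sup>2 + 1 / 2 * (a (n + 2))\<^sup>2"
      by (simp add: power2_diff abs_mult)
    then have "coupling n * \<bar>a n * a (n + 2)\<bar> \<le> coupling n * (1 / 2 * (a n)\<^sup>2 + 1 / 2 * (a (n + 2))\<^sup>2)"
      by (intro mult_left_mono coupling_nonneg)
    moreover have "\<bar>(diag (n + 2) - diag n) * neighbour a n\<bar> = coupling n * \<bar>a n * a (n + 2)\<bar>"
      using False hop_bound(1)[of "n + 1"] by (simp add: neighbour_def coupling_def abs_mult)
    ultimately show ?thesis by (simp add: distrib_left)
  qed
  have XUV: "\<bar>X\<bar> \<le> U + V"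
  proof -
    have "X \<le> U + V" by (rule sums_le[OF _ sX sums_add[OF sU sV]]) (use cross in \<open>meson abs_le_D1\<close>)
    moreover have "- X \<le> U + V" by (rule sums_le[OF _ sums_minus[OF sX] sums_add[OF sU sV]]) (use cross in \<open>meson abs_le_D2\<close>)
    ultimately show ?thesis by simp
  qed
  have low: "11 / 100 * A \<le> D - U - V"
  proof (rule sums_le[OF _ sums_mult[OF sA] sums_diff[OF sums_diff[OF sD sU] sV']])
    fix n
    show "11 / 100 * (a n)\<^sup>2 \<le> diag n * diag n * (a n)\<^sup>2 - coupling n / 2 * (a n)\<^sup>2
        - (if n < 2 then 0 else coupling (n - 2) / 2 * (a (n - 2 + 2))\<^sup>2)"
    proof (cases "n < 2")
      case True
      then have "n = 0 \<or> n = 1" by auto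
      then show ?thesis using z by auto
    next
      case False
      then have "11 / 100 * (a n)\<^sup>2 \<le> ((diag n)\<^sup>2 - coupling n / 2 - coupling (n - 2) / 2) * (a n)\<^sup>2"
        by (intro mult_right_mono quadratic_form_weights(1)) auto
      moreover have "n - 2 + 2 = n" using False by simp
      ultimately show ?thesis using False by (simp add: left_diff_distrib power2_eq_square)
    qed
  qed
  have upp: "D + U + V \<le> 9 / 10 * A"
  proof (rule sums_le[OF _ sums_add[OF sums_add[OF sD sU] sV'] sums_mult[OF sA]])
    fix n
    show "diag n * diag n * (a n)\<^sup>2 + coupling n / 2 * (a n)\<^sup>2
        + (if n < 2 then 0 else coupling (n - 2) / 2 * (a (n - 2 + 2))\<^sup>2) \<le> 9 / 10 * (a n)\<^sup>2"
    proof (cases "n < 2")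
      case True
      then have "n = 0 \<or> n = 1" by auto
      then show ?thesis using z by auto
    next
      case False
      then have "((diag n)\<^sup>2 + coupling n / 2 + coupling (n - 2) / 2) * (a n)\<^sup>2 \<le> 9 / 10 * (a n)\<^sup>2"
        by (intro mult_right_mono quadratic_form_weights(2)) auto
      moreover have "n - 2 + 2 = n" using False by simp
      ultimately show ?thesis using False by (simp add: distrib_right power2_eq_square)
    qed
  qed
  show "11 / 100 * (\<Sum>n. (a n)\<^sup>2) \<le> (\<Sum>n. diag n * (a n * L_coeff a n))"
    and "(\<Sum>n. diag n * (a n * L_coeff a n)) \<le> 9 / 10 * (\<Sum>n. (a n)\<^sup>2)"
    using low upp XUV unfolding Q A_def[symmetric] by linarith+
qed

section \<open>Evolution of the coefficients and of the energy\<close>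

lemma L_coeff_linear_bound:
  assumes "\<And>n. \<bar>a n\<bar> \<le> M"
  shows "\<bar>L_coeff a n\<bar> \<le> 5 * real n * M"
proof (cases "n < 2")
  case True
  have "0 \<le> M" using assms[of 0] by linarith
  then show ?thesis using True by (simp add: L_coeff_def)
next
  case False
  have M: "0 \<le> M" using assms[of 0] by linarith
  have "\<bar>diag n\<bar> \<le> real n" using abs_diag_le_1[of n] False by linarith
  then have 1: "\<bar>diag n * a n\<bar> \<le> real n * M" unfolding abs_mult using assms by (intro mult_mono) auto
  have "hop (n - 1) \<le> real n" "hop (n + 1) \<le> 2 * real n"
    using hop_bound(2)[of "n - 1"] hop_bound(2)[of "n + 1"] False by auto
  then have 2: "\<bar>hop (n - 1) * a (n - 2)\<bar> \<le> real n * M" "\<bar>hop (n + 1) * a (n + 2)\<bar> \<le> 2 * real n * M"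
    unfolding abs_mult using assms hop_bound(1) by (intro mult_mono; simp)+
  have "L_coeff a n = diag n * a n + hop (n - 1) * a (n - 2) - hop (n + 1) * a (n + 2)"
    using False by (simp add: L_coeff_def diag_def)
  moreover have "0 \<le> real n * M" using M by simp
  ultimately show ?thesis using 1 2 by linarith
qed

lemma decay_imp_bound:
  assumes "\<And>n. real n ^ 4 * \<bar>a n\<bar> \<le> M" "a 0 = 0"
  shows "\<bar>a n\<bar> \<le> M"
proof (cases "n = 0")
  case False
  then have "1 * \<bar>a n\<bar> \<le> real n ^ 4 * \<bar>a n\<bar>" by (intro mult_right_mono one_le_power) auto
  then show ?thesis using assms(1)[of n] by linarith
qed (use assms(1)[of 0] assms(2) in simp)

text \<open>
  Termwise differentiation. The factor \<open>L_coeff\<close> grows at most linearly in \<open>n\<close>, the coefficients decay like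
  \<open>n\<^sup>-\<^sup>4\<close>, so the derivatives are dominated by a multiple of \<open>n\<^sup>-\<^sup>2\<close> near \<open>t\<close>.
\<close>
lemma weighted_energy_has_derivative:
  fixes a :: "real \<Rightarrow> nat \<Rightarrow> real"
  assumes w: "\<And>n. \<bar>w n\<bar> \<le> 1"
    and z: "\<And>t. 0 \<le> t \<Longrightarrow> a t 0 = 0"
    and ode: "\<And>t n. 0 \<le> t \<Longrightarrow> ((\<lambda>s. a s n) has_real_derivative - L_coeff (a t) n) (at t within {0..})"
    and t: "0 \<le> t" and \<delta>: "0 < \<delta>"
    and bd: "\<And>s n. 0 \<le> s \<Longrightarrow> \<bar>s - t\<bar> < \<delta> \<Longrightarrow> real n ^ 4 * \<bar>a s n\<bar> \<le> M"
  shows "((\<lambda>s. \<Sum>n. w n * (a s n)\<^sup>2) has_real_derivative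
      - 2 * (\<Sum>n. w n * (a t n * L_coeff (a t) n))) (at t within {0..})"
proof -
  define S where "S = {0..} \<inter> {t - \<delta><..<t + \<delta>}"
  have S: "convex S" "t \<in> S" using t \<delta> by (auto simp: S_def intro!: convex_Int)
  have inS: "0 \<le> s" "\<bar>s - t\<bar> < \<delta>" if "s \<in> S" for s using that by (auto simp: S_def)
  have M0: "0 \<le> M" using bd[OF t, of 0] \<delta> by simp
  let ?f = "\<lambda>n s. w n * (a s n)\<^sup>2" and ?f' = "\<lambda>n s. - 2 * (w n * (a s n * L_coeff (a s) n))"
  have df: "(?f n has_real_derivative ?f' n s) (at s within S)" if "s \<in> S" for n s
  proof -
    have "((\<lambda>s. a s n) has_real_derivative - L_coeff (a s) n) (at s within S)"
      by (rule DERIV_subset[OF ode[OF inS(1)[OF that]]]) (simp add: S_def)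
    then show ?thesis by (auto intro!: derivative_eq_intros)
  qed
  have bound: "norm (?f' n s) \<le> 10 * M\<^sup>2 * (1 / real n ^ 2)" if s: "s \<in> S" for n s
  proof (cases "n = 0")
    case True then show ?thesis using z inS[OF s] by simp
  next
    case False
    then have n: "1 \<le> real n" by simp
    have b: "\<bar>a s n\<bar> \<le> M" for n by (rule decay_imp_bound[OF bd]) (use inS[OF s] z in auto)
    have "real n ^ 3 * \<bar>a s n\<bar> \<le> real n ^ 4 * \<bar>a s n\<bar>" using n by (intro mult_right_mono power_increasing) auto
    then have a3: "real n ^ 3 * \<bar>a s n\<bar> \<le> M" using bd[of s n] inS[OF s] by linarith
    have "real n ^ 2 * (\<bar>a s n\<bar> * \<bar>L_coeff (a s) n\<bar>) \<le> real n ^ 2 * (\<bar>a s n\<bar> * (5 * real n * M))"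
      by (intro mult_left_mono L_coeff_linear_bound b) auto
    also have "\<dots> = 5 * M * (real n ^ 3 * \<bar>a s n\<bar>)" by (simp add: power2_eq_square power3_eq_cube)
    also have "\<dots> \<le> 5 * M * M" using M0 a3 by (intro mult_left_mono) auto
    finally have "real n ^ 2 * (\<bar>a s n\<bar> * \<bar>L_coeff (a s) n\<bar>) \<le> 5 * M\<^sup>2" by (simp add: power2_eq_square)
    then have al: "\<bar>a s n\<bar> * \<bar>L_coeff (a s) n\<bar> \<le> 5 * M\<^sup>2 * (1 / real n ^ 2)"
      using n by (simp add: pos_le_divide_eq mult.commute)
    have "\<bar>w n\<bar> * (\<bar>a s n\<bar> * \<bar>L_coeff (a s) n\<bar>) \<le> 1 * (\<bar>a s n\<bar> * \<bar>L_coeff (a s) n\<bar>)"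
      by (intro mult_right_mono w) auto
    with al show ?thesis by (simp add: abs_mult)
  qed
  have sm: "summable (\<lambda>n. 10 * M\<^sup>2 * (1 / real n ^ 2))"
    by (rule summable_mult[OF summable_inverse_square])
  have ul: "uniform_limit S (\<lambda>N s. \<Sum>n<N. ?f' n s) (\<lambda>s. \<Sum>n. ?f' n s) sequentially"
    by (rule Weierstrass_m_test[OF bound sm])
  have sum_a: "summable (\<lambda>n. (a s n)\<^sup>2)" if "s \<in> S" for s
    by (intro summable_square summable_abs_of_weighted weighted_sum_of_decay(1)[of _ M] bd inS that)
  have sumf: "summable (\<lambda>n. ?f n s)" if "s \<in> S" for s
    using summable_mult_bounded[of "\<lambda>n. (a s n)\<^sup>2" w] sum_a[OF that] w by (simp add: mult.commute)
  obtain g where g: "\<And>s. s \<in> S \<Longrightarrow> (\<lambda>n. ?f n s) sums g s"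
     "\<And>s. s \<in> S \<Longrightarrow> (g has_real_derivative (\<Sum>n. ?f' n s)) (at s within S)"
    using has_field_derivative_series[OF S(1) df ul S(2) sumf[OF S(2)]] by blast
  have "at t within S = at t within {0..}"
    unfolding S_def by (rule at_within_nhd[of t "{t - \<delta><..<t + \<delta>}"]) (use \<delta> in auto)
  then have "(g has_real_derivative (\<Sum>n. ?f' n t)) (at t within {0..})" using g(2)[OF S(2)] by simp
  moreover have "(\<Sum>n. ?f' n t) = - 2 * (\<Sum>n. w n * (a t n * L_coeff (a t) n))"
  proof (rule suminf_mult)
    have "summable (\<lambda>n. ?f' n t)"
      by (rule summable_comparison_test'[OF sm, of 0]) (use bound[OF S(2)] in blast)
    from summable_mult[OF this, of "- 1 / 2"] show "summable (\<lambda>n. w n * (a t n * L_coeff (a t) n))" by simp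
  qed
  ultimately have "(g has_real_derivative - 2 * (\<Sum>n. w n * (a t n * L_coeff (a t) n))) (at t within {0..})" by simp
  then show ?thesis
  proof (rule has_field_derivative_transform_within[OF _ \<delta>])
    show "t \<in> {0..}" using t by simp
    fix s assume "s \<in> {0..}" "dist s t < \<delta>"
    then have "s \<in> S" by (auto simp: S_def dist_real_def)
    then show "g s = (\<Sum>n. w n * (a s n)\<^sup>2)" using g(1) sums_unique by blast
  qed
qed

text \<open>
  The mean value inequality in time bounds the difference quotients by \<open>B\<close>, and dominated convergence
  applies.
\<close>
lemma has_derivative_integral_dominated:
  fixes f f' :: "real \<Rightarrow> real \<Rightarrow> real"
  assumes t: "0 \<le> t" and \<delta>: "0 < \<delta>"
    and cont: "\<And>s. 0 \<le> s \<Longrightarrow> continuous_on {a..b} (f s)"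
    and d: "\<And>s \<theta>. 0 \<le> s \<Longrightarrow> ((\<lambda>s. f s \<theta>) has_real_derivative f' s \<theta>) (at s within {0..})"
    and bd: "\<And>s \<theta>. 0 \<le> s \<Longrightarrow> \<bar>s - t\<bar> < \<delta> \<Longrightarrow> \<theta> \<in> {a..b} \<Longrightarrow> \<bar>f' s \<theta>\<bar> \<le> B"
  shows "((\<lambda>s. integral {a..b} (f s)) has_real_derivative integral {a..b} (f' t)) (at t within {0..})"
  unfolding has_field_derivative_iff tendsto_at_iff_sequentially comp_def
proof (intro allI impI)
  fix X :: "nat \<Rightarrow> real"
  assume X: "\<forall>i. X i \<in> {0..} - {t}" and lim: "X \<longlonglongrightarrow> t"
  define S where "S = {0..} \<inter> {t - \<delta><..<t + \<delta>}"
  have S: "convex S" "t \<in> S" using t \<delta> by (auto simp: S_def intro!: convex_Int)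
  have inS: "0 \<le> s" "\<bar>s - t\<bar> < \<delta>" if "s \<in> S" for s using that by (auto simp: S_def)
  have "\<forall>\<^sub>F i in sequentially. dist (X i) t < \<delta>" using lim \<delta> by (rule tendstoD)
  then obtain N where N: "\<And>i. N \<le> i \<Longrightarrow> dist (X i) t < \<delta>" by (auto simp: eventually_sequentially)
  define Y where "Y i = X (i + N)" for i
  \<comment> \<open>From index \<open>N\<close> on the sequence stays in the neighbourhood where the bound holds.\<close>
  have Y: "Y i \<in> S" "Y i \<noteq> t" "0 \<le> Y i" for i
    using N[of "i + N"] X[rule_format, of "i + N"] by (auto simp: Y_def S_def dist_real_def)
  have Ylim: "Y \<longlonglongrightarrow> t" unfolding Y_def by (rule LIMSEQ_ignore_initial_segment[OF lim])
  define q where "q i \<theta> = (f (Y i) \<theta> - f t \<theta>) / (Y i - t)" for i \<theta>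
  have qc: "continuous_on {a..b} (q i)" for i
    unfolding q_def[abs_def] by (intro continuous_intros cont Y t) (use Y in auto)
  have qb: "norm (q i \<theta>) \<le> B" if \<theta>: "\<theta> \<in> {a..b}" for i \<theta>
  proof -
    have "norm (f (Y i) \<theta> - f t \<theta>) \<le> B * norm (Y i - t)"
    proof (rule field_differentiable_bound[OF S(1)])
      show "((\<lambda>s. f s \<theta>) has_field_derivative f' s \<theta>) (at s within S)" if "s \<in> S" for s
        by (rule DERIV_subset[OF d[OF inS(1)[OF that]]]) (simp add: S_def)
      show "norm (f' s \<theta>) \<le> B" if "s \<in> S" for s using bd[OF inS[OF that] \<theta>] by simp
    qed (use S Y in auto)
    then show ?thesis using Y(2)[of i] by (simp add: q_def pos_divide_le_eq)
  qed
  have ql: "(\<lambda>i. q i \<theta>) \<longlonglongrightarrow> f' t \<theta>" for \<theta>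
    using d[OF t, of \<theta>] Ylim Y unfolding has_field_derivative_iff tendsto_at_iff_sequentially q_def comp_def
    by auto
  have "(\<lambda>i. integral {a..b} (q i)) \<longlonglongrightarrow> integral {a..b} (f' t)"
    by (rule dominated_convergence(2)[OF integrable_continuous_interval[OF qc] _ qb ql]) auto
  moreover have "integral {a..b} (q i) = (integral {a..b} (f (Y i)) - integral {a..b} (f t)) / (Y i - t)" for i
  proof -
    have "integral {a..b} (\<lambda>\<theta>. f (Y i) \<theta> - f t \<theta>) = integral {a..b} (f (Y i)) - integral {a..b} (f t)"
      by (intro Henstock_Kurzweil_Integration.integral_diff integrable_continuous_interval cont Y t)
    then show ?thesis unfolding q_def by simp
  qed
  ultimately have "(\<lambda>i. (integral {a..b} (f (X (i + N))) - integral {a..b} (f t)) / (X (i + N) - t)) \<longlonglongrightarrow> integral {a..b} (f' t)"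
    by (simp add: Y_def)
  then show "(\<lambda>i. (integral {a..b} (f (X i)) - integral {a..b} (f t)) / (X i - t)) \<longlonglongrightarrow> integral {a..b} (f' t)"
    by (rule LIMSEQ_offset)
qed

text \<open>
  Every entry of column \<open>n\<close> of the matrix is bounded by a multiple of \<open>n\<close>.
\<close>
lemma L_coeff_abs_summable:
  assumes s: "summable (\<lambda>n. real n * \<bar>a n\<bar>)" and z: "a 0 = 0"
  shows "summable (\<lambda>n. \<bar>L_coeff a n\<bar>)" "(\<Sum>n. \<bar>L_coeff a n\<bar>) \<le> 4 * (\<Sum>n. real n * \<bar>a n\<bar>)"
proof -
  define y where "y n = real n * \<bar>a n\<bar>" for n
  define Y where "Y = (\<Sum>n. y n)"
  have sy: "summable y" using s by (simp add: y_def[abs_def])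
  have y0: "0 \<le> y n" for n by (simp add: y_def)
  have Y: "y sums Y" unfolding Y_def by (rule summable_sums[OF sy])
  have s2: "summable (\<lambda>n. y (n + 2))" by (rule summable_ignore_initial_segment[OF sy])
  have Y2: "(\<Sum>n. y (n + 2)) \<le> Y"
    using suminf_split_initial_segment[OF sy, of 2] sum_nonneg[of "{..<2}" y] y0 unfolding Y_def by simp
  have le: "\<bar>L_coeff a n\<bar> \<le> y n + (if n < 2 then 0 else 2 * y (n - 2)) + y (n + 2)" for n
  proof (cases "n < 2")
    case True
    then show ?thesis using y0 by (simp add: L_coeff_def)
  next
    case False
    have "\<bar>diag n\<bar> \<le> real n" using abs_diag_le_1[of n] False by linarith
    then have 1: "\<bar>diag n * a n\<bar> \<le> y n" unfolding abs_mult y_def by (intro mult_right_mono) auto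
    have 2: "\<bar>hop (n - 1) * a (n - 2)\<bar> \<le> 2 * y (n - 2)"
    proof (cases "n = 2")
      case True then show ?thesis using z by (simp add: y_def)
    next
      case n: False
      have "hop (n - 1) \<le> 2 * real (n - 2)" using hop_bound(2)[of "n - 1"] n False by auto
      then have "hop (n - 1) * \<bar>a (n - 2)\<bar> \<le> 2 * real (n - 2) * \<bar>a (n - 2)\<bar>" by (intro mult_right_mono) auto
      then show ?thesis using hop_bound(1)[of "n - 1"] by (simp add: abs_mult y_def)
    qed
    have "hop (n + 1) \<le> real (n + 2)" using hop_bound(2)[of "n + 1"] by simp
    then have "hop (n + 1) * \<bar>a (n + 2)\<bar> \<le> real (n + 2) * \<bar>a (n + 2)\<bar>" by (intro mult_right_mono) auto
    then have 3: "\<bar>hop (n + 1) * a (n + 2)\<bar> \<le> y (n + 2)" using hop_bound(1)[of "n + 1"] by (simp add: abs_mult y_def)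
    have "L_coeff a n = diag n * a n + hop (n - 1) * a (n - 2) - hop (n + 1) * a (n + 2)"
      using False by (simp add: L_coeff_def diag_def)
    then show ?thesis using 1 2 3 unfolding if_not_P[OF False] by linarith
  qed
  have maj: "(\<lambda>n. y n + (if n < 2 then 0 else 2 * y (n - 2)) + y (n + 2)) sums (Y + 2 * Y + (\<Sum>n. y (n + 2)))"
    by (intro sums_add Y sums_delay_two[of "\<lambda>n. 2 * y n"] sums_mult summable_sums[OF s2])
  show sL: "summable (\<lambda>n. \<bar>L_coeff a n\<bar>)"
    by (rule summable_comparison_test'[OF sums_summable[OF maj], of 0]) (use le in simp)
  have "(\<Sum>n. \<bar>L_coeff a n\<bar>) \<le> Y + 2 * Y + (\<Sum>n. y (n + 2))"
    by (rule sums_le[OF le summable_sums[OF sL] maj])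
  also have "\<dots> \<le> 4 * Y" using Y2 by simp
  finally show "(\<Sum>n. \<bar>L_coeff a n\<bar>) \<le> 4 * (\<Sum>n. real n * \<bar>a n\<bar>)" by (simp add: Y_def y_def)
qed

lemma abs_expansion_le:
  assumes s: "summable (\<lambda>n. \<bar>x n\<bar>)"
  shows "\<bar>expansion x \<theta>\<bar> \<le> 2 * (\<Sum>n. \<bar>x n\<bar>)"
proof -
  define S where "S = (\<Sum>n. \<bar>x n\<bar>)"
  have S: "(\<lambda>n. \<bar>x n\<bar>) sums S" unfolding S_def by (rule summable_sums[OF s])
  have s1: "summable (\<lambda>n. \<bar>x (n + 1)\<bar>)" by (rule summable_shift_abs(1)[OF s])
  have S1: "(\<Sum>n. \<bar>x (n + 1)\<bar>) \<le> S"
    using suminf_split_initial_segment[OF s, of 1] unfolding S_def by simp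
  have "(\<lambda>k. if k < 1 then 0 else \<bar>x (k - 1)\<bar>) sums S"
    by (subst sums_iff_shift'[of _ 1, symmetric]) (use S in simp)
  from sums_add[OF summable_sums[OF s1] this]
  have maj: "(\<lambda>k. \<bar>x (k + 1)\<bar> + (if k < 1 then 0 else \<bar>x (k - 1)\<bar>)) sums ((\<Sum>n. \<bar>x (n + 1)\<bar>) + S)" .
  have le: "\<bar>primitive_coeff x k * sin (real k * \<theta>)\<bar> \<le> \<bar>x (k + 1)\<bar> + (if k < 1 then 0 else \<bar>x (k - 1)\<bar>)" for k
  proof (cases "k = 0")
    case False
    have "\<bar>primitive_coeff x k * sin (real k * \<theta>)\<bar> \<le> \<bar>primitive_coeff x k\<bar> * 1"
      unfolding abs_mult by (intro mult_left_mono) auto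
    also have "\<dots> = \<bar>x (k + 1) - x (k - 1)\<bar> / real k" by (simp add: primitive_coeff_def)
    also have "\<dots> \<le> \<bar>x (k + 1) - x (k - 1)\<bar>" using False divide_left_mono[of 1 "real k" "\<bar>x (k + 1) - x (k - 1)\<bar>"] by simp
    also have "\<dots> \<le> \<bar>x (k + 1)\<bar> + \<bar>x (k - 1)\<bar>" by (rule abs_triangle_ineq4)
    finally show ?thesis using False by simp
  qed (simp add: primitive_coeff_def)
  have ss: "summable (\<lambda>k. \<bar>primitive_coeff x k * sin (real k * \<theta>)\<bar>)"
    by (rule summable_comparison_test'[OF sums_summable[OF maj], of 0]) (use le in simp)
  have "\<bar>expansion x \<theta>\<bar> \<le> (\<Sum>k. \<bar>primitive_coeff x k * sin (real k * \<theta>)\<bar>)"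
    unfolding expansion_def sine_series_def by (rule summable_rabs[OF ss])
  also have "\<dots> \<le> (\<Sum>n. \<bar>x (n + 1)\<bar>) + S" by (rule sums_le[OF le summable_sums[OF ss] maj])
  finally show ?thesis using S1 by (simp add: S_def)
qed

text \<open>
  Pair the pointwise equation with the biorthogonal polynomial. The local bound on the coefficients
  makes \<open>L \<eta>\<close> bounded near \<open>t\<close> uniformly in \<open>\<theta>\<close>, so the derivative may be taken inside the
  integral; on the right side the polynomial picks the \<open>n\<close>-th coefficient of \<open>L \<eta>\<close>.
\<close>
lemma DW_coeff_ode:
  fixes \<eta> :: "real \<Rightarrow> real \<Rightarrow> real" and a :: "real \<Rightarrow> nat \<Rightarrow> real"
  assumes rep: "\<And>s. 0 \<le> s \<Longrightarrow> \<eta> s = expansion (a s)"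
    and z: "\<And>s. 0 \<le> s \<Longrightarrow> a s 0 = 0" "\<And>s. 0 \<le> s \<Longrightarrow> a s 1 = 0"
    and sm: "\<And>s. 0 \<le> s \<Longrightarrow> summable (\<lambda>n. real n * \<bar>a s n\<bar>)"
    and eq: "\<And>s \<theta>. 0 \<le> s \<Longrightarrow> ((\<lambda>r. \<eta> r \<theta>) has_real_derivative - L_op (\<eta> s) \<theta>) (at s within {0..})"
    and t: "0 \<le> t" and \<delta>: "0 < \<delta>"
    and bd: "\<And>s n. 0 \<le> s \<Longrightarrow> \<bar>s - t\<bar> < \<delta> \<Longrightarrow> real n ^ 4 * \<bar>a s n\<bar> \<le> M"
  shows "((\<lambda>s. a s n) has_real_derivative - L_coeff (a t) n) (at t within {0..})"
proof -
  have sa: "summable (\<lambda>n. \<bar>a s n\<bar>)" if "0 \<le> s" for s by (rule summable_abs_of_weighted[OF sm[OF that]])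
  have sL: "summable (\<lambda>n. \<bar>L_coeff (a s) n\<bar>)" if "0 \<le> s" for s
    by (rule L_coeff_abs_summable(1)[OF sm[OF that] z(1)[OF that]])
  have L: "L_op (\<eta> s) = expansion (L_coeff (a s))" if "0 \<le> s" for s
    unfolding rep[OF that] by (rule L_op_expansion[OF sa[OF that]])
  have "bounded (dual n ` {-pi..pi})"
    by (intro compact_imp_bounded compact_continuous_image continuous_on_dual) simp
  then obtain D where "\<forall>y\<in>dual n ` {-pi..pi}. norm y \<le> D"
    unfolding bounded_iff by blast
  then have D: "\<bar>dual n \<theta>\<bar> \<le> D" if "\<theta> \<in> {-pi..pi}" for \<theta>
    using that unfolding real_norm_def by blast
  define B where "B = 2 * (4 * (M * (\<Sum>n. 1 / real n ^ 2)))"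
  have B: "\<bar>L_op (\<eta> s) \<theta>\<bar> \<le> B" if s: "0 \<le> s" "\<bar>s - t\<bar> < \<delta>" for s \<theta>
  proof -
    have "\<bar>L_op (\<eta> s) \<theta>\<bar> \<le> 2 * (\<Sum>n. \<bar>L_coeff (a s) n\<bar>)"
      unfolding L[OF s(1)] by (rule abs_expansion_le[OF sL[OF s(1)]])
    then show ?thesis
      using L_coeff_abs_summable(2)[OF sm[OF s(1)] z(1)[OF s(1)]]
        weighted_sum_of_decay(2)[of "a s" M, OF bd[OF s]] unfolding B_def by linarith
  qed
  have "((\<lambda>s. integral {-pi..pi} (\<lambda>\<theta>. dual n \<theta> * \<eta> s \<theta>)) has_real_derivative
      integral {-pi..pi} (\<lambda>\<theta>. dual n \<theta> * - L_op (\<eta> t) \<theta>)) (at t within {0..})"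
  proof (rule has_derivative_integral_dominated[OF t \<delta>, where B = "D * B"])
    show "continuous_on {-pi..pi} (\<lambda>\<theta>. dual n \<theta> * \<eta> s \<theta>)" if "0 \<le> s" for s
      unfolding rep[OF that] by (intro continuous_intros continuous_on_dual continuous_on_expansion sa that)
    show "((\<lambda>s. dual n \<theta> * \<eta> s \<theta>) has_real_derivative dual n \<theta> * - L_op (\<eta> s) \<theta>) (at s within {0..})"
      if "0 \<le> s" for s \<theta>
      by (rule DERIV_cmult[OF eq[OF that]])
    show "\<bar>dual n \<theta> * - L_op (\<eta> s) \<theta>\<bar> \<le> D * B" if "0 \<le> s" "\<bar>s - t\<bar> < \<delta>" "\<theta> \<in> {-pi..pi}" for s \<theta>
      unfolding abs_mult abs_minus_cancel
      using D[OF that(3)] B[OF that(1,2), of \<theta>] by (intro mult_mono) auto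
  qed
  moreover have "integral {-pi..pi} (\<lambda>\<theta>. dual n \<theta> * - L_op (\<eta> t) \<theta>) = - L_coeff (a t) n"
  proof -
    have "integral {-pi..pi} (\<lambda>\<theta>. dual n \<theta> * expansion (L_coeff (a t)) \<theta>) = L_coeff (a t) n"
      by (rule integral_dual_expansion[OF sL[OF t]]) (simp_all add: L_coeff_def)
    then show ?thesis unfolding L[OF t] by simp
  qed
  ultimately have "((\<lambda>s. integral {-pi..pi} (\<lambda>\<theta>. dual n \<theta> * \<eta> s \<theta>)) has_real_derivative - L_coeff (a t) n) (at t within {0..})"
    by simp
  then show ?thesis
  proof (rule has_field_derivative_transform_within[OF _ zero_less_one])
    show "t \<in> {0..}" using t by simp
    fix s :: real assume "s \<in> {0..}"
    then have "0 \<le> s" by simp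
    then show "integral {-pi..pi} (\<lambda>\<theta>. dual n \<theta> * \<eta> s \<theta>) = a s n"
      unfolding rep[OF \<open>0 \<le> s\<close>] by (intro integral_dual_expansion sa z)
  qed
qed

lemma expansion_minus:
  assumes "summable (\<lambda>n. \<bar>x n\<bar>)"
  shows "(\<lambda>\<theta>. - expansion x \<theta>) = expansion (\<lambda>n. - x n)"
proof -
  have "primitive_coeff (\<lambda>n. - x n) = (\<lambda>k. - primitive_coeff x k)"
    by (auto simp: primitive_coeff_def fun_eq_iff minus_divide_left)
  then show ?thesis
    unfolding expansion_def
    by (intro ext) (simp only: sine_series_minus[OF summable_primitive_coeff[OF assms]])
qed

text \<open>
  In the pairing of \<open>L \<eta>\<close> with \<open>\<eta>\<close> the antisymmetric off-diagonal part cancels.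
\<close>
lemma inner_rho_L:
  assumes s: "summable (\<lambda>n. real n * \<bar>a n\<bar>)" and z: "a 0 = 0" "a 1 = 0"
  shows "inner_rho (\<lambda>\<theta>. - L_op (expansion a) \<theta>) (expansion a) = - (\<Sum>n. diag n * (a n)\<^sup>2)"
proof -
  have sL: "summable (\<lambda>n. \<bar>L_coeff a n\<bar>)" by (rule L_coeff_abs_summable(1)[OF s z(1)])
  have sa: "summable (\<lambda>n. \<bar>a n\<bar>)" by (rule summable_abs_of_weighted[OF s])
  have "(\<lambda>n. - L_coeff a n * a n) sums inner_rho (expansion (\<lambda>n. - L_coeff a n)) (expansion a)"
    by (rule inner_rho_expansion[OF _ sa]) (use sL z in \<open>simp_all add: L_coeff_def\<close>)
  moreover have "(\<lambda>n. - L_coeff a n * a n) sums - (\<Sum>n. diag n * (a n)\<^sup>2)"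
    using sums_minus[OF L_pairing[OF s z]] by (simp add: mult.commute)
  ultimately show ?thesis
    unfolding L_op_expansion[OF sa] expansion_minus[OF sL] by (rule sums_unique2)
qed

lemma solution_coefficients:
  assumes m: "3 < m" and sol: "classical_solution m \<eta>\<^sub>0 \<eta>"
  defines "a \<equiv> \<lambda>t. DW_coeff (\<eta> t)"
  assumes t: "0 \<le> t"
  shows "\<exists>\<delta> M. 0 < \<delta> \<and> (\<forall>s n. 0 \<le> s \<longrightarrow> \<bar>s - t\<bar> < \<delta> \<longrightarrow> real n ^ 4 * \<bar>a s n\<bar> \<le> M)"
    and "summable (\<lambda>n. real n * \<bar>a t n\<bar>)" "a t 0 = 0" "a t 1 = 0" "\<eta> t = expansion (a t)"
proof -
  have T: "0 < t + 1" using t by simp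
  have cc: "curve_cont (sobolev m) (sobolev_norm m) (t + 1) (\<lambda>t. rho_half_deriv (\<eta> t))"
    and ch: "curve_cont H_DW norm_DW (t + 1) \<eta>"
    using sol T unfolding classical_solution_def by auto
  have tin: "t \<in> {0..t + 1}" using t by simp
  have m4: "4 \<le> m" using m by simp
  obtain \<delta> M where \<delta>: "0 < \<delta>"
    and near: "\<forall>s\<in>{0..t + 1}. \<forall>n. \<bar>s - t\<bar> < \<delta> \<longrightarrow> real n ^ 4 * \<bar>DW_coeff (\<eta> s) n\<bar> \<le> M"
    using DW_coeff_locally_bounded[OF cc m4 tin] by blast
  have bd: "real n ^ 4 * \<bar>DW_coeff (\<eta> s) n\<bar> \<le> M" if "s \<in> {0..t + 1}" "\<bar>s - t\<bar> < \<delta>" for s n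
    using near that by simp
  show "\<exists>\<delta> M. 0 < \<delta> \<and> (\<forall>s n. 0 \<le> s \<longrightarrow> \<bar>s - t\<bar> < \<delta> \<longrightarrow> real n ^ 4 * \<bar>a s n\<bar> \<le> M)"
  proof (intro exI conjI allI impI)
    show "0 < min \<delta> 1" using \<delta> by simp
    fix s :: real and n :: nat assume "0 \<le> s" "\<bar>s - t\<bar> < min \<delta> 1"
    then show "real n ^ 4 * \<bar>a s n\<bar> \<le> M" unfolding a_def by (intro bd) auto
  qed
  have "\<bar>t - t\<bar> < \<delta>" using \<delta> by simp
  then have "real n ^ 4 * \<bar>a t n\<bar> \<le> M" for n unfolding a_def by (intro bd tin)
  then show sm: "summable (\<lambda>n. real n * \<bar>a t n\<bar>)" by (rule weighted_sum_of_decay(1))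
  have "\<eta> t \<in> H_DW" using ch tin by (simp add: curve_cont_def)
  then have odd: "odd_fun (\<eta> t)" and per: "periodic (\<eta> t)" by (simp_all add: H_DW_def sobolev_def)
  have diff: "\<eta> t differentiable (at \<theta>)" for \<theta> using sol t by (simp add: classical_solution_def)
  have "rho_half_deriv (\<eta> t) \<in> sobolev m" using cc tin by (simp add: curve_cont_def)
  note int = sobolev_absolutely_integrable[OF this]
  note r = odd_periodic_eq_expansion[OF odd per diff int summable_abs_of_weighted[OF sm[unfolded a_def]]]
  show "a t 0 = 0" "a t 1 = 0" "\<eta> t = expansion (a t)" unfolding a_def by (fact r)+
qed

section \<open>Two-sided exponential bounds\<close>

theorem theorem1p2:
  shows "\<exists>l\<^sub>1 l\<^sub>2 :: real. 0 < l\<^sub>1 \<and> l\<^sub>1 < l\<^sub>2 \<and>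
    (\<forall>(m :: nat) (\<eta>\<^sub>0 :: real \<Rightarrow> real) (\<eta> :: real \<Rightarrow> real \<Rightarrow> real).
       3 < m \<longrightarrow> \<eta>\<^sub>0 \<in> H_DW \<longrightarrow> rho_half_deriv \<eta>\<^sub>0 \<in> sobolev m \<longrightarrow> \<eta>\<^sub>0 \<noteq> (\<lambda>\<theta>. 0) \<longrightarrow>
       inner_rho (\<lambda>\<theta>. - L_op \<eta>\<^sub>0 \<theta>) \<eta>\<^sub>0 \<ge> 0 \<longrightarrow>
       classical_solution m \<eta>\<^sub>0 \<eta> \<longrightarrow>
       (\<forall>t>0. 0 < sqrt (J \<eta>\<^sub>0 l\<^sub>1 t)
            \<and> sqrt (J \<eta>\<^sub>0 l\<^sub>1 t) < norm_DW (\<eta> t)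
            \<and> norm_DW (\<eta> t) < sqrt (J \<eta>\<^sub>0 l\<^sub>2 t)))"
proof (rule exI[of _ "1 / 10 :: real"], rule exI[of _ "1 :: real"], intro conjI allI impI)
  fix m :: nat and \<eta>\<^sub>0 :: "real \<Rightarrow> real" and \<eta> :: "real \<Rightarrow> real \<Rightarrow> real" and t :: real
  assume m: "3 < m" and ne: "\<eta>\<^sub>0 \<noteq> (\<lambda>\<theta>. 0)" and pos: "0 \<le> inner_rho (\<lambda>\<theta>. - L_op \<eta>\<^sub>0 \<theta>) \<eta>\<^sub>0"
    and sol: "classical_solution m \<eta>\<^sub>0 \<eta>" and t: "0 < t"
  define a where "a t = DW_coeff (\<eta> t)" for t
  note sc = solution_coefficients[OF m sol, folded a_def]
  have sm: "summable (\<lambda>n. real n * \<bar>a s n\<bar>)" and z: "a s 0 = 0" "a s 1 = 0" and rep: "\<eta> s = expansion (a s)"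
    if "0 \<le> s" for s using sc(2-5)[OF that] by blast+
  have eq: "((\<lambda>r. \<eta> r \<theta>) has_real_derivative - L_op (\<eta> s) \<theta>) (at s within {0..})" if s: "0 \<le> s" for s \<theta>
  proof -
    obtain D where "((\<lambda>r. \<eta> r \<theta>) has_real_derivative D) (at s within {0..})" "D + L_op (\<eta> s) \<theta> = 0"
      using sol s unfolding classical_solution_def by blast
    moreover from this(2) have "D = - L_op (\<eta> s) \<theta>" by linarith
    ultimately show ?thesis by simp
  qed
  have ode: "((\<lambda>r. a r n) has_real_derivative - L_coeff (a s) n) (at s within {0..})" if s: "0 \<le> s" for s n
  proof -
    obtain \<delta> M where \<delta>: "0 < \<delta>" and bd: "\<And>r n. 0 \<le> r \<Longrightarrow> \<bar>r - s\<bar> < \<delta> \<Longrightarrow> real n ^ 4 * \<bar>a r n\<bar> \<le> M"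
      using sc(1)[OF s] by blast
    show ?thesis by (rule DW_coeff_ode[OF rep z sm eq s \<delta> bd])
  qed
  define E F Q where "E s = (\<Sum>n. (a s n)\<^sup>2)" and "F s = - (\<Sum>n. diag n * (a s n)\<^sup>2)"
    and "Q s = (\<Sum>n. diag n * (a s n * L_coeff (a s) n))" for s
  have weighted: "((\<lambda>r. \<Sum>n. w n * (a r n)\<^sup>2) has_real_derivative
      - 2 * (\<Sum>n. w n * (a s n * L_coeff (a s) n))) (at s within {0..})"
    if w: "\<And>n. \<bar>w n\<bar> \<le> 1" and s: "0 \<le> s" for w s
  proof -
    obtain \<delta> M where \<delta>: "0 < \<delta>" and bd: "\<And>r n. 0 \<le> r \<Longrightarrow> \<bar>r - s\<bar> < \<delta> \<Longrightarrow> real n ^ 4 * \<bar>a r n\<bar> \<le> M"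
      using sc(1)[OF s] by blast
    show ?thesis by (rule weighted_energy_has_derivative[OF w z(1) ode s \<delta> bd])
  qed
  have dE: "(E has_real_derivative 2 * F s) (at s within {0..})" if s: "0 \<le> s" for s
    using weighted[of "\<lambda>_. 1", OF _ s] sums_unique[OF L_pairing[OF sm[OF s] z[OF s]]]
    by (simp add: E_def[abs_def] F_def)
  have dF: "(F has_real_derivative 2 * Q s) (at s within {0..})" if s: "0 \<le> s" for s
    using DERIV_minus[OF weighted[OF abs_diag_le_1 s]] by (simp add: F_def[abs_def] Q_def)
  have Q: "11 / 100 * E s \<le> Q s" "Q s \<le> 9 / 10 * E s" if "0 \<le> s" for s
    using quadratic_form_bounds[OF sm[OF that] z[OF that]] by (simp_all add: E_def Q_def)
  have sq: "summable (\<lambda>n. (a s n)\<^sup>2)" if "0 \<le> s" for s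
    by (rule summable_square[OF summable_abs_of_weighted[OF sm[OF that]]])
  have E_nonneg: "0 \<le> E s" if "0 \<le> s" for s unfolding E_def by (rule suminf_nonneg[OF sq[OF that]]) simp
  have E_inner: "inner_rho (\<eta> s) (\<eta> s) = E s" if s: "0 \<le> s" for s
    using sums_unique[OF inner_rho_expansion[OF summable_abs_of_weighted[OF sm[OF s]] summable_abs_of_weighted[OF sm[OF s]] z[OF s] z[OF s]]]
    by (simp add: E_def rep[OF s] power2_eq_square)
  have \<eta>0: "\<eta> 0 = \<eta>\<^sub>0" using sol by (auto simp: classical_solution_def)
  have E0: "inner_rho \<eta>\<^sub>0 \<eta>\<^sub>0 = E 0" using E_inner[of 0] by (simp add: \<eta>0)
  have F0: "inner_rho (\<lambda>\<theta>. - L_op \<eta>\<^sub>0 \<theta>) \<eta>\<^sub>0 = F 0"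
    using inner_rho_L[OF sm z, of 0] rep[of 0] by (simp add: F_def \<eta>0)
  \<comment> \<open>If all coefficients vanished initially, then so would the initial value.\<close>
  have E0_pos: "0 < E 0"
  proof (rule ccontr)
    assume "\<not> 0 < E 0"
    then have "E 0 = 0" using E_nonneg[of 0] by simp
    then have "\<forall>n. (a 0 n)\<^sup>2 = 0" using suminf_eq_zero_iff[OF sq[of 0]] by (simp add: E_def)
    then have "a 0 = (\<lambda>_. 0)" by auto
    then have "\<eta>\<^sub>0 = (\<lambda>\<theta>. 0)"
      using rep[of 0] by (simp add: \<eta>0 expansion_def sine_series_def primitive_coeff_def fun_eq_iff)
    with ne show False by blast
  qed
  have F_nonneg: "0 \<le> F s" if s: "0 \<le> s" for s
  proof -
    have "0 \<le> 2 * Q r" if "0 \<le> r" for r using Q(1)[OF that] E_nonneg[OF that] by linarith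
    from mono_of_nonneg_derivative[OF dF this s] show ?thesis using pos F0 by simp
  qed
  have E_pos: "0 < E s" if s: "0 \<le> s" for s
    using mono_of_nonneg_derivative[OF dE _ s] F_nonneg E0_pos by fastforce
  \<comment> \<open>The coefficients of the growing and of the decaying exponential; \<open>K\<close> is half the derivative of \<open>J\<close>, so that \<open>(J, K)\<close> solves the linear model of the system for \<open>(E, F)\<close>.\<close>
  define P N where "P l = (E 0 + 1 / sqrt l * F 0) / 2" and "N l = (E 0 - 1 / sqrt l * F 0) / 2" for l
  define K where "K l s = sqrt l * (P l * exp (2 * sqrt l * s) - N l * exp (- 2 * sqrt l * s))" for l s
  have J: "J \<eta>\<^sub>0 l = (\<lambda>s. P l * exp (2 * sqrt l * s) + N l * exp (- 2 * sqrt l * s))" for l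
    by (simp only: J_def[abs_def] E0 F0 P_def N_def)
  have PN: "P l + N l = E 0" for l by (simp add: P_def N_def add_divide_distrib[symmetric])
  have PN': "sqrt l * (P l - N l) = F 0" if "0 < l" for l
  proof -
    have "P l - N l = F 0 / sqrt l" by (simp add: P_def N_def diff_divide_distrib[symmetric])
    then show ?thesis using that by simp
  qed
  have J0: "J \<eta>\<^sub>0 l 0 = E 0" "0 < l \<Longrightarrow> K l 0 = F 0" for l
    using PN PN' by (simp_all add: J K_def)
  have dJ: "(J \<eta>\<^sub>0 l has_real_derivative 2 * K l s) (at s within {0..})" for l s
    unfolding J K_def by (auto intro!: derivative_eq_intros simp: algebra_simps)
  have dK: "(K l has_real_derivative 2 * l * J \<eta>\<^sub>0 l s) (at s within {0..})" if "0 < l" for l s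
  proof -
    define c where "c = sqrt l"
    have c: "l = c * c" using that by (simp add: c_def)
    have "((\<lambda>s. c * (P l * exp (2 * c * s) - N l * exp (- 2 * c * s))) has_real_derivative
        2 * (c * c) * (P l * exp (2 * c * s) + N l * exp (- 2 * c * s))) (at s within {0..})"
      by (auto intro!: derivative_eq_intros simp: algebra_simps)
    then show ?thesis
      unfolding J K_def[abs_def] c_def[symmetric] c[symmetric] .
  qed
  have lower: "0 < E t - J \<eta>\<^sub>0 (1 / 10) t"
  proof (rule hyperbolic_comparison[where l = "1 / 10" and z = "\<lambda>s. F s - K (1 / 10) s"
        and z' = "\<lambda>s. 2 * Q s - 2 * (1 / 10) * J \<eta>\<^sub>0 (1 / 10) s", OF _ _ _ _ _ _ t])
    show "((\<lambda>s. E s - J \<eta>\<^sub>0 (1 / 10) s) has_real_derivative 2 * (F s - K (1 / 10) s)) (at s within {0..})" if "0 \<le> s" for s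
      using DERIV_diff[OF dE[OF that] dJ] by (simp add: right_diff_distrib)
    show "((\<lambda>s. F s - K (1 / 10) s) has_real_derivative 2 * Q s - 2 * (1 / 10) * J \<eta>\<^sub>0 (1 / 10) s) (at s within {0..})" if "0 \<le> s" for s
      by (rule DERIV_diff[OF dF[OF that] dK]) simp
    show "2 * (1 / 10) * (E s - J \<eta>\<^sub>0 (1 / 10) s) < 2 * Q s - 2 * (1 / 10) * J \<eta>\<^sub>0 (1 / 10) s" if "0 < s" for s
      using Q(1)[of s] E_pos[of s] that by (simp add: right_diff_distrib)
  qed (simp_all add: J0)
  have upper: "0 < J \<eta>\<^sub>0 1 t - E t"
  proof (rule hyperbolic_comparison[where l = 1 and z = "\<lambda>s. K 1 s - F s"
        and z' = "\<lambda>s. 2 * 1 * J \<eta>\<^sub>0 1 s - 2 * Q s", OF _ _ _ _ _ _ t])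
    show "((\<lambda>s. J \<eta>\<^sub>0 1 s - E s) has_real_derivative 2 * (K 1 s - F s)) (at s within {0..})" if "0 \<le> s" for s
      using DERIV_diff[OF dJ dE[OF that]] by (simp add: right_diff_distrib)
    show "((\<lambda>s. K 1 s - F s) has_real_derivative 2 * 1 * J \<eta>\<^sub>0 1 s - 2 * Q s) (at s within {0..})" if "0 \<le> s" for s
      by (rule DERIV_diff[OF dK dF[OF that]]) simp
    show "2 * 1 * (J \<eta>\<^sub>0 1 s - E s) < 2 * 1 * J \<eta>\<^sub>0 1 s - 2 * Q s" if "0 < s" for s
      using Q(2)[of s] E_pos[of s] that by simp
  qed (simp_all add: J0)
  have J_pos: "0 < J \<eta>\<^sub>0 (1 / 10) t"
  proof -
    define u v where "u = exp (2 * sqrt (1 / 10) * t)" and "v = exp (- 2 * sqrt (1 / 10) * t)"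
    have uv: "0 < v" "v \<le> u" using t by (simp_all add: u_def v_def)
    have "J \<eta>\<^sub>0 (1 / 10) t = E 0 / 2 * (u + v) + 1 / sqrt (1 / 10) * F 0 / 2 * (u - v)"
      unfolding J P_def N_def u_def[symmetric] v_def[symmetric]
      by (simp add: algebra_simps add_divide_distrib diff_divide_distrib)
    moreover have "0 < E 0 / 2 * (u + v)" using E0_pos uv by (intro mult_pos_pos) auto
    moreover have "0 \<le> 1 / sqrt (1 / 10) * F 0 / 2 * (u - v)"
      using F_nonneg[of 0] uv by (intro mult_nonneg_nonneg divide_nonneg_nonneg) auto
    ultimately show ?thesis by linarith
  qed
  have norm: "norm_DW (\<eta> t) = sqrt (E t)" using E_inner[of t] t by (simp add: norm_DW_def)
  show "0 < sqrt (J \<eta>\<^sub>0 (1 / 10) t)" using J_pos by (rule real_sqrt_gt_zero)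
  show "sqrt (J \<eta>\<^sub>0 (1 / 10) t) < norm_DW (\<eta> t)" unfolding norm using lower by (intro real_sqrt_less_mono) simp
  show "norm_DW (\<eta> t) < sqrt (J \<eta>\<^sub>0 1 t)" unfolding norm using upper by (intro real_sqrt_less_mono) simp
qed simp_all

end
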